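(* Let $\zeta$ be a primitive aperiodic substitution on the alphabet $\mathcal A=\{1,\ldots,m\}$, with substitution matrix $\mathsf S$ whose eigenvalues satisfy $$\theta=\theta_1>\theta_2>|\theta_3|\ge\cdots,\qquad \theta_2>1$$ (with $\theta_2$ real). Let $f\in L^2(\mathfrak X_\zeta,\widetilde\mu)$ be a cylindrical function on the self-similar suspension flow $(\mathfrak X_\zeta,h_t,\widetilde\mu)$ with zero mean $\int f\,d\widetilde\mu=0$ and with $m_{\Phi_2^-}(f)\ne0$. Let $\sigma_f$ be the corresponding spectral measure on $\mathbb R$, and let $\alpha=\log_\theta(\theta_2)\in(0,1)$. Then there exists a non-trivial positive $\sigma$-finite Borel measure $\eta$ on $\mathbb R$ such that $$\lim_{N\to\infty}\frac{\sigma_f([-c\theta^{-N},c\theta^{-N}])}{\theta^{-N(2-2\alpha)}}=\eta([-c,c])\quad\text{for all } c>0 \text{ such that } \eta(\{c\})=0.$$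
   Context: Let $m\ge2$, $\mathcal A=\{1,\dots,m\}$, and let $\mathcal A^+$ be the set of nonempty finite words over $\mathcal A$. A substitution is a map $\zeta:\mathcal A\to\mathcal A^+$, extended to words and sequences by concatenation. The substitution matrix $\mathsf S$ is the $m\times m$ matrix with $\mathsf S(i,j)$ = number of symbols $i$ in $\zeta(j)$; $\zeta$ is primitive if some power $\mathsf S^n$ is entrywise strictly positive. $X_\zeta\subset\mathcal A^{\mathbb Z}$ is the set of bi-infinite sequences all of whose finite subwords occur as subwords of $\zeta^n(a)$ for some $a\in\mathcal A$, $n\in\mathbb N$; $T_\zeta$ is the left shift on $X_\zeta$. For primitive $\zeta$, aperiodic means $X_\zeta$ is infinite; $(X_\zeta,T_\zeta)$ is uniquely ergodic. The self-similar suspension flow: let $\vec s=(s_1,\dots,s_m)$ be the (strictly positive) Perron-Frobenius eigenvector of the transpose matrix, $\mathsf S^t\vec s=\theta\vec s$. Then $\mathfrak X_\zeta=\{(y,u):y\in X_\zeta,\ 0\le u\le s_{y_0}\}$ with $(y,s_{y_0})$ identified with $(T_\zeta y,0)$, $h_t$ is the unit-speed vertical flow, and $\widetilde\mu$ is its unique invariant probability measure. For $f\in L^2(\mathfrak X_\zeta,\widetilde\mu)$ the spectral measure $\sigma_f$ is the finite positive Borel measure on $\mathbb R$ with $\int_{\mathbb R}e^{2\pi i\omega t}\,d\sigma_f(\omega)=\langle f\circ h_t,f\rangle$ for all $t\in\mathbb R$. A function $f$ on $\mathfrak X_\zeta$ is cylindrical if there are integrable functions $\psi_j$ on $[0,s_j]$,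 $j\le m$, such that $f(y,t)=\psi_{y_0}(t)$ for $0\le t\le s_{y_0}$. For such $f$, $$m_{\Phi_2^-}(f)=\sum_{j=1}^m(\vec e_2)_j\int_0^{s_j}\psi_j(t)\,dt,$$ where $\vec e_2$ is the (real, nonzero) eigenvector of $\mathsf S$ corresponding to $\theta_2$ (unique up to scaling). *)

theory Defs
  imports "HOL-Probability.Probability" "HOL-Library.Sublist" "Jordan_Normal_Form.Char_Poly"
begin

unbundle no vec_syntax

text \<open>
  The alphabet of \<open>m\<close> letters is \<open>{..<m}\<close> (0-based, to agree with matrix indices), words are lists
  over it, and vectors and matrices are those of \<open>Jordan_Normal_Form\<close>.
\<close>

definition substitution :: "nat \<Rightarrow> (nat \<Rightarrow> nat list) \<Rightarrow> bool" where
  "substitution m \<zeta> \<longleftrightarrow> (\<forall>a<m. \<zeta> a \<noteq> [] \<and> set (\<zeta> a) \<subseteq> {..<m})"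

definition subst_word :: "(nat \<Rightarrow> nat list) \<Rightarrow> nat list \<Rightarrow> nat list" where
  "subst_word \<zeta> w = concat (map \<zeta> w)"

definition subst_matrix :: "nat \<Rightarrow> (nat \<Rightarrow> nat list) \<Rightarrow> real mat" where
  "subst_matrix m \<zeta> = mat m m (\<lambda>(i, j). real (count_list (\<zeta> j) i))"

definition primitive_subst :: "nat \<Rightarrow> (nat \<Rightarrow> nat list) \<Rightarrow> bool" where
  "primitive_subst m \<zeta> \<longleftrightarrow>
     (\<exists>n. \<forall>i<m. \<forall>j<m. (subst_matrix m \<zeta> ^\<^sub>m n) $$ (i, j) > 0)"

definition subst_space :: "nat \<Rightarrow> (nat \<Rightarrow> nat list) \<Rightarrow> (int \<Rightarrow> nat) set" where
  "subst_space m \<zeta> =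
     {x. \<forall>i j. \<exists>a<m. \<exists>n. sublist (map x [i..j]) ((subst_word \<zeta> ^^ n) [a])}"

definition aperiodic_subst :: "nat \<Rightarrow> (nat \<Rightarrow> nat list) \<Rightarrow> bool" where
  "aperiodic_subst m \<zeta> \<longleftrightarrow> infinite (subst_space m \<zeta>)"

text \<open>The eigenvalues of a real matrix in the complex numbers, listed with algebraic multiplicity.\<close>

definition eigenvalue_list :: "real mat \<Rightarrow> complex list \<Rightarrow> bool" where
  "eigenvalue_list A zs \<longleftrightarrow> char_poly (map_mat complex_of_real A) = (\<Prod>z\<leftarrow>zs. [:- z, 1:])"

text \<open>
  The suspension is realized on the representatives \<open>(y, u)\<close> with \<open>0 \<le> u < s\<^sub>y\<^sub>0\<close>: identifying
  \<open>(y, s\<^sub>y\<^sub>0)\<close> with \<open>(T y, 0)\<close> leaves exactly one such point in each class.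
\<close>

definition suspension :: "nat \<Rightarrow> (nat \<Rightarrow> nat list) \<Rightarrow> real vec \<Rightarrow> ((int \<Rightarrow> nat) \<times> real) set" where
  "suspension m \<zeta> s = {(y, u). y \<in> subst_space m \<zeta> \<and> 0 \<le> u \<and> u < s $ y 0}"

text \<open>Only the \<open>\<sigma>\<close>-algebra of this measure space is used; it is the Borel one.\<close>

definition suspension_algebra ::
    "nat \<Rightarrow> (nat \<Rightarrow> nat list) \<Rightarrow> real vec \<Rightarrow> ((int \<Rightarrow> nat) \<times> real) measure" where
  "suspension_algebra m \<zeta> s =
     restrict_space ((\<Pi>\<^sub>M i\<in>UNIV. count_space UNIV) \<Otimes>\<^sub>M borel) (suspension m \<zeta> s)"

text \<open>
  The time at which the vertical flow started at \<open>(y, 0)\<close> arrives at \<open>(T\<^sup>n y, 0)\<close>: at most one of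
  the two sums is nonempty, the second one being for negative \<open>n\<close>.
\<close>

definition return_time :: "real vec \<Rightarrow> (int \<Rightarrow> nat) \<Rightarrow> int \<Rightarrow> real" where
  "return_time s y n = (\<Sum>i\<in>{0..<n}. s $ y i) - (\<Sum>i\<in>{n..<0}. s $ y i)"

definition suspension_flow ::
    "real vec \<Rightarrow> real \<Rightarrow> (int \<Rightarrow> nat) \<times> real \<Rightarrow> (int \<Rightarrow> nat) \<times> real" where
  "suspension_flow s t = (\<lambda>(y, u).
     let n = (THE n. return_time s y n \<le> u + t \<and> u + t < return_time s y (n + 1))
     in (\<lambda>i. y (i + n), u + t - return_time s y n))"

definition invariant_prob ::
    "nat \<Rightarrow> (nat \<Rightarrow> nat list) \<Rightarrow> real vec \<Rightarrow> ((int \<Rightarrow> nat) \<times> real) measure \<Rightarrow> bool" where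
  "invariant_prob m \<zeta> s \<mu> \<longleftrightarrow>
     sets \<mu> = sets (suspension_algebra m \<zeta> s) \<and> prob_space \<mu> \<and>
     (\<forall>t. suspension_flow s t \<in> measurable \<mu> \<mu> \<and> distr \<mu> \<mu> (suspension_flow s t) = \<mu>)"

definition square_integrable :: "'a measure \<Rightarrow> ('a \<Rightarrow> complex) \<Rightarrow> bool" where
  "square_integrable M f \<longleftrightarrow> f \<in> borel_measurable M \<and> integrable M (\<lambda>x. (cmod (f x))\<^sup>2)"

definition spectral_measure ::
    "'a measure \<Rightarrow> (real \<Rightarrow> 'a \<Rightarrow> 'a) \<Rightarrow> ('a \<Rightarrow> complex) \<Rightarrow> real measure \<Rightarrow> bool" where
  "spectral_measure M h f \<sigma> \<longleftrightarrow>
     sets \<sigma> = sets borel \<and> finite_measure \<sigma> \<and>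
     (\<forall>t. (LINT \<omega>|\<sigma>. exp (2 * of_real pi * \<i> * of_real \<omega> * of_real t)) =
          (LINT x|M. f (h t x) * cnj (f x)))"

text \<open>
  \<open>f\<close> is cylindrical with profile functions \<open>\<psi>\<^sub>j\<close>; the value at the endpoint \<open>s\<^sub>j\<close> is not constrained,
  as \<open>(y, s\<^sub>y\<^sub>0)\<close> is represented by \<open>(T y, 0)\<close>.
\<close>

definition cylindrical ::
    "nat \<Rightarrow> (nat \<Rightarrow> nat list) \<Rightarrow> real vec \<Rightarrow> (nat \<Rightarrow> real \<Rightarrow> complex) \<Rightarrow>
     ((int \<Rightarrow> nat) \<times> real \<Rightarrow> complex) \<Rightarrow> bool" where
  "cylindrical m \<zeta> s \<psi> f \<longleftrightarrow>
     (\<forall>j<m. set_integrable lborel {0..s $ j} (\<psi> j)) \<and>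
     (\<forall>(y, t) \<in> suspension m \<zeta> s. f (y, t) = \<psi> (y 0) t)"

text \<open>\<open>m\<^bsub>\<Phi>\<^esub>(f)\<close> for \<open>f\<close> cylindrical with profile functions \<open>\<psi>\<^sub>j\<close>, where \<open>e\<close> is the eigenvector
  defining \<open>\<Phi>\<close>.\<close>

definition m_Phi :: "nat \<Rightarrow> real vec \<Rightarrow> real vec \<Rightarrow> (nat \<Rightarrow> real \<Rightarrow> complex) \<Rightarrow> complex" where
  "m_Phi m s e \<psi> = (\<Sum>j<m. complex_of_real (e $ j) * (LINT t:{0..s $ j}|lborel. \<psi> j t))"

end

theory Submission
  imports Defs "Jordan_Normal_Form.Schur_Decomposition"
begin

text \<open>
  Let \<open>S\<^sub>R f x\<close> be the integral of \<open>f\<close> over the orbit segment of length \<open>R\<close> from \<open>x\<close>. The Fourier transform of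
  \<open>R\<^sup>2 sinc\<^sup>2(\<pi>\<omega>R) d\<sigma>\<^sub>f(\<omega>)\<close> at \<open>t\<close> is the correlation \<open>\<langle>S\<^sub>R f \<circ> h\<^sub>t, S\<^sub>R f\<rangle>\<close>. With \<open>\<theta>\<^sup>N t\<close> and \<open>\<theta>\<^sup>N R\<close> for \<open>t\<close> and \<open>R\<close>, this
  correlation is an ergodic average along substituted words, hence equals the correlation at scale \<open>(t, R)\<close> of
  the tiling whose tile \<open>a\<close> carries the rescaled word \<open>\<zeta>\<^sup>N(a)\<close>. Since \<open>f\<close> has mean zero, the integrals of \<open>f\<close> over
  \<open>\<zeta>\<^sup>N(a)\<close> grow like \<open>\<theta>\<^sub>2\<^sup>N\<close>; divided by \<open>\<theta>\<^sub>2\<^sup>N\<close> they converge, uniformly on each tile because one more substitution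
  contracts by \<open>1/\<theta>\<^sub>2\<close>, and the limit is not zero because its pairing with \<open>e\<^sub>2\<close> is \<open>m\<^sub>\<Phi>(f)\<close>. So the Fourier
  transforms of the rescaled measures, weighted by two Fejer kernels without common zero, converge to a
  function continuous at \<open>0\<close>. By Levy's theorem the weighted measures converge weakly; dividing the limit
  by the weight gives \<open>\<eta>\<close>.
\<close>

text \<open>The total masses of the rescaled measures grow like
  \<open>(\<theta> / \<theta>\<^sub>2) ^ (2 * N)\<close>, which excludes a weak limit of the
  measures themselves. A Fejer weight decays at infinity, and the weighted masses are mean squares
  of normalised orbit integrals, which stay bounded. One kernel vanishes at the nonzero multiples of
  1/R, where dividing by it would lose the limit; hence two kernels whose lengths have an irrational
  ratio. The exponent has two sources: the kernel of length \<theta>^N R brings the factor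
  \<theta>^(2N), and dividing both factors of a correlation by \<open>\<theta>\<^sub>2 ^ N\<close>
  brings \<open>\<theta>\<^sub>2\<close> to the power -2N; together they give 2 - 2\<alpha>. The
  limit is non-trivial because its correlation at t = 0 is positive: by primitivity, a tile on which
  the limit profile has nonzero total recurs with positive frequency. Averages are taken only of
  functions of words that are additive up to a bounded error. For these the spectral gap suffices:
  \<theta> is a simple eigenvalue, and bounded errors become summable after division by
  \<theta>^n.\<close>

section \<open>Convergence of measures on symmetric intervals\<close>

lemma one_minus_exp_mono_bound:
  fixes e x :: real assumes "1 \<le> e * \<bar>x\<bar>" "0 < e"
  shows "1 - exp (- 1 / 2) \<le> 1 - exp (- (e * x)\<^sup>2 / 2)"
proof -
  have "1 \<le> (e * \<bar>x\<bar>)\<^sup>2" using assms by simp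
  also have "\<dots> = (e * x)\<^sup>2" by (simp add: power_mult_distrib)
  finally show ?thesis by simp
qed

text \<open>Averaged against a Gaussian, the characteristic function becomes the integral of a Gaussian
  weight, which is small far out: this controls the tails.\<close>

lemma (in real_distribution) gaussian_average_char:
  fixes e :: real
  shows "(CLINT t|std_normal_distribution. char M (e * t)) = (CLINT x|M. exp (- (e * x)\<^sup>2 / 2))"
proof -
  interpret G: real_distribution std_normal_distribution by (rule real_dist_normal_dist)
  interpret P: pair_sigma_finite M std_normal_distribution ..
  interpret PP: pair_prob_space M std_normal_distribution ..
  have I: "integrable (M \<Otimes>\<^sub>M std_normal_distribution) (\<lambda>(x, t). iexp (e * t * x))"
    by (rule PP.integrable_const_bound[where B = 1]) (auto simp: split_beta')
  have "(CLINT t|std_normal_distribution. char M (e * t)) =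
      (CLINT t|std_normal_distribution. CLINT x|M. iexp (e * t * x))"
    by (simp add: char_def)
  also have "\<dots> = (CLINT x|M. CLINT t|std_normal_distribution. iexp (e * t * x))"
    by (rule P.Fubini_integral[OF I])
  also have "\<dots> = (CLINT x|M. char std_normal_distribution (e * x))"
    by (simp add: char_def mult_ac)
  finally show "(CLINT t|std_normal_distribution. char M (e * t)) = (CLINT x|M. exp (- (e * x)\<^sup>2 / 2))"
    by (simp add: char_std_normal_distribution)
qed

text \<open>Markov's inequality for the nonnegative function 1 - exp(-(e x)^2 / 2), which is at
  least 1 - exp(-1/2) as soon as |x| \<ge> 1/e.\<close>

lemma (in real_distribution) char_tail_bound:
  fixes e :: real assumes e: "0 < e"
  shows "(1 - exp (- 1 / 2 :: real)) * measure M {x. 1 / e \<le> \<bar>x\<bar>} \<le>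
    1 - Re (CLINT t|std_normal_distribution. char M (e * t))"
proof -
  have 1: "Re (CLINT t|std_normal_distribution. char M (e * t)) = (LINT x|M. exp (- (e * x)\<^sup>2 / 2))"
    unfolding gaussian_average_char by (simp del: of_real_exp)
  have i: "integrable M (\<lambda>x. exp (- (e * x)\<^sup>2 / 2))"
    by (rule integrable_const_bound[where B = 1]) auto
  have "(1 - exp (- 1 / 2 :: real)) * measure M {x. 1 / e \<le> \<bar>x\<bar>} =
      (LINT x|M. (1 - exp (- 1 / 2 :: real)) * indicator {x. 1 / e \<le> \<bar>x\<bar>} x)"
    by simp
  also have "\<dots> \<le> (LINT x|M. 1 - exp (- (e * x)\<^sup>2 / 2))"
  proof (rule integral_mono)
    show "integrable M (\<lambda>x. (1 - exp (- 1 / 2 :: real)) * indicator {x. 1 / e \<le> \<bar>x\<bar>} x)"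
      by (rule integrable_const_bound[where B = 1]) (auto simp: indicator_def)
    show "integrable M (\<lambda>x. 1 - exp (- (e * x)\<^sup>2 / 2))" using i by auto
    show "(1 - exp (- 1 / 2 :: real)) * indicator {x. 1 / e \<le> \<bar>x\<bar>} x \<le> 1 - exp (- (e * x)\<^sup>2 / 2)" for x
      using one_minus_exp_mono_bound[of e x] e by (auto simp: indicator_def field_simps)
  qed
  also have "\<dots> = 1 - Re (CLINT t|std_normal_distribution. char M (e * t))"
    unfolding 1 using i prob_space by simp
  finally show ?thesis .
qed

text \<open>Continuity at 0 makes the Gaussian averages of \<phi> at scale e tend to 1 as e tends to
  0. For one fixed small e, dominated convergence transfers this to \<open>char (M n)\<close> for
  all large n, and \<open>char_tail_bound\<close> turns it into a common tail estimate.\<close>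

lemma tight_if_char_converges:
  fixes M :: "nat \<Rightarrow> real measure" and \<phi> :: "real \<Rightarrow> complex"
  assumes M: "\<And>n. real_distribution (M n)"
    and conv: "\<And>t. (\<lambda>n. char (M n) t) \<longlonglongrightarrow> \<phi> t"
    and cont: "isCont \<phi> 0"
  shows "tight M"
  unfolding tight_def
proof (intro conjI allI impI M)
  fix d :: real assume d: "d > 0"
  interpret M: real_distribution "M n" for n by (rule M)
  interpret G: real_distribution std_normal_distribution by (rule real_dist_normal_dist)
  define k where "k = 1 - exp (- 1 / 2 :: real)"
  have k: "k > 0" by (simp add: k_def)
  have b\<phi>: "norm (\<phi> t) \<le> 1" for t
    by (rule LIMSEQ_le_const2[OF tendsto_norm[OF conv]]) (auto intro!: exI[of _ 0] M.cmod_char_le_1)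
  have \<phi>0: "\<phi> 0 = 1"
    using conv[of 0] by (auto simp: M.char_zero intro: LIMSEQ_unique)
  have [measurable]: "\<phi> \<in> borel_measurable borel"
    by (rule borel_measurable_LIMSEQ_metric[OF _ conv]) (auto intro: M.char_measurable)
  have "(\<lambda>j. CLINT t|std_normal_distribution. \<phi> (1 / Suc j * t)) \<longlonglongrightarrow> (CLINT t|std_normal_distribution. 1)"
  proof (rule integral_dominated_convergence[where w = "\<lambda>_. 1"])
    show "AE t in std_normal_distribution. (\<lambda>j. \<phi> (1 / Suc j * t)) \<longlonglongrightarrow> 1"
    proof (rule AE_I2)
      fix t :: real
      have "(\<lambda>j. 1 / Suc j * t) \<longlonglongrightarrow> 0 * t"
        by (intro tendsto_mult tendsto_const) (use LIMSEQ_inverse_real_of_nat in \<open>simp add: inverse_eq_divide\<close>)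
      then show "(\<lambda>j. \<phi> (1 / Suc j * t)) \<longlonglongrightarrow> 1"
        using isCont_tendsto_compose[OF cont] \<phi>0 by simp
    qed
  qed (auto intro!: AE_I2 b\<phi>)
  then have "(\<lambda>j. 1 - Re (CLINT t|std_normal_distribution. \<phi> (1 / Suc j * t))) \<longlonglongrightarrow> 1 - Re (CLINT t|std_normal_distribution. 1)"
    by (intro tendsto_intros)
  then have "(\<lambda>j. 1 - Re (CLINT t|std_normal_distribution. \<phi> (1 / Suc j * t))) \<longlonglongrightarrow> 0"
    using G.prob_space by simp
  then have "\<forall>\<^sub>F j in sequentially. 1 - Re (CLINT t|std_normal_distribution. \<phi> (1 / Suc j * t)) < d * k / 2"
    by (rule order_tendstoD) (use d k in simp)
  then obtain j :: nat where j: "1 - Re (CLINT t|std_normal_distribution. \<phi> (1 / Suc j * t)) < d * k / 2"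
    by (auto simp: eventually_sequentially)
  define e where "e = 1 / real (Suc j)"
  have e: "e > 0" by (simp add: e_def)
  have "(\<lambda>n. CLINT t|std_normal_distribution. char (M n) (e * t)) \<longlonglongrightarrow> (CLINT t|std_normal_distribution. \<phi> (e * t))"
    by (rule integral_dominated_convergence[where w = "\<lambda>_. 1"])
       (auto intro!: AE_I2 conv M.cmod_char_le_1)
  then have "(\<lambda>n. 1 - Re (CLINT t|std_normal_distribution. char (M n) (e * t))) \<longlonglongrightarrow>
      1 - Re (CLINT t|std_normal_distribution. \<phi> (e * t))"
    by (intro tendsto_intros)
  then have "\<forall>\<^sub>F n in sequentially. 1 - Re (CLINT t|std_normal_distribution. char (M n) (e * t)) < d * k"
    by (rule order_tendstoD) (use j mult_pos_pos[OF d k] in \<open>simp add: e_def\<close>)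
  then obtain N where N: "\<And>n. n \<ge> N \<Longrightarrow> 1 - Re (CLINT t|std_normal_distribution. char (M n) (e * t)) < d * k"
    by (auto simp: eventually_sequentially)
  have large: "measure (M n) {x. 1 / e \<le> \<bar>x\<bar>} < d" if "n \<ge> N" for n
  proof -
    have "k * measure (M n) {x. 1 / e \<le> \<bar>x\<bar>} < k * d"
      using M.char_tail_bound[OF e, of n] N[OF that] unfolding k_def by (simp only: mult.commute[of d])
    then show ?thesis using k by simp
  qed
  \<comment> \<open>A single distribution has small tails anyway; this serves the finitely many n <
    N.\<close>
  have "\<forall>n. \<exists>K::nat. measure (M n) {x. real K \<le> \<bar>x\<bar>} < d"
  proof
    fix n
    have "(\<lambda>K::nat. measure (M n) {x. real K \<le> \<bar>x\<bar>}) \<longlonglongrightarrow> measure (M n) (\<Inter>K::nat. {x. real K \<le> \<bar>x\<bar>})"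
      by (rule M.finite_Lim_measure_decseq) (auto simp: decseq_def)
    also have "(\<Inter>K::nat. {x. real K \<le> \<bar>x\<bar>}) = {}"
    proof -
      have "\<exists>K::nat. \<not> real K \<le> \<bar>x\<bar>" for x :: real
        using reals_Archimedean2[of "\<bar>x\<bar>"] by (auto simp: not_le)
      then show ?thesis by blast
    qed
    finally have "\<forall>\<^sub>F K in sequentially. measure (M n) {x. real K \<le> \<bar>x\<bar>} < d"
      using d by (auto dest: order_tendstoD)
    then show "\<exists>K::nat. measure (M n) {x. real K \<le> \<bar>x\<bar>} < d" by (auto simp: eventually_sequentially)
  qed
  then obtain K :: "nat \<Rightarrow> nat" where K: "\<And>n. measure (M n) {x. real (K n) \<le> \<bar>x\<bar>} < d" by metis
  define L where "L = Max (insert (1 / e) ((\<lambda>n. real (K n)) ` {..<N})) + 1"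
  have "y < L" if "y \<in> insert (1 / e) ((\<lambda>n. real (K n)) ` {..<N})" for y
    using Max_ge[OF _ that] unfolding L_def by fastforce
  then have L: "1 / e < L" "n < N \<Longrightarrow> real (K n) < L" for n
    by auto
  have *: "measure (M n) {x. L \<le> \<bar>x\<bar>} < d" for n
  proof (cases "n < N")
    case True
    have "measure (M n) {x. L \<le> \<bar>x\<bar>} \<le> measure (M n) {x. real (K n) \<le> \<bar>x\<bar>}"
      using L(2)[OF True] by (intro M.finite_measure_mono) auto
    with K[of n] show ?thesis by simp
  next
    case False
    have "measure (M n) {x. L \<le> \<bar>x\<bar>} \<le> measure (M n) {x. 1 / e \<le> \<bar>x\<bar>}"
      using L(1) by (intro M.finite_measure_mono) auto
    with large[of n] False show ?thesis by simp
  qed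
  have "0 < L" using L(1) e by (smt (verit) divide_pos_pos)
  have "1 - d < measure (M n) {- L <.. L}" for n
  proof -
    have "1 - measure (M n) {x. L \<le> \<bar>x\<bar>} = measure (M n) (space (M n) - {x. L \<le> \<bar>x\<bar>})"
      by (rule M.prob_compl[symmetric]) auto
    also have "\<dots> \<le> measure (M n) {- L <.. L}"
      by (intro M.finite_measure_mono) auto
    finally show ?thesis using *[of n] by simp
  qed
  then show "\<exists>a b. a < b \<and> (\<forall>n. 1 - d < measure (M n) {a<..b})"
    using \<open>0 < L\<close> by (intro exI[of _ "- L"] exI[of _ L]) auto
qed

text \<open>Tightness gives a weak limit along a subsequence. Its characteristic function has to be
  \<phi>, so \<phi> is a characteristic function and Levy continuity applies to the whole
  sequence.\<close>

lemma weak_limit_if_char_converges: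
  fixes M :: "nat \<Rightarrow> real measure" and \<phi> :: "real \<Rightarrow> complex"
  assumes M: "\<And>n. real_distribution (M n)"
    and conv: "\<And>t. (\<lambda>n. char (M n) t) \<longlonglongrightarrow> \<phi> t"
    and cont: "isCont \<phi> 0"
  obtains M' where "real_distribution M'" "char M' = \<phi>" "weak_conv_m M M'"
proof -
  have "tight M" by (rule tight_if_char_converges[OF assms])
  from tight_imp_convergent_subsubsequence[OF this strict_mono_id]
  obtain r M' where r: "strict_mono (r :: nat \<Rightarrow> nat)" "real_distribution M'" "weak_conv_m (M \<circ> id \<circ> r) M'" by blast
  have "char M' = \<phi>"
  proof
    fix t
    have "(\<lambda>n. char ((M \<circ> id \<circ> r) n) t) \<longlonglongrightarrow> char M' t"
      using M by (intro levy_continuity1 r) auto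
    moreover have "(\<lambda>n. char ((M \<circ> id \<circ> r) n) t) \<longlonglongrightarrow> \<phi> t"
      using LIMSEQ_subseq_LIMSEQ[OF conv[of t] r(1)] by (simp add: o_def)
    ultimately show "char M' t = \<phi> t" by (rule LIMSEQ_unique)
  qed
  moreover then have "weak_conv_m M M'" using conv by (intro levy_continuity M r) auto
  ultimately show thesis using that r(2) by blast
qed

text \<open>Intervals \<open>[-c, c]\<close> only see the even part of a measure. For even measures the characteristic
  function is real and even, so its values at \<open>t \<ge> 0\<close> suffice, and a limit without atom at \<open>c\<close> has none
  at \<open>-c\<close> either.\<close>

definition symmetrized :: "real measure \<Rightarrow> real measure" where
  "symmetrized \<nu> =
     distr (\<nu> \<Otimes>\<^sub>M measure_pmf (bernoulli_pmf (1 / 2))) borel (\<lambda>(x, b). if b then x else - x)"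

lemma sets_symmetrized [simp, measurable_cong]: "sets (symmetrized \<nu>) = sets borel"
  by (simp add: symmetrized_def)

lemma space_symmetrized [simp]: "space (symmetrized \<nu>) = UNIV"
  by (simp add: symmetrized_def)

lemma finite_measure_symmetrized:
  assumes "finite_measure \<nu>" and [measurable_cong, simp]: "sets \<nu> = sets borel"
  shows "finite_measure (symmetrized \<nu>)"
proof -
  interpret finite_measure \<nu> by fact
  interpret B: prob_space "measure_pmf (bernoulli_pmf (1 / 2))" by (rule measure_pmf.prob_space_axioms)
  have "finite_measure (\<nu> \<Otimes>\<^sub>M measure_pmf (bernoulli_pmf (1 / 2)))"
    by (rule finite_measure_pair_measure) unfold_locales
  then show ?thesis unfolding symmetrized_def
    by (rule finite_measure.finite_measure_distr) measurable
qed

lemma integral_symmetrized: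
  fixes g :: "real \<Rightarrow> 'a :: {banach, second_countable_topology}"
  assumes "finite_measure \<nu>" and [measurable_cong, simp]: "sets \<nu> = sets borel"
    and [measurable]: "g \<in> borel_measurable borel" and B: "\<And>x. norm (g x) \<le> B"
  shows "(LINT x|symmetrized \<nu>. g x) = (1 / 2) *\<^sub>R ((LINT x|\<nu>. g x) + (LINT x|\<nu>. g (- x)))"
proof -
  interpret finite_measure \<nu> by fact
  interpret B: prob_space "measure_pmf (bernoulli_pmf (1 / 2))" by (rule measure_pmf.prob_space_axioms)
  interpret P: pair_sigma_finite \<nu> "measure_pmf (bernoulli_pmf (1 / 2))" ..
  interpret PF: finite_measure "\<nu> \<Otimes>\<^sub>M measure_pmf (bernoulli_pmf (1 / 2))"
    by (rule finite_measure_pair_measure) unfold_locales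
  have i: "integrable \<nu> g" "integrable \<nu> (\<lambda>x. g (- x))"
    by (rule integrable_const_bound[where B = B]; simp add: B)+
  have I: "integrable (\<nu> \<Otimes>\<^sub>M measure_pmf (bernoulli_pmf (1 / 2))) (\<lambda>p. g (if snd p then fst p else - fst p))"
    by (rule PF.integrable_const_bound[where B = B]) (auto simp: B split_beta')
  have "(LINT x|symmetrized \<nu>. g x) =
      (LINT p|(\<nu> \<Otimes>\<^sub>M measure_pmf (bernoulli_pmf (1 / 2))). g (if snd p then fst p else - fst p))"
    unfolding symmetrized_def by (subst integral_distr) (auto simp: split_beta')
  also have "\<dots> = (LINT x|\<nu>. LINT b|measure_pmf (bernoulli_pmf (1 / 2)). g (if b then x else - x))"
    using P.integral_fst'[OF I, symmetric] by (simp only: fst_conv snd_conv)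
  also have "\<dots> = (LINT x|\<nu>. (1 / 2) *\<^sub>R (g x + g (- x)))"
    by (subst integral_measure_pmf[of UNIV]) (auto simp: UNIV_bool algebra_simps)
  finally show ?thesis using i by simp
qed

text \<open>The masses of the measures \<open>\<nu> n\<close> may be unbounded, but those of w
  d\<nu> converge to \<open>\<phi> 0\<close>. Since w is continuous and positive, 1 / w is bounded
  on compact intervals; so weak convergence of the weighted probability measures still determines
  the unweighted mass of an interval.\<close>

lemma vague_limit_measure_aux:
  fixes \<nu> :: "nat \<Rightarrow> real measure" and w \<phi> :: "real \<Rightarrow> real"
  assumes fin: "\<And>n. finite_measure (\<nu> n)" and sets_\<nu> [measurable_cong, simp]: "\<And>n. sets (\<nu> n) = sets borel"
    and w_cont: "continuous_on UNIV w" and w_pos: "\<And>x. 0 < w x" and w_bd: "\<And>x. w x \<le> B"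
    and w_even: "\<And>x. w (- x) = w x"
    and conv: "\<And>t. 0 \<le> t \<Longrightarrow> (\<lambda>n. Re (CLINT x|\<nu> n. iexp (t * x) * w x)) \<longlonglongrightarrow> \<phi> t"
    and cont: "(\<phi> \<longlongrightarrow> \<phi> 0) (at_right 0)" and pos: "0 < \<phi> 0"
    and Z: "\<And>n. 0 < (LINT x|\<nu> n. w x)"
  shows "\<exists>\<eta> :: real measure. sets \<eta> = sets borel \<and> sigma_finite_measure \<eta> \<and> emeasure \<eta> UNIV \<noteq> 0 \<and>
    (\<forall>c>0. emeasure \<eta> {c} = 0 \<longrightarrow> (\<lambda>n. ennreal (measure (\<nu> n) {- c..c})) \<longlonglongrightarrow> emeasure \<eta> {- c..c})"
proof -
  have [measurable]: "w \<in> borel_measurable borel"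
    by (rule borel_measurable_continuous_onI[OF w_cont])
  have w_abs: "\<bar>w x\<bar> \<le> B" for x using w_pos[of x] w_bd[of x] by simp
  define S where "S n = symmetrized (\<nu> n)" for n
  have fS: "finite_measure (S n)" for n
    unfolding S_def by (rule finite_measure_symmetrized[OF fin]) simp
  interpret S: finite_measure "S n" for n by (rule fS)
  have sS [measurable_cong, simp]: "sets (S n) = sets borel" and [simp]: "space (S n) = UNIV" for n
    by (simp_all add: S_def)
  define Z where "Z n = (LINT x|S n. w x)" for n
  define Z where "Z n = (LINT x|S n. w x)" for n
  have intS: "(LINT x|S n. g x) = (1 / 2) *\<^sub>R ((LINT x|\<nu> n. g x) + (LINT x|\<nu> n. g (- x)))"
    if "g \<in> borel_measurable borel" "\<And>x. norm (g x) \<le> C"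
    for g :: "real \<Rightarrow> 'b :: {banach, second_countable_topology}" and C n
    unfolding S_def by (rule integral_symmetrized[OF fin _ that]) simp
  have Z_eq: "Z n = (LINT x|\<nu> n. w x)" for n
    unfolding Z_def S_def by (subst integral_symmetrized[OF fin sets_\<nu>, of w B]) (simp_all add: w_abs w_even)
  have Z_pos: "0 < Z n" for n using \<open>\<And>n. 0 < (LINT x|\<nu> n. w x)\<close> by (simp add: Z_eq)
  have wZ: "0 \<le> w x / Z n" for x n
    using w_pos[of x] Z_pos[of n] by simp
  define M where "M n = density (S n) (\<lambda>x. ennreal (w x / Z n))" for n
  have sM [measurable_cong, simp]: "sets (M n) = sets borel" for n by (simp add: M_def)
  have iw: "integrable (S n) w" for n
    by (rule S.integrable_const_bound[where B = B]) (simp_all add: w_abs)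
  have M: "real_distribution (M n)" for n
  proof -
    have "emeasure (M n) (space (M n)) = (\<integral>\<^sup>+ x. ennreal (w x / Z n) \<partial>S n)"
      by (simp add: M_def emeasure_density)
    also have "\<dots> = ennreal (LINT x|S n. w x / Z n)"
      using wZ iw by (intro nn_integral_eq_integral AE_I2) auto
    also have "(LINT x|S n. w x / Z n) = 1"
      using Z_pos[of n] by (simp add: Z_def)
    finally have "prob_space (M n)" by (intro prob_spaceI) simp
    then show ?thesis by (auto simp: real_distribution_def real_distribution_axioms_def)
  qed
  interpret M: real_distribution "M n" for n by (rule M)
  have intM_complex: "(CLINT x|M n. g x) = (CLINT x|S n. (w x / Z n) *\<^sub>R g x)"
    and intM_real: "(LINT x|M n. h x) = (LINT x|S n. (w x / Z n) *\<^sub>R h x)"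
    if [measurable]: "g \<in> borel_measurable borel" "h \<in> borel_measurable borel"
    for g :: "real \<Rightarrow> complex" and h :: "real \<Rightarrow> real" and n
    unfolding M_def by (intro integral_density AE_I2 wZ; measurable)+
  have char_M: "char (M n) t = complex_of_real (Re (CLINT x|\<nu> n. iexp (\<bar>t\<bar> * x) * w x) / Z n)" for n t
  proof -
    interpret \<nu>: finite_measure "\<nu> n" by (rule fin)
    have i: "integrable (\<nu> n) (\<lambda>x. iexp (r * x) * w x)" for r
      by (rule \<nu>.integrable_const_bound[where B = B]) (auto simp: norm_mult w_abs)
    have bd: "norm ((w x / Z n) *\<^sub>R iexp (t * x)) \<le> B / Z n" for x
      using w_abs[of x] Z_pos[of n] by (simp add: divide_right_mono)
    have "char (M n) t = (CLINT x|S n. (w x / Z n) *\<^sub>R iexp (t * x))"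
      unfolding char_def by (rule intM_complex) measurable
    also have "\<dots> = (1 / 2) *\<^sub>R ((CLINT x|\<nu> n. (w x / Z n) *\<^sub>R iexp (t * x)) +
        (CLINT x|\<nu> n. (w (- x) / Z n) *\<^sub>R iexp (t * (- x))))"
      unfolding S_def by (rule integral_symmetrized[OF fin sets_\<nu> _ bd]) measurable
    also have "(CLINT x|\<nu> n. (w x / Z n) *\<^sub>R iexp (t * x)) = (CLINT x|\<nu> n. iexp (t * x) * w x) / Z n"
      unfolding integral_divide_zero[symmetric]
      by (rule Bochner_Integration.integral_cong) (simp_all add: scaleR_conv_of_real)
    also have "(CLINT x|\<nu> n. (w (- x) / Z n) *\<^sub>R iexp (t * (- x))) = cnj (CLINT x|\<nu> n. iexp (t * x) * w x) / Z n"
      unfolding Bochner_Integration.integral_cnj[symmetric] integral_divide_zero[symmetric]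
      by (rule Bochner_Integration.integral_cong) (simp_all add: scaleR_conv_of_real w_even exp_cnj)
    also have "(1 / 2) *\<^sub>R ((CLINT x|\<nu> n. iexp (t * x) * w x) / Z n + cnj (CLINT x|\<nu> n. iexp (t * x) * w x) / Z n)
        = complex_of_real (Re (CLINT x|\<nu> n. iexp (t * x) * w x) / Z n)"
      by (simp add: complex_eq_iff scaleR_conv_of_real add_divide_distrib[symmetric] complex_add_cnj)
    also have "Re (CLINT x|\<nu> n. iexp (t * x) * w x) = Re (CLINT x|\<nu> n. iexp (\<bar>t\<bar> * x) * w x)"
    proof (cases "t \<ge> 0")
      case False
      have "(CLINT x|\<nu> n. iexp (\<bar>t\<bar> * x) * w x) = cnj (CLINT x|\<nu> n. iexp (t * x) * w x)"
        unfolding Bochner_Integration.integral_cnj[symmetric] using False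
        by (intro Bochner_Integration.integral_cong) (simp_all add: exp_cnj)
      then show ?thesis by simp
    qed simp
    finally show ?thesis .
  qed
  have Z_lim: "Z \<longlonglongrightarrow> \<phi> 0"
  proof -
    have "Re (CLINT x|\<nu> n. iexp (0 * x) * w x) = Z n" for n
      by (simp add: Z_eq)
    then show ?thesis using conv[of 0] by simp
  qed
  have char_lim: "(\<lambda>n. char (M n) t) \<longlonglongrightarrow> complex_of_real (\<phi> \<bar>t\<bar> / \<phi> 0)" for t
    unfolding char_M using conv[of "\<bar>t\<bar>"] Z_lim pos by (intro tendsto_intros) auto
  have "isCont (\<lambda>t. complex_of_real (\<phi> \<bar>t\<bar> / \<phi> 0)) 0"
  proof -
    have "((\<lambda>t. \<phi> \<bar>t\<bar>) \<longlongrightarrow> \<phi> 0) (at 0)"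
    proof (rule filterlim_compose[OF cont])
      show "filterlim (\<lambda>t::real. \<bar>t\<bar>) (at_right 0) (at 0)"
        unfolding filterlim_at
        by (auto intro!: tendsto_eq_intros simp: eventually_at_filter)
    qed
    then have "((\<lambda>t. complex_of_real (\<phi> \<bar>t\<bar> / \<phi> 0)) \<longlongrightarrow> complex_of_real (\<phi> 0 / \<phi> 0)) (at 0)"
      using pos by (intro tendsto_intros) auto
    then show ?thesis by (simp only: isCont_def abs_zero)
  qed
  from weak_limit_if_char_converges[OF M char_lim this]
  obtain M' where M': "real_distribution M'" "char M' = (\<lambda>t. complex_of_real (\<phi> \<bar>t\<bar> / \<phi> 0))" "weak_conv_m M M'" .
  interpret M': real_distribution M' by (rule M'(1))
  have M'_sym: "distr M' borel uminus = M'"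
  proof (rule Levy_uniqueness[OF _ M'(1)])
    show "real_distribution (distr M' borel uminus)"
      by (rule M'.real_distribution_distr) simp
    have "char (distr M' borel uminus) t = char M' (- t)" for t
      unfolding char_def by (subst integral_distr) auto
    then show "char (distr M' borel uminus) = char M'" unfolding M'(2) by auto
  qed
  \<comment> \<open>\<open>M n\<close> has density w / Z with Z tending to \<open>\<phi> 0\<close>;
    this factor undoes the weight and the normalisation in the limit.\<close>
  define \<eta> where "\<eta> = density M' (\<lambda>x. ennreal (\<phi> 0 / w x))"
  have s\<eta>: "sets \<eta> = sets borel" by (simp add: \<eta>_def)
  have nz: "ennreal (\<phi> 0 / w x) \<noteq> 0" for x using pos w_pos[of x] by (simp add: ennreal_eq_0_iff not_le)
  have sf: "sigma_finite_measure \<eta>"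
    unfolding \<eta>_def by (subst M'.sigma_finite_iff_density_finite) auto
  have nontrivial: "emeasure \<eta> UNIV \<noteq> 0"
  proof
    assume "emeasure \<eta> UNIV = 0"
    then have "AE x in M'. ennreal (\<phi> 0 / w x) = 0"
      unfolding \<eta>_def by (subst (asm) emeasure_density) (auto simp: nn_integral_0_iff_AE)
    then have "AE x in M'. False" using nz by simp
    then show False by simp
  qed
  have "(\<lambda>n. ennreal (measure (\<nu> n) {- c..c})) \<longlonglongrightarrow> emeasure \<eta> {- c..c}"
    if c: "c > 0" and atom: "emeasure \<eta> {c} = 0" for c
  proof -
    \<comment> \<open>\<open>Z n\<close> times the integral of h against \<open>M n\<close> is the
      mass of [-c, c]. The function h is bounded and can jump only at c and -c, which carry no mass
      of M'.\<close>
    define h where "h x = indicator {- c..c} x / w x" for x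
    have [measurable]: "h \<in> borel_measurable borel" unfolding h_def by measurable
    have "continuous_on {- c..c} (\<lambda>x. 1 / w x)"
      using w_pos by (intro continuous_intros continuous_on_subset[OF w_cont]) (auto simp: less_imp_neq[symmetric])
    from compact_imp_bounded[OF compact_continuous_image[OF this compact_Icc]]
    obtain C0 where "\<forall>x\<in>{- c..c}. norm (1 / w x) \<le> C0" by (auto simp: bounded_iff)
    then have h_bd: "norm (h x) \<le> max C0 0" for x
    proof (cases "x \<in> {- c..c}")
      case True
      then have "norm (1 / w x) \<le> C0" using \<open>\<forall>x\<in>{- c..c}. norm (1 / w x) \<le> C0\<close> by blast
      then show ?thesis using True by (simp add: h_def)
    qed (simp add: h_def)
    have "AE x in M'. ennreal (\<phi> 0 / w x) * indicator {c} x = 0"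
    proof (subst nn_integral_0_iff_AE[symmetric])
      have "emeasure \<eta> {c} = (\<integral>\<^sup>+ x. ennreal (\<phi> 0 / w x) * indicator {c} x \<partial>M')"
        unfolding \<eta>_def by (rule emeasure_density) measurable
      then show "(\<integral>\<^sup>+ x. ennreal (\<phi> 0 / w x) * indicator {c} x \<partial>M') = 0" using atom by (rule trans[OF sym])
    qed measurable
    then have AEc: "AE x in M'. x \<noteq> c"
    proof (rule AE_mp, intro AE_I2 impI notI)
      fix x assume "ennreal (\<phi> 0 / w x) * indicator {c} x = 0" "x = c"
      then show False using nz[of c] by simp
    qed
    have "AE x in distr M' borel uminus. x \<noteq> c" unfolding M'_sym by (rule AEc)
    then have AEc': "AE x in M'. - x \<noteq> c"
      by (subst (asm) AE_distr_iff) auto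
    have null: "M' {x. \<not> isCont h x} = 0"
    proof -
      have "isCont h x" if "x \<noteq> c" "- x \<noteq> c" for x
      proof (cases "x \<in> {- c<..<c}")
        case True
        have "continuous_on {- c<..<c} (\<lambda>x. 1 / w x)"
          by (rule continuous_on_subset[OF \<open>continuous_on {- c..c} (\<lambda>x. 1 / w x)\<close>]) auto
        then have "continuous_on {- c<..<c} h"
          by (rule continuous_on_eq) (auto simp: h_def indicator_def)
        with True show ?thesis by (auto simp: continuous_on_eq_continuous_at)
      next
        case False
        then have "x \<in> - {- c..c}" using that by auto
        moreover have "continuous_on (- {- c..c}) h"
          by (rule continuous_on_eq[where f = "\<lambda>_. 0"]) (auto simp: h_def indicator_def)
        moreover have "open (- {- c..c})" by auto
        ultimately show ?thesis by (auto simp: continuous_on_eq_continuous_at)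
      qed
      then have "x = c \<or> x = - c" if "\<not> isCont h x" for x using that by (metis minus_minus)
      then have sub: "{x. \<not> isCont h x} \<subseteq> {c, - c}" by auto
      have "AE x in M'. x \<notin> {c, - c}" using AEc AEc' by eventually_elim auto
      then have "M' {c, - c} = 0"
        by (subst (asm) AE_iff_measurable[where N = "{c, - c}"]) auto
      then show ?thesis using emeasure_mono[OF sub, of M'] by simp
    qed
    have "(\<lambda>n. LINT x|M n. h x) \<longlonglongrightarrow> (LINT x|M'. h x)"
      by (rule weak_conv_imp_bdd_ae_continuous_conv[OF M M'(1,3) null h_bd]) simp
    then have "(\<lambda>n. Z n * (LINT x|M n. h x)) \<longlonglongrightarrow> \<phi> 0 * (LINT x|M'. h x)"
      by (intro tendsto_mult Z_lim)
    moreover have "Z n * (LINT x|M n. h x) = measure (\<nu> n) {- c..c}" for n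
    proof -
      have "Z n * (LINT x|M n. h x) = Z n * (LINT x|S n. (w x / Z n) * h x)"
        by (subst intM_real[of "\<lambda>_. 0" h]) auto
      also have "\<dots> = (LINT x|S n. indicator {- c..c} x)"
        using Z_pos[of n] w_pos unfolding h_def
        by (subst integral_mult_right_zero[symmetric], intro Bochner_Integration.integral_cong)
          (simp_all add: less_imp_neq[THEN not_sym])
      also have "\<dots> = measure (\<nu> n) {- c..c}"
      proof -
        have e: "indicator {- c..c} (- x) = (indicator {- c..c} x :: real)" for x
          by (auto simp: indicator_def)
        have "space (\<nu> n) = UNIV" using sets_eq_imp_space_eq[OF sets_\<nu>] by simp
        moreover have "(LINT x|S n. indicator {- c..c} x) =
            (1 / 2) *\<^sub>R ((LINT x|\<nu> n. indicator {- c..c} x) + (LINT x|\<nu> n. (indicator {- c..c} (- x) :: real)))"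
          unfolding S_def by (rule integral_symmetrized[OF fin sets_\<nu>, where B = 1]) (simp_all add: indicator_def)
        ultimately show ?thesis unfolding e by simp
      qed
      finally show ?thesis .
    qed
    ultimately have "(\<lambda>n. measure (\<nu> n) {- c..c}) \<longlonglongrightarrow> \<phi> 0 * (LINT x|M'. h x)" by simp
    moreover have "emeasure \<eta> {- c..c} = ennreal (\<phi> 0 * (LINT x|M'. h x))"
    proof -
      have "emeasure \<eta> {- c..c} = (\<integral>\<^sup>+ x. ennreal (\<phi> 0 * h x) \<partial>M')"
        unfolding \<eta>_def by (subst emeasure_density) (auto intro!: nn_integral_cong simp: h_def indicator_def)
      also have "\<dots> = ennreal (LINT x|M'. \<phi> 0 * h x)"
      proof (rule nn_integral_eq_integral)
        have "integrable M' h" by (rule M'.integrable_const_bound[where B = "max C0 0"]) (use h_bd in auto)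
        then show "integrable M' (\<lambda>x. \<phi> 0 * h x)" by simp
        show "AE x in M'. 0 \<le> \<phi> 0 * h x"
          using pos w_pos by (auto intro!: AE_I2 simp: h_def less_imp_le)
      qed
      finally show ?thesis by simp
    qed
    ultimately show ?thesis by (simp add: tendsto_ennrealI)
  qed
  then show ?thesis
    by (intro exI[of _ \<eta>] conjI s\<eta> sf nontrivial allI impI)
qed

text \<open>The weighted masses converge to \<open>\<phi> 0\<close>, hence are positive from some
  index on; dropping the first terms reduces to the lemma above.\<close>

lemma vague_limit_measure:
  fixes \<nu> :: "nat \<Rightarrow> real measure" and w \<phi> :: "real \<Rightarrow> real"
  assumes fin: "\<And>n. finite_measure (\<nu> n)" and sets_\<nu>: "\<And>n. sets (\<nu> n) = sets borel"
    and w: "continuous_on UNIV w" "\<And>x. 0 < w x" "\<And>x. w x \<le> B" "\<And>x. w (- x) = w x"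
    and conv: "\<And>t. 0 \<le> t \<Longrightarrow> (\<lambda>n. Re (CLINT x|\<nu> n. iexp (t * x) * w x)) \<longlonglongrightarrow> \<phi> t"
    and cont: "(\<phi> \<longlongrightarrow> \<phi> 0) (at_right 0)" and pos: "0 < \<phi> 0"
  shows "\<exists>\<eta> :: real measure. sets \<eta> = sets borel \<and> sigma_finite_measure \<eta> \<and> emeasure \<eta> UNIV \<noteq> 0 \<and>
    (\<forall>c>0. emeasure \<eta> {c} = 0 \<longrightarrow> (\<lambda>n. ennreal (measure (\<nu> n) {- c..c})) \<longlonglongrightarrow> emeasure \<eta> {- c..c})"
proof -
  have "Re (CLINT x|\<nu> n. iexp (0 * x) * w x) = (LINT x|\<nu> n. w x)" for n
    by simp
  then have "(\<lambda>n. LINT x|\<nu> n. w x) \<longlonglongrightarrow> \<phi> 0" using conv[of 0] by simp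
  from order_tendstoD(1)[OF this pos] obtain N where N: "\<And>n. n \<ge> N \<Longrightarrow> 0 < (LINT x|\<nu> n. w x)"
    by (auto simp: eventually_sequentially)
  have "\<exists>\<eta> :: real measure. sets \<eta> = sets borel \<and> sigma_finite_measure \<eta> \<and> emeasure \<eta> UNIV \<noteq> 0 \<and>
    (\<forall>c>0. emeasure \<eta> {c} = 0 \<longrightarrow> (\<lambda>n. ennreal (measure (\<nu> (n + N)) {- c..c})) \<longlonglongrightarrow> emeasure \<eta> {- c..c})"
    by (rule vague_limit_measure_aux[where w = w and \<phi> = \<phi> and B = B])
       (use fin sets_\<nu> w N cont pos LIMSEQ_ignore_initial_segment[OF conv] in simp_all)
  then obtain \<eta> :: "real measure" where \<eta>: "sets \<eta> = sets borel" "sigma_finite_measure \<eta>" "emeasure \<eta> UNIV \<noteq> 0"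
    and lim: "\<And>c. 0 < c \<Longrightarrow> emeasure \<eta> {c} = 0 \<Longrightarrow>
      (\<lambda>n. ennreal (measure (\<nu> (n + N)) {- c..c})) \<longlonglongrightarrow> emeasure \<eta> {- c..c}"
    by metis
  show ?thesis
    by (intro exI[of _ \<eta>] conjI \<eta> allI impI LIMSEQ_offset[OF lim])
qed

section \<open>Row recursions under a spectral gap\<close>

lemma contracting_recursion_null:
  fixes d c :: "nat \<Rightarrow> complex"
  assumes rec: "\<And>n. d (Suc n) = \<rho> * d n + c n" and \<rho>: "norm \<rho> < 1" and c: "c \<longlonglongrightarrow> 0"
  shows "d \<longlonglongrightarrow> 0"
proof (rule LIMSEQ_I)
  fix r :: real assume r: "0 < r"
  \<comment> \<open>Solves |\<rho>| r/2 + q = r/2, so that the bound r/2 reproduces itself under the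
    recursion.\<close>
  define q where "q = r / 2 * (1 - norm \<rho>)"
  have q: "0 < q" using r \<rho> by (simp add: q_def)
  obtain N where N: "\<And>n. n \<ge> N \<Longrightarrow> norm (c n) < q" using LIMSEQ_D[OF c q] by auto
  have bound: "norm (d (N + k)) \<le> norm \<rho> ^ k * norm (d N) + r / 2" for k
  proof (induction k)
    case 0 then show ?case using r by simp
  next
    case (Suc k)
    have "norm (d (N + Suc k)) \<le> norm \<rho> * norm (d (N + k)) + norm (c (N + k))"
      using norm_triangle_ineq[of "\<rho> * d (N + k)" "c (N + k)"] by (simp add: rec norm_mult)
    also have "\<dots> \<le> norm \<rho> * (norm \<rho> ^ k * norm (d N) + r / 2) + q"
      using Suc N[of "N + k"] by (intro add_mono mult_left_mono) (auto intro: less_imp_le)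
    also have "\<dots> = norm \<rho> ^ Suc k * norm (d N) + r / 2" by (simp add: q_def algebra_simps diff_divide_distrib)
    finally show ?case .
  qed
  have "(\<lambda>k. norm \<rho> ^ k * norm (d N)) \<longlonglongrightarrow> 0 * norm (d N)"
    using \<rho> by (intro tendsto_mult LIMSEQ_power_zero tendsto_const) simp
  from LIMSEQ_D[OF this half_gt_zero[OF r]] obtain K
    where K: "\<And>k. k \<ge> K \<Longrightarrow> norm \<rho> ^ k * norm (d N) < r / 2" by auto
  have "norm (d n - 0) < r" if "n \<ge> N + K" for n
  proof -
    have "K \<le> n - N" using that by simp
    from K[OF this] bound[of "n - N"] that show ?thesis by (simp add: field_simps)
  qed
  then show "\<exists>no. \<forall>n\<ge>no. norm (d n - 0) < r" by blast
qed

lemma contracting_recursion_convergent: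
  fixes a b :: "nat \<Rightarrow> complex"
  assumes rec: "\<And>n. a (Suc n) = \<rho> * a n + b n" and \<rho>: "norm \<rho> < 1" and b: "convergent b"
  shows "convergent a"
proof -
  obtain \<beta> where \<beta>: "b \<longlonglongrightarrow> \<beta>" using b by (auto simp: convergent_def)
  \<comment> \<open>The fixed point of z \<mapsto> \<rho> z + \<beta>.\<close>
  define L where "L = \<beta> / (1 - \<rho>)"
  have "\<rho> \<noteq> 1" using \<rho> by auto
  then have L: "L = \<rho> * L + \<beta>" by (simp add: L_def field_simps)
  have "(\<lambda>n. a n - L) \<longlonglongrightarrow> 0"
  proof (rule contracting_recursion_null[OF _ \<rho>])
    show "a (Suc n) - L = \<rho> * (a n - L) + (b n - \<beta>)" for n
      using L by (simp add: rec algebra_simps)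
    show "(\<lambda>n. b n - \<beta>) \<longlonglongrightarrow> 0" using \<beta> by (simp add: LIM_zero)
  qed
  then show ?thesis using LIM_zero_cancel convergentI by blast
qed

text \<open>For a row vector x, the entries of x P serve as coordinates in which A acts by the upper
  triangular T: coordinate j is influenced by coordinates up to j only. The eigenvalues stand on the
  diagonal in the order of \<open>es\<close>, so the dominant coordinates can be put first.\<close>

lemma schur_coordinates:
  fixes A :: "complex mat"
  assumes A: "A \<in> carrier_mat m m" and c: "char_poly A = (\<Prod>z\<leftarrow>es. [:- z, 1:])"
  obtains P Q T :: "nat \<Rightarrow> nat \<Rightarrow> complex"
  where "length es = m"
    and "\<And>i j. i < m \<Longrightarrow> j < m \<Longrightarrow> (\<Sum>l<m. A $$ (i, l) * P l j) = (\<Sum>l\<le>j. P i l * T l j)"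
    and "\<And>i j. i < m \<Longrightarrow> j < m \<Longrightarrow> (\<Sum>l<m. P i l * Q l j) = (if i = j then 1 else 0)"
    and "\<And>j. j < m \<Longrightarrow> T j j = es ! j"
proof -
  obtain B P Q where "schur_decomposition A es = (B, P, Q)" by (metis prod_cases3)
  from schur_decomposition[OF A c this]
  have sim: "similar_mat_wit A B P Q" and ut: "upper_triangular B" and diag: "diag_mat B = es" by auto
  have dim: "B \<in> carrier_mat m m" "P \<in> carrier_mat m m" "Q \<in> carrier_mat m m"
    and PQ: "P * Q = 1\<^sub>m m" and QP: "Q * P = 1\<^sub>m m" and APBQ: "A = P * B * Q"
    using sim A unfolding similar_mat_wit_def Let_def by auto
  have AP: "A * P = P * B"
    using dim QP unfolding APBQ by (simp add: assoc_mult_mat[of _ m m _ m _ m])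
  show thesis
  proof (rule that[of "\<lambda>i j. P $$ (i, j)" "\<lambda>i j. B $$ (i, j)" "\<lambda>i j. Q $$ (i, j)"])
    show "length es = m" using dim(1) unfolding diag[symmetric] by (simp add: diag_mat_def)
    show "B $$ (j, j) = es ! j" if "j < m" for j
      using dim(1) that unfolding diag[symmetric] by (simp add: diag_mat_def)
    show "(\<Sum>l<m. P $$ (i, l) * Q $$ (l, j)) = (if i = j then 1 else 0)" if "i < m" "j < m" for i j
    proof -
      have "(P * Q) $$ (i, j) = (\<Sum>l<m. P $$ (i, l) * Q $$ (l, j))"
        using dim that by (simp add: scalar_prod_def lessThan_atLeast0)
      then show ?thesis using that by (simp add: PQ)
    qed
    show "(\<Sum>l<m. A $$ (i, l) * P $$ (l, j)) = (\<Sum>l\<le>j. P $$ (i, l) * B $$ (l, j))" if "i < m" "j < m" for i j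
    proof -
      have "(\<Sum>l<m. A $$ (i, l) * P $$ (l, j)) = (A * P) $$ (i, j)"
        using dim A that by (simp add: scalar_prod_def lessThan_atLeast0)
      also have "\<dots> = (\<Sum>l<m. P $$ (i, l) * B $$ (l, j))"
        unfolding AP using dim that by (simp add: scalar_prod_def lessThan_atLeast0)
      also have "\<dots> = (\<Sum>l\<le>j. P $$ (i, l) * B $$ (l, j))"
        using dim(1) ut that unfolding upper_triangular_def
        by (intro sum.mono_neutral_right) auto
      finally show ?thesis .
    qed
  qed
qed

lemma row_times_schur:
  fixes A :: "complex mat"
  assumes AP: "\<And>i j. i < m \<Longrightarrow> j < m \<Longrightarrow> (\<Sum>l<m. A $$ (i, l) * P l j) = (\<Sum>l\<le>j. P i l * T l j)"
    and j: "j < m"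
  shows "(\<Sum>l<m. (\<Sum>i<m. x i * A $$ (i, l)) * P l j) = (\<Sum>l\<le>j. (\<Sum>i<m. x i * P i l) * T l j)"
proof -
  have "(\<Sum>l<m. (\<Sum>i<m. x i * A $$ (i, l)) * P l j) = (\<Sum>l<m. \<Sum>i<m. x i * (A $$ (i, l) * P l j))"
    by (simp add: sum_distrib_right mult.assoc)
  also have "\<dots> = (\<Sum>i<m. x i * (\<Sum>l<m. A $$ (i, l) * P l j))"
    by (subst sum.swap) (simp add: sum_distrib_left)
  also have "\<dots> = (\<Sum>i<m. x i * (\<Sum>l\<le>j. P i l * T l j))"
    using AP j by (intro sum.cong) auto
  also have "\<dots> = (\<Sum>l\<le>j. (\<Sum>i<m. x i * P i l) * T l j)"
    by (simp add: sum_distrib_left sum_distrib_right mult.assoc) (rule sum.swap)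
  finally show ?thesis .
qed

lemma row_from_schur_coordinates:
  fixes x :: "nat \<Rightarrow> complex"
  assumes PQ: "\<And>i j. i < m \<Longrightarrow> j < m \<Longrightarrow> (\<Sum>l<m. P i l * Q l j) = (if i = j then 1 else 0)"
    and j: "j < m"
  shows "x j = (\<Sum>l<m. (\<Sum>i<m. x i * P i l) * Q l j)"
proof -
  have "(\<Sum>l<m. (\<Sum>i<m. x i * P i l) * Q l j) = (\<Sum>i<m. x i * (\<Sum>l<m. P i l * Q l j))"
    by (simp add: sum_distrib_left sum_distrib_right mult.assoc) (rule sum.swap)
  also have "\<dots> = (\<Sum>i<m. if i = j then x i else 0)"
    using PQ j by (intro sum.cong) auto
  finally show ?thesis using j by simp
qed

text \<open>Induction over the Schur coordinates: coordinate j obeys a scalar recursion with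
  multiplier T j j / \<rho>, driven by the earlier coordinates and the error. Where the multiplier
  does not contract, convergence has to come from elsewhere, which is the second alternative in
  \<open>diag\<close>.\<close>

lemma row_recursion_convergent:
  fixes A :: "complex mat" and x \<epsilon> :: "nat \<Rightarrow> nat \<Rightarrow> complex"
  assumes AP: "\<And>i j. i < m \<Longrightarrow> j < m \<Longrightarrow> (\<Sum>l<m. A $$ (i, l) * P l j) = (\<Sum>l\<le>j. P i l * T l j)"
    and PQ: "\<And>i j. i < m \<Longrightarrow> j < m \<Longrightarrow> (\<Sum>l<m. P i l * Q l j) = (if i = j then 1 else 0)"
    and rec: "\<And>n j. j < m \<Longrightarrow> x (Suc n) j = (\<Sum>i<m. x n i * A $$ (i, j)) / \<rho> + \<epsilon> n j"
    and \<epsilon>: "\<And>j. j < m \<Longrightarrow> convergent (\<lambda>n. \<epsilon> n j)"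
    and \<rho>: "\<rho> \<noteq> 0"
    and diag: "\<And>j. j < m \<Longrightarrow> norm (T j j) < norm \<rho> \<or> convergent (\<lambda>n. \<Sum>i<m. x n i * P i j)"
    and j: "j < m"
  shows "convergent (\<lambda>n. x n j)"
proof -
  define z where "z n j = (\<Sum>i<m. x n i * P i j)" for n j
  have z_conv: "convergent (\<lambda>n. z n j)" if "j < m" for j
    using that
  proof (induction j rule: less_induct)
    case (less j)
    show ?case
    proof (cases "norm (T j j) < norm \<rho>")
      case False
      then show ?thesis using diag[OF less.prems] by (simp add: z_def)
    next
      case True
      have "z (Suc n) j = T j j / \<rho> * z n j + ((\<Sum>l<j. z n l * T l j) / \<rho> + (\<Sum>i<m. \<epsilon> n i * P i j))" for n
      proof -
        have "z (Suc n) j = (\<Sum>l<m. (\<Sum>i<m. x n i * A $$ (i, l)) * P l j) / \<rho> + (\<Sum>i<m. \<epsilon> n i * P i j)"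
          unfolding z_def sum_divide_distrib sum.distrib[symmetric]
          by (rule sum.cong) (simp_all add: rec distrib_right)
        also have "(\<Sum>l<m. (\<Sum>i<m. x n i * A $$ (i, l)) * P l j) = (\<Sum>l\<le>j. z n l * T l j)"
          unfolding z_def by (rule row_times_schur[OF AP less.prems])
        also have "\<dots> = (\<Sum>l<j. z n l * T l j) + z n j * T j j"
          by (simp add: lessThan_Suc_atMost[symmetric])
        finally show ?thesis by (simp add: add_divide_distrib algebra_simps)
      qed
      moreover have "norm (T j j / \<rho>) < 1" using True \<rho> by (simp add: norm_divide)
      moreover have "convergent (\<lambda>n. (\<Sum>l<j. z n l * T l j) / \<rho> + (\<Sum>i<m. \<epsilon> n i * P i j))"
        unfolding divide_inverse using less \<epsilon>
        by (intro convergent_add convergent_sum convergent_mult convergent_const) auto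
      ultimately show ?thesis by (rule contracting_recursion_convergent)
    qed
  qed
  have "(\<lambda>n. x n j) = (\<lambda>n. \<Sum>l<m. z n l * Q l j)"
    unfolding z_def using row_from_schur_coordinates[OF PQ j] by blast
  then show ?thesis using z_conv by (auto intro!: convergent_sum convergent_mult convergent_const)
qed

text \<open>Once the earlier Schur coordinates vanish, coordinate j satisfies (\<rho> - T j j) z =
  0. Applied to a difference of two eigenvectors, this shows that the left eigenspace is
  one-dimensional.\<close>

lemma left_eigenvector_unique:
  fixes A :: "complex mat" and r :: "nat \<Rightarrow> complex"
  assumes AP: "\<And>i j. i < m \<Longrightarrow> j < m \<Longrightarrow> (\<Sum>l<m. A $$ (i, l) * P l j) = (\<Sum>l\<le>j. P i l * T l j)"
    and PQ: "\<And>i j. i < m \<Longrightarrow> j < m \<Longrightarrow> (\<Sum>l<m. P i l * Q l j) = (if i = j then 1 else 0)"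
    and ev: "\<And>j. j < m \<Longrightarrow> (\<Sum>i<m. r i * A $$ (i, j)) = \<rho> * r j"
    and diag: "\<And>j. 0 < j \<Longrightarrow> j < m \<Longrightarrow> T j j \<noteq> \<rho>"
    and r0: "(\<Sum>i<m. r i * P i 0) = 0"
    and j: "j < m"
  shows "r j = 0"
proof -
  define z where "z j = (\<Sum>i<m. r i * P i j)" for j
  have z: "z j = 0" if "j < m" for j
    using that
  proof (induction j rule: less_induct)
    case (less j)
    show ?case
    proof (cases "j = 0")
      case True then show ?thesis using r0 by (simp add: z_def)
    next
      case False
      have "\<rho> * z j = (\<Sum>l<m. (\<Sum>i<m. r i * A $$ (i, l)) * P l j)"
        by (simp add: z_def ev sum_distrib_left mult.assoc)
      also have "\<dots> = (\<Sum>l\<le>j. z l * T l j)"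
        unfolding z_def by (rule row_times_schur[OF AP less.prems])
      also have "\<dots> = z j * T j j"
        using less by (simp add: lessThan_Suc_atMost[symmetric])
      finally show ?thesis using diag[of j] False less.prems by auto
    qed
  qed
  have "r j = (\<Sum>l<m. z l * Q l j)" unfolding z_def by (rule row_from_schur_coordinates[OF PQ j])
  then show ?thesis using z by simp
qed

text \<open>After division by \<theta>^n the bounded errors form a summable series. Coordinate 0
  then has multiplier 1 and is a partial sum of this series; all other coordinates contract. The
  limit is a left eigenvector for \<theta>, hence a multiple of s.\<close>

lemma dominant_row_recursion:
  fixes A :: "complex mat" and x e :: "nat \<Rightarrow> nat \<Rightarrow> complex" and \<theta> C :: real and s :: "nat \<Rightarrow> complex"
  assumes A: "A \<in> carrier_mat m m"
    and c: "char_poly A = (\<Prod>z\<leftarrow>complex_of_real \<theta> # zs. [:- z, 1:])"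
    and dom: "\<And>z. z \<in> set zs \<Longrightarrow> norm z < \<theta>" and \<theta>: "1 < \<theta>"
    and rec: "\<And>n j. j < m \<Longrightarrow> x (Suc n) j = (\<Sum>i<m. x n i * A $$ (i, j)) + e n j"
    and e: "\<And>n j. j < m \<Longrightarrow> norm (e n j) \<le> C"
    and s: "\<And>j. j < m \<Longrightarrow> (\<Sum>i<m. s i * A $$ (i, j)) = \<theta> * s j" and s0: "k < m" "s k \<noteq> 0"
  obtains \<kappa> where "\<And>j. j < m \<Longrightarrow> (\<lambda>n. x n j / \<theta> ^ n) \<longlonglongrightarrow> \<kappa> * s j"
proof -
  obtain P Q T where len: "length (complex_of_real \<theta> # zs) = m"
    and AP: "\<And>i j. i < m \<Longrightarrow> j < m \<Longrightarrow> (\<Sum>l<m. A $$ (i, l) * P l j) = (\<Sum>l\<le>j. P i l * T l j)"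
    and PQ: "\<And>i j. i < m \<Longrightarrow> j < m \<Longrightarrow> (\<Sum>l<m. P i l * Q l j) = (if i = j then 1 else 0)"
    and diag: "\<And>j. j < m \<Longrightarrow> T j j = (complex_of_real \<theta> # zs) ! j"
    by (rule schur_coordinates[OF A c]) blast
  have m: "0 < m" using len by auto
  have small: "norm (T j j) < \<theta>" if "0 < j" "j < m" for j
    using that len dom[of "zs ! (j - 1)"] by (simp add: diag nth_Cons')
  define y where "y n j = x n j / \<theta> ^ n" for n j
  define \<epsilon> where "\<epsilon> n j = e n j / \<theta> ^ Suc n" for n j
  have geo: "summable (\<lambda>n. C * (1 / \<theta>) ^ Suc n)"
    using \<theta> by (intro summable_mult) (simp add: summable_geometric)
  have sum_\<epsilon>: "summable (\<lambda>n. \<epsilon> n j)" if "j < m" for j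
  proof (rule summable_comparison_test'[OF geo])
    show "norm (\<epsilon> n j) \<le> C * (1 / \<theta>) ^ Suc n" for n
      using e[OF that, of n] \<theta> unfolding \<epsilon>_def
      by (simp add: norm_divide norm_mult norm_power power_divide divide_right_mono)
  qed
  have y_rec: "y (Suc n) j = (\<Sum>i<m. y n i * A $$ (i, j)) / \<theta> + \<epsilon> n j" if "j < m" for n j
    unfolding y_def \<epsilon>_def rec[OF that] by (simp add: add_divide_distrib sum_divide_distrib mult.commute)
  have "convergent (\<lambda>n. y n j)" if "j < m" for j
  proof (rule row_recursion_convergent[where A = A and P = P and T = T and Q = Q and x = y and \<epsilon> = \<epsilon>
        and \<rho> = "complex_of_real \<theta>" and m = m])
    show "convergent (\<lambda>n. \<epsilon> n j)" if "j < m" for j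
      using summable_LIMSEQ_zero[OF sum_\<epsilon>[OF that]] by (rule convergentI)
    show "complex_of_real \<theta> \<noteq> 0" using \<theta> by simp
    show "norm (T j j) < norm (complex_of_real \<theta>) \<or> convergent (\<lambda>n. \<Sum>i<m. y n i * P i j)" if "j < m" for j
    proof (cases "j = 0")
      case False then show ?thesis using small[of j] that \<theta> by auto
    next
      case True
      define z where "z n = (\<Sum>i<m. y n i * P i 0)" for n
      define \<delta> where "\<delta> n = (\<Sum>i<m. \<epsilon> n i * P i 0)" for n
      have step: "z (Suc n) = z n + \<delta> n" for n
      proof -
        have "z (Suc n) = (\<Sum>l<m. (\<Sum>i<m. y n i * A $$ (i, l)) * P l 0) / \<theta> + \<delta> n"
          unfolding z_def \<delta>_def sum_divide_distrib sum.distrib[symmetric]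
          by (rule sum.cong) (simp_all add: y_rec distrib_right)
        also have "(\<Sum>l<m. (\<Sum>i<m. y n i * A $$ (i, l)) * P l 0) = z n * \<theta>"
          using row_times_schur[OF AP m, of "y n"] diag[OF m] by (simp add: z_def)
        finally show ?thesis using \<theta> by simp
      qed
      have "summable \<delta>" unfolding \<delta>_def
        by (intro summable_sum summable_mult2 sum_\<epsilon>) auto
      then have conv: "convergent (\<lambda>n. z 0 + (\<Sum>i<n. \<delta> i))"
        by (intro convergent_add convergent_const) (simp add: summable_iff_convergent)
      have "z n = z 0 + (\<Sum>i<n. \<delta> i)" for n by (induction n) (simp_all add: step add.assoc)
      then have eq: "(\<lambda>n. z 0 + (\<Sum>i<n. \<delta> i)) = z" by (intro ext) (rule sym)
      have "convergent z" by (rule iffD1[OF arg_cong[OF eq, of convergent] conv])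
      also have "z = (\<lambda>n. \<Sum>i<m. y n i * P i 0)" by (rule ext) (rule z_def)
      finally have "convergent (\<lambda>n. \<Sum>i<m. y n i * P i 0)" .
      then show ?thesis unfolding True by (rule disjI2)
    qed
  qed (fact AP PQ y_rec that)+
  then obtain g where g: "\<And>j. j < m \<Longrightarrow> (\<lambda>n. y n j) \<longlonglongrightarrow> g j"
    unfolding convergent_def by metis
  have g_ev: "(\<Sum>i<m. g i * A $$ (i, j)) = \<theta> * g j" if "j < m" for j
  proof -
    have "(\<lambda>n. (\<Sum>i<m. y n i * A $$ (i, j)) / \<theta> + \<epsilon> n j) \<longlonglongrightarrow> (\<Sum>i<m. g i * A $$ (i, j)) / \<theta> + 0"
      using \<theta> that summable_LIMSEQ_zero[OF sum_\<epsilon>[OF that]] by (intro tendsto_intros g) auto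
    moreover have "(\<lambda>n. (\<Sum>i<m. y n i * A $$ (i, j)) / \<theta> + \<epsilon> n j) \<longlonglongrightarrow> g j"
      using LIMSEQ_Suc[OF g[OF that]] by (simp add: y_rec that)
    ultimately have "(\<Sum>i<m. g i * A $$ (i, j)) / \<theta> + 0 = g j" by (rule LIMSEQ_unique)
    then show ?thesis using \<theta> by (simp add: field_simps)
  qed
  have diag_ne: "T j j \<noteq> complex_of_real \<theta>" if "0 < j" "j < m" for j
    using small[OF that] \<theta> by auto
  define zs0 where "zs0 = (\<Sum>i<m. s i * P i 0)"
  have "zs0 \<noteq> 0"
    using left_eigenvector_unique[OF AP PQ s diag_ne _ s0(1)] s0(2) by (auto simp: zs0_def)
  \<comment> \<open>Makes Schur coordinate 0 of the eigenvector g - \<kappa> s vanish.\<close>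
  define \<kappa> where "\<kappa> = (\<Sum>i<m. g i * P i 0) / zs0"
  have "g j - \<kappa> * s j = 0" if "j < m" for j
  proof (rule left_eigenvector_unique[OF AP PQ _ diag_ne _ that])
    show "(\<Sum>i<m. (g i - \<kappa> * s i) * A $$ (i, j)) = \<theta> * (g j - \<kappa> * s j)" if "j < m" for j
      using g_ev[OF that] s[OF that]
      by (simp add: left_diff_distrib sum_subtractf mult.assoc sum_distrib_left[symmetric] algebra_simps)
    have "(\<Sum>i<m. (g i - \<kappa> * s i) * P i 0) = (\<Sum>i<m. g i * P i 0) - \<kappa> * zs0"
      by (simp add: zs0_def left_diff_distrib sum_subtractf mult.assoc sum_distrib_left[symmetric])
    then show "(\<Sum>i<m. (g i - \<kappa> * s i) * P i 0) = 0"
      using \<open>zs0 \<noteq> 0\<close> by (simp add: \<kappa>_def)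
  qed
  then have "g j = \<kappa> * s j" if "j < m" for j using that by simp
  then show thesis using that[of \<kappa>] g unfolding y_def by auto
qed

text \<open>Coordinate 0 is multiplied by exactly \<theta> at each step, so growth slower than
  \<theta>^n forces it to be 0 throughout. Then coordinate 1 is multiplied by exactly
  \<open>\<theta>\<^sub>2\<close>, and the remaining ones contract after the normalisation.\<close>

lemma subdominant_row_iteration:
  fixes A :: "complex mat" and x :: "nat \<Rightarrow> nat \<Rightarrow> complex" and \<theta> \<theta>\<^sub>2 :: real
  assumes A: "A \<in> carrier_mat m m"
    and c: "char_poly A = (\<Prod>z\<leftarrow>complex_of_real \<theta> # complex_of_real \<theta>\<^sub>2 # zs. [:- z, 1:])"
    and dom: "\<And>z. z \<in> set zs \<Longrightarrow> norm z < \<theta>\<^sub>2" and \<theta>\<^sub>2: "0 < \<theta>\<^sub>2" and \<theta>: "\<theta>\<^sub>2 < \<theta>"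
    and rec: "\<And>n j. j < m \<Longrightarrow> x (Suc n) j = (\<Sum>i<m. x n i * A $$ (i, j))"
    and small: "\<And>j. j < m \<Longrightarrow> (\<lambda>n. x n j / \<theta> ^ n) \<longlonglongrightarrow> 0"
    and j: "j < m"
  shows "convergent (\<lambda>n. x n j / \<theta>\<^sub>2 ^ n)"
proof -
  obtain P Q T where len: "length (complex_of_real \<theta> # complex_of_real \<theta>\<^sub>2 # zs) = m"
    and AP: "\<And>i j. i < m \<Longrightarrow> j < m \<Longrightarrow> (\<Sum>l<m. A $$ (i, l) * P l j) = (\<Sum>l\<le>j. P i l * T l j)"
    and PQ: "\<And>i j. i < m \<Longrightarrow> j < m \<Longrightarrow> (\<Sum>l<m. P i l * Q l j) = (if i = j then 1 else 0)"
    and diag: "\<And>j. j < m \<Longrightarrow> T j j = (complex_of_real \<theta> # complex_of_real \<theta>\<^sub>2 # zs) ! j"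
    by (rule schur_coordinates[OF A c]) blast
  have m: "0 < m" "1 < m" using len by auto
  define z where "z n j = (\<Sum>i<m. x n i * P i j)" for n j
  have z_rec: "z (Suc n) j = (\<Sum>l\<le>j. z n l * T l j)" if "j < m" for n j
    using row_times_schur[OF AP that, of "x n"] by (simp add: z_def rec)
  have z0: "z n 0 = \<theta> ^ n * z 0 0" for n
    by (induction n) (simp_all add: z_rec[OF m(1)] diag[OF m(1)])
  have "(\<lambda>n. \<Sum>i<m. x n i / \<theta> ^ n * P i 0) \<longlonglongrightarrow> (\<Sum>i<m. 0 * P i 0)"
    by (intro tendsto_intros small) auto
  also have "(\<lambda>n. \<Sum>i<m. x n i / \<theta> ^ n * P i 0) = (\<lambda>n. z 0 0)"
  proof
    fix n
    have "(\<Sum>i<m. x n i / \<theta> ^ n * P i 0) = z n 0 / \<theta> ^ n"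
      by (simp add: z_def sum_divide_distrib)
    also have "\<dots> = z 0 0" using \<theta> \<theta>\<^sub>2 by (subst z0) simp
    finally show "(\<Sum>i<m. x n i / \<theta> ^ n * P i 0) = z 0 0" .
  qed
  finally have "z 0 0 = 0" by (simp add: LIMSEQ_const_iff)
  then have z0: "z n 0 = 0" for n using z0[of n] by simp
  have z1: "z n 1 = \<theta>\<^sub>2 ^ n * z 0 1" for n
  proof (induction n)
    case (Suc n)
    have "z (Suc n) 1 = z n 0 * T 0 1 + z n 1 * T 1 1"
      using z_rec[OF m(2), of n] by (simp add: atMost_Suc)
    then show ?case using Suc z0 diag[OF m(2)] by simp
  qed simp
  define y where "y n j = x n j / \<theta>\<^sub>2 ^ n" for n j
  have "convergent (\<lambda>n. y n j)"
  proof (rule row_recursion_convergent[where A = A and P = P and T = T and Q = Q and x = y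
        and \<epsilon> = "\<lambda>_ _. 0" and \<rho> = "complex_of_real \<theta>\<^sub>2" and m = m])
    show "y (Suc n) j = (\<Sum>i<m. y n i * A $$ (i, j)) / \<theta>\<^sub>2 + 0" if "j < m" for n j
      unfolding y_def rec[OF that] by (simp add: sum_divide_distrib mult.commute)
    show "norm (T j j) < norm (complex_of_real \<theta>\<^sub>2) \<or> convergent (\<lambda>n. \<Sum>i<m. y n i * P i j)" if "j < m" for j
    proof -
      have zy: "(\<Sum>i<m. y n i * P i j) = z n j / \<theta>\<^sub>2 ^ n" for n j
        by (simp add: y_def z_def sum_divide_distrib)
      consider "j = 0" | "j = 1" | "j \<ge> 2" by linarith
      then show ?thesis
      proof cases
        case 3
        then have "norm (zs ! (j - 2)) < \<theta>\<^sub>2" using len that by (intro dom nth_mem) auto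
        moreover have "T j j = zs ! (j - 2)"
          using 3 diag[OF that] by (simp add: nth_Cons' numeral_2_eq_2)
        ultimately show ?thesis using \<theta>\<^sub>2 by simp
      next
        case 1
        then show ?thesis by (simp add: zy z0 convergent_const)
      next
        case 2
        have "z n 1 / \<theta>\<^sub>2 ^ n = z 0 1" for n by (subst z1) (use \<theta>\<^sub>2 in simp)
        then show ?thesis using 2 by (simp only: zy convergent_const simp_thms)
      qed
    qed
    show "complex_of_real \<theta>\<^sub>2 \<noteq> 0" using \<theta>\<^sub>2 by simp
  qed (fact AP PQ j | rule convergent_const)+
  then show ?thesis by (simp add: y_def)
qed

section \<open>Integrals along substituted words\<close>

definition clip :: "real \<Rightarrow> real \<Rightarrow> real" where
  "clip c \<tau> = max 0 (min \<tau> c)"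

text \<open>\<open>P a u\<close> plays the role of the integral of a function over the first \<open>u\<close> time units of the tile
  \<open>a\<close>. Then \<open>acc s P w \<tau>\<close> is its integral over \<open>[0, \<tau>]\<close> along the tiles \<open>w\<close>; it vanishes for
  \<open>\<tau> \<le> 0\<close> and is constant past the end of \<open>w\<close>, where it equals \<open>tot s P w\<close>.\<close>

primrec acc :: "real vec \<Rightarrow> (nat \<Rightarrow> real \<Rightarrow> complex) \<Rightarrow> nat list \<Rightarrow> real \<Rightarrow> complex" where
  "acc s P [] \<tau> = 0"
| "acc s P (a # w) \<tau> = P a (clip (s $ a) \<tau>) + acc s P w (\<tau> - s $ a)"

definition wlen :: "real vec \<Rightarrow> nat list \<Rightarrow> real" where
  "wlen s w = (\<Sum>a\<leftarrow>w. s $ a)"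

definition tot :: "real vec \<Rightarrow> (nat \<Rightarrow> real \<Rightarrow> complex) \<Rightarrow> nat list \<Rightarrow> complex" where
  "tot s P w = (\<Sum>a\<leftarrow>w. P a (s $ a))"

lemma wlen_simps [simp]:
  "wlen s [] = 0" "wlen s (a # w) = s $ a + wlen s w" "wlen s (v @ w) = wlen s v + wlen s w"
  by (simp_all add: wlen_def)

lemma tot_simps [simp]:
  "tot s P [] = 0" "tot s P (a # w) = P a (s $ a) + tot s P w" "tot s P (v @ w) = tot s P v + tot s P w"
  by (simp_all add: tot_def)

lemma clip_range: "0 \<le> c \<Longrightarrow> clip c \<tau> \<in> {0..c}"
  by (auto simp: clip_def)

lemma acc_append: "acc s P (v @ w) \<tau> = acc s P v \<tau> + acc s P w (\<tau> - wlen s v)"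
  by (induction v arbitrary: \<tau>) (simp_all add: algebra_simps)

lemma subst_word_append: "(subst_word \<zeta> ^^ n) (v @ w) = (subst_word \<zeta> ^^ n) v @ (subst_word \<zeta> ^^ n) w"
  by (induction n) (simp_all add: subst_word_def)

lemma subst_word_Nil [simp]: "(subst_word \<zeta> ^^ n) [] = []"
  by (induction n) (simp_all add: subst_word_def)

lemma subst_word_concat: "(subst_word \<zeta> ^^ n) w = concat (map (\<lambda>b. (subst_word \<zeta> ^^ n) [b]) w)"
proof (induction w)
  case (Cons a w)
  then show ?case using subst_word_append[of n \<zeta> "[a]" w] by simp
qed simp

section \<open>Cutting words into blocks\<close>

lemma prefix_concat_decomposition:
  assumes "prefix w (concat (map g us))" and "\<And>u. u \<in> set us \<Longrightarrow> length (g u) \<le> L"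
  shows "\<exists>us' q. w = concat (map g us') @ q \<and> length q \<le> L \<and> set us' \<subseteq> set us"
  using assms
proof (induction us arbitrary: w)
  case (Cons a us)
  from Cons.prems(1) have "prefix w (g a) \<or> (\<exists>v. w = g a @ v \<and> prefix v (concat (map g us)))"
    by (simp add: prefix_append)
  then show ?case
  proof
    assume "prefix w (g a)"
    then have "length w \<le> L" using prefix_length_le Cons.prems(2)[of a] by fastforce
    then show ?thesis by (intro exI[of _ "[]"] exI[of _ w]) simp
  next
    assume "\<exists>v. w = g a @ v \<and> prefix v (concat (map g us))"
    then obtain v where v: "w = g a @ v" "prefix v (concat (map g us))" by blast
    with Cons.IH[OF v(2)] Cons.prems(2) obtain us' q
      where "v = concat (map g us') @ q" "length q \<le> L" "set us' \<subseteq> set us" by auto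
    then show ?thesis using v(1) by (intro exI[of _ "a # us'"] exI[of _ q]) auto
  qed
qed (auto intro!: exI[of _ "[]"])

text \<open>Applied with \<open>g b\<close> the word \<zeta>^n(b): a subword of a long substituted
  word consists of complete blocks and two ends whose length is bounded in terms of n alone.\<close>

lemma sublist_concat_decomposition:
  assumes "sublist w (concat (map g us))" and "\<And>u. u \<in> set us \<Longrightarrow> length (g u) \<le> L"
  shows "\<exists>p us' q. w = p @ concat (map g us') @ q \<and> length p \<le> L \<and> length q \<le> L \<and> set us' \<subseteq> set us"
  using assms
proof (induction us)
  case Nil
  then show ?case by (auto intro!: exI[of _ "[]"])
next
  case (Cons a us)
  from Cons.prems(1) consider "sublist w (g a)" | "sublist w (concat (map g us))"
    | w1 w2 where "w = w1 @ w2" "suffix w1 (g a)" "prefix w2 (concat (map g us))"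
    by (auto simp: sublist_append)
  then show ?case
  proof cases
    case 1
    then have "length w \<le> L" using sublist_length_le Cons.prems(2)[of a] by fastforce
    then show ?thesis by (intro exI[of _ w] exI[of _ "[]"]) auto
  next
    case 2
    from Cons.IH[OF this] Cons.prems(2) obtain p us' q where
      "w = p @ concat (map g us') @ q" "length p \<le> L" "length q \<le> L" "set us' \<subseteq> set us" by auto
    then show ?thesis by (intro exI[of _ p] exI[of _ us'] exI[of _ q]) auto
  next
    case 3
    have "length w1 \<le> L" using suffix_length_le[OF 3(2)] Cons.prems(2)[of a] by simp
    moreover obtain us' q where "w2 = concat (map g us') @ q" "length q \<le> L" "set us' \<subseteq> set us"
      using prefix_concat_decomposition[OF 3(3)] Cons.prems(2) by (metis list.set_intros(2))
    ultimately show ?thesis using 3(1) by (intro exI[of _ w1] exI[of _ us'] exI[of _ q]) auto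
  qed
qed

text \<open>The assumption \<open>wlen_subst_letter\<close> is the eigenvector equation for s read
  geometrically: the tile a inflated by \<theta> is tiled exactly by the letters of
  \<open>\<zeta> a\<close>.\<close>

locale self_similar_tiling =
  fixes m :: nat and \<zeta> :: "nat \<Rightarrow> nat list" and s :: "real vec" and \<theta> :: real
  assumes subst: "substitution m \<zeta>" and m_pos: "0 < m"
    and s_pos: "\<And>a. a < m \<Longrightarrow> 0 < s $ a"
    and wlen_subst_letter: "\<And>a. a < m \<Longrightarrow> wlen s (\<zeta> a) = \<theta> * s $ a"
    and \<theta>_gt_1: "1 < \<theta>"
begin

abbreviation sub :: "nat \<Rightarrow> nat list \<Rightarrow> nat list" where
  "sub n \<equiv> subst_word \<zeta> ^^ n"

abbreviation word :: "nat list \<Rightarrow> bool" where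
  "word w \<equiv> set w \<subseteq> {..<m}"

definition smin :: real where "smin = Min ((\<lambda>a. s $ a) ` {..<m})"
definition smax :: real where "smax = Max ((\<lambda>a. s $ a) ` {..<m})"

lemma smin_pos: "0 < smin" and smin_le: "a < m \<Longrightarrow> smin \<le> s $ a" and smax_ge: "a < m \<Longrightarrow> s $ a \<le> smax"
proof -
  have ne: "(\<lambda>a. s $ a) ` {..<m} \<noteq> {}" using m_pos by auto
  show "0 < smin" unfolding smin_def using ne s_pos by (subst Min_gr_iff) auto
  show "a < m \<Longrightarrow> smin \<le> s $ a" unfolding smin_def by (rule Min_le) auto
  show "a < m \<Longrightarrow> s $ a \<le> smax" unfolding smax_def by (rule Max_ge) auto
qed

lemma word_sub: "word w \<Longrightarrow> word (sub n w)"
proof (induction n arbitrary: w)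
  case (Suc n)
  have "word (subst_word \<zeta> w)"
    using Suc.prems subst unfolding subst_word_def substitution_def by fastforce
  then show ?case using Suc.IH by (simp add: funpow_swap1)
qed simp

lemma word_\<zeta>: "a < m \<Longrightarrow> word (\<zeta> a)"
  using subst by (auto simp: substitution_def)

lemma wlen_sub: "word w \<Longrightarrow> wlen s (sub n w) = \<theta> ^ n * wlen s w"
proof (induction n arbitrary: w)
  case (Suc n)
  have "wlen s (subst_word \<zeta> w) = \<theta> * wlen s w"
    using Suc.prems by (induction w) (simp_all add: subst_word_def wlen_subst_letter algebra_simps)
  moreover have "word (subst_word \<zeta> w)" using word_sub[OF Suc.prems, of 1] by simp
  ultimately show ?case using Suc.IH by (simp add: funpow_swap1)
qed simp

lemma wlen_nonneg: "word w \<Longrightarrow> 0 \<le> wlen s w"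
  by (induction w) (auto intro: add_nonneg_nonneg less_imp_le[OF s_pos])

lemma length_le_wlen: "word w \<Longrightarrow> smin * length w \<le> wlen s w"
proof (induction w)
  case (Cons a w)
  then show ?case using smin_le[of a] by (simp add: algebra_simps)
qed simp

lemma wlen_le_length: "word w \<Longrightarrow> wlen s w \<le> smax * length w"
proof (induction w)
  case (Cons a w)
  then show ?case using smax_ge[of a] by (simp add: algebra_simps)
qed simp

context
  fixes P :: "nat \<Rightarrow> real \<Rightarrow> complex"
  assumes P0: "\<And>a. a < m \<Longrightarrow> P a 0 = 0"
begin

lemma acc_nonpos: "word w \<Longrightarrow> \<tau> \<le> 0 \<Longrightarrow> acc s P w \<tau> = 0"
proof (induction w arbitrary: \<tau>)
  case (Cons a w)
  then have "clip (s $ a) \<tau> = 0" "\<tau> - s $ a \<le> 0" using s_pos[of a] by (auto simp: clip_def)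
  then show ?case using Cons P0[of a] by simp
qed simp

lemma acc_ge_wlen: "word w \<Longrightarrow> wlen s w \<le> \<tau> \<Longrightarrow> acc s P w \<tau> = tot s P w"
proof (induction w arbitrary: \<tau>)
  case (Cons a w)
  then have "clip (s $ a) \<tau> = s $ a"
    using s_pos[of a] wlen_nonneg[of w] by (auto simp: clip_def)
  then show ?case using Cons by simp
qed simp

lemma acc_clip: "word w \<Longrightarrow> acc s P w (clip (wlen s w) \<tau>) = acc s P w \<tau>"
  using wlen_nonneg[of w] acc_nonpos[of w] acc_ge_wlen[of w "wlen s w"] acc_ge_wlen[of w \<tau>]
  by (auto simp: clip_def max_def min_def)

lemma acc_append_left: "word v \<Longrightarrow> word w \<Longrightarrow> \<tau> \<le> wlen s v \<Longrightarrow> acc s P (v @ w) \<tau> = acc s P v \<tau>"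
  by (simp add: acc_append acc_nonpos)

lemma acc_append_right: "word v \<Longrightarrow> 0 \<le> \<tau> \<Longrightarrow> acc s P (v @ w) (wlen s v + \<tau>) = tot s P v + acc s P w \<tau>"
  by (simp add: acc_append acc_ge_wlen)

text \<open>This is the self-similarity of the tiling: the inflated tiles of w and the patches
  \<open>\<zeta> a\<close> begin and end at the same times. One substitution is thereby traded for a
  new family of tile profiles.\<close>

lemma acc_subst_word:
  "word w \<Longrightarrow> acc s P (subst_word \<zeta> w) (\<theta> * \<tau>) = acc s (\<lambda>a u. acc s P (\<zeta> a) (\<theta> * u)) w \<tau>"
proof (induction w arbitrary: \<tau>)
  case (Cons a w)
  then have a: "a < m" and w: "word w" by auto
  note \<zeta>a = word_\<zeta>[OF a]
  have "acc s P (subst_word \<zeta> (a # w)) (\<theta> * \<tau>) =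
      acc s P (\<zeta> a) (\<theta> * \<tau>) + acc s P (subst_word \<zeta> w) (\<theta> * (\<tau> - s $ a))"
    by (simp add: subst_word_def acc_append wlen_subst_letter[OF a] algebra_simps)
  also have "acc s P (\<zeta> a) (\<theta> * \<tau>) = acc s P (\<zeta> a) (\<theta> * clip (s $ a) \<tau>)"
  proof -
    have "clip (\<theta> * s $ a) (\<theta> * \<tau>) = \<theta> * clip (s $ a) \<tau>"
      using \<theta>_gt_1 by (simp add: clip_def max_def min_def mult_le_0_iff zero_le_mult_iff)
    then show ?thesis using acc_clip[OF \<zeta>a, of "\<theta> * \<tau>"] by (simp add: wlen_subst_letter[OF a])
  qed
  finally show ?case using Cons.IH[OF w] by simp
qed (simp add: subst_word_def)

lemma continuous_acc:
  assumes "\<And>a. a < m \<Longrightarrow> continuous_on {0..s $ a} (P a)" "word w"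
  shows "continuous_on UNIV (acc s P w)"
  using assms(2)
proof (induction w)
  case (Cons a w)
  then have a: "a < m" and w: "word w" by auto
  have "continuous_on UNIV (\<lambda>\<tau>. P a (clip (s $ a) \<tau>))"
  proof (rule continuous_on_compose2[OF assms(1)[OF a]])
    show "continuous_on UNIV (clip (s $ a))" unfolding clip_def by (intro continuous_intros)
    show "clip (s $ a) ` UNIV \<subseteq> {0..s $ a}"
      using clip_range[OF less_imp_le[OF s_pos[OF a]]] by blast
  qed
  moreover have "continuous_on UNIV (\<lambda>\<tau>. acc s P w (\<tau> - s $ a))"
    by (rule continuous_on_compose2[OF Cons.IH[OF w]]) (auto intro!: continuous_intros)
  ultimately show ?case by (simp add: continuous_on_add)
qed simp

context
  fixes B :: real
  assumes B: "\<And>a u. a < m \<Longrightarrow> 0 \<le> u \<Longrightarrow> u \<le> s $ a \<Longrightarrow> norm (P a u) \<le> B"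
begin

lemma B_clip: "a < m \<Longrightarrow> norm (P a (clip (s $ a) \<tau>)) \<le> B"
  using B clip_range[OF less_imp_le[OF s_pos]] by auto

lemma B_nonneg: "0 \<le> B"
  using B_clip[OF m_pos] norm_ge_zero order_trans by blast

text \<open>At most 1 + \<tau> / smin tiles start before a time \<tau> > 0, and each contributes at
  most B; the length of w does not matter.\<close>

lemma norm_acc_le: "word w \<Longrightarrow> norm (acc s P w \<tau>) \<le> B * (1 + max 0 \<tau> / smin)"
proof (induction w arbitrary: \<tau>)
  case Nil
  then show ?case using B_nonneg smin_pos by simp
next
  case (Cons a w)
  then have a: "a < m" and w: "word w" by auto
  show ?case
  proof (cases "\<tau> \<le> 0")
    case True
    then show ?thesis using acc_nonpos[OF Cons.prems True] B_nonneg by simp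
  next
    case False
    have "norm (acc s P (a # w) \<tau>) \<le> B + norm (acc s P w (\<tau> - s $ a))"
      using norm_triangle_ineq[of "P a (clip (s $ a) \<tau>)" "acc s P w (\<tau> - s $ a)"] B_clip[OF a, of \<tau>]
      by simp
    also have "norm (acc s P w (\<tau> - s $ a)) \<le> B * (\<tau> / smin)"
    proof (cases "\<tau> - s $ a \<le> 0")
      case True
      then show ?thesis using acc_nonpos[OF w True] B_nonneg False smin_pos by simp
    next
      case *: False
      have "norm (acc s P w (\<tau> - s $ a)) \<le> B * (1 + (\<tau> - s $ a) / smin)"
        using Cons.IH[OF w, of "\<tau> - s $ a"] * by (simp add: max_def)
      also have "\<dots> \<le> B * (\<tau> / smin)"
        using smin_le[OF a] smin_pos by (intro mult_left_mono B_nonneg) (simp add: field_simps)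
      finally show ?thesis .
    qed
    finally show ?thesis using False by (simp add: algebra_simps)
  qed
qed

text \<open>The constant 3 consists of two values of P in the tile where the interval
  [\<tau>, \<tau> + R] opens and of the 1 in \<open>norm_acc_le\<close> for the tiles after it. The
  bound depends neither on \<tau> nor on w.\<close>

lemma norm_acc_diff_le:
  "word w \<Longrightarrow> 0 \<le> R \<Longrightarrow> norm (acc s P w (\<tau> + R) - acc s P w \<tau>) \<le> B * (3 + R / smin)"
proof (induction w arbitrary: \<tau>)
  case Nil
  then show ?case using B_nonneg smin_pos by simp
next
  case (Cons a w)
  then have a: "a < m" and w: "word w" by auto
  show ?case
  proof (cases "s $ a \<le> \<tau>")
    case True
    then have "clip (s $ a) (\<tau> + R) = clip (s $ a) \<tau>" using Cons.prems by (simp add: clip_def)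
    then show ?thesis using Cons.IH[OF w Cons.prems(2), of "\<tau> - s $ a"] by (simp add: algebra_simps)
  next
    case False
    have "norm (acc s P (a # w) (\<tau> + R) - acc s P (a # w) \<tau>) =
        norm (P a (clip (s $ a) (\<tau> + R)) - P a (clip (s $ a) \<tau>) + acc s P w (\<tau> + R - s $ a))"
      using acc_nonpos[OF w, of "\<tau> - s $ a"] False by (simp add: algebra_simps)
    also have "\<dots> \<le> B + B + norm (acc s P w (\<tau> + R - s $ a))"
      by (intro norm_triangle_le add_mono order_refl norm_triangle_le_diff B_clip a)
    also have "norm (acc s P w (\<tau> + R - s $ a)) \<le> B * (1 + max 0 (\<tau> + R - s $ a) / smin)"
      by (rule norm_acc_le[OF w])
    also have "\<dots> \<le> B * (1 + R / smin)"
      using False Cons.prems(2) smin_pos B_nonneg by (intro mult_left_mono add_left_mono divide_right_mono) auto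
    finally show ?thesis by (simp add: algebra_simps)
  qed
qed

end

end

text \<open>A tile that is completed before \<tau> enters only through its end value, with error e;
  at most one tile is cut by \<tau> and contributes d. That d is not multiplied by the number of
  tiles is what makes the passage to the next level, followed by division by a rate above 1, a
  contraction.\<close>

lemma acc_diff_le:
  fixes e d :: real
  assumes P0: "\<And>a. a < m \<Longrightarrow> P a 0 = 0" and P0': "\<And>a. a < m \<Longrightarrow> P' a 0 = 0"
    and e: "\<And>a. a < m \<Longrightarrow> norm (P a (s $ a) - P' a (s $ a)) \<le> e"
    and d: "\<And>a u. a < m \<Longrightarrow> 0 \<le> u \<Longrightarrow> u \<le> s $ a \<Longrightarrow> norm (P a u - P' a u) \<le> d"
    and w: "word w"
  shows "norm (acc s P w \<tau> - acc s P' w \<tau>) \<le> length w * e + d"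
proof -
  have e0: "0 \<le> e" using e[OF m_pos] norm_ge_zero order_trans by blast
  have d0: "0 \<le> d" using d[OF m_pos order_refl] s_pos[OF m_pos] norm_ge_zero order_trans less_imp_le by blast
  show ?thesis using w
  proof (induction w arbitrary: \<tau>)
    case (Cons a w)
    then have a: "a < m" and w: "word w" by auto
    show ?case
    proof (cases "s $ a \<le> \<tau>")
      case True
      then have "clip (s $ a) \<tau> = s $ a" using s_pos[OF a] by (simp add: clip_def)
      then have "norm (acc s P (a # w) \<tau> - acc s P' (a # w) \<tau>) =
          norm ((P a (s $ a) - P' a (s $ a)) + (acc s P w (\<tau> - s $ a) - acc s P' w (\<tau> - s $ a)))"
        by (simp add: algebra_simps)
      also have "\<dots> \<le> e + (length w * e + d)"
        by (intro norm_triangle_le add_mono e a Cons.IH w)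
      finally show ?thesis by (simp add: algebra_simps)
    next
      case False
      have "norm (acc s P (a # w) \<tau> - acc s P' (a # w) \<tau>) = norm (P a (clip (s $ a) \<tau>) - P' a (clip (s $ a) \<tau>))"
        using acc_nonpos[of P, OF P0 w, of "\<tau> - s $ a"] acc_nonpos[of P', OF P0' w, of "\<tau> - s $ a"] False by simp
      also have "\<dots> \<le> d" using d[OF a] clip_range[OF less_imp_le[OF s_pos[OF a]], of \<tau>] by auto
      also have "\<dots> \<le> length (a # w) * e + d" using e0 by simp
      finally show ?thesis .
    qed
  qed (use d0 in simp)
qed

lemma tendsto_acc:
  assumes "\<And>a u. a < m \<Longrightarrow> 0 \<le> u \<Longrightarrow> u \<le> s $ a \<Longrightarrow> ((\<lambda>n. P n a u) \<longlongrightarrow> p a u) F" and "word w"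
  shows "((\<lambda>n. acc s (P n) w \<tau>) \<longlongrightarrow> acc s p w \<tau>) F"
  using assms(2)
proof (induction w arbitrary: \<tau>)
  case (Cons a w)
  then have a: "a < m" and w: "word w" by auto
  have "((\<lambda>n. P n a (clip (s $ a) \<tau>)) \<longlongrightarrow> p a (clip (s $ a) \<tau>)) F"
    using assms(1)[OF a] clip_range[OF less_imp_le[OF s_pos[OF a]], of \<tau>] by auto
  then show ?case using Cons.IH[OF w] by (auto intro: tendsto_add)
qed simp

lemma acc_scale: "acc s (\<lambda>a u. c * P a u) w \<tau> = c * acc s P w \<tau>"
  by (induction w arbitrary: \<tau>) (simp_all add: algebra_simps)

end

section \<open>Averages of quasi-additive functions of words\<close>

text \<open>Every concatenation costs C. The additional 1 pays for \<open>I []\<close>, which may be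
  nonzero but has norm at most C.\<close>

lemma quasi_additive_concat:
  fixes I :: "nat list \<Rightarrow> complex"
  assumes qa: "\<And>v w. set v \<subseteq> A \<Longrightarrow> set w \<subseteq> A \<Longrightarrow> norm (I (v @ w) - I v - I w) \<le> C"
    and us: "\<And>u. u \<in> set us \<Longrightarrow> set (g u) \<subseteq> A"
  shows "norm (I (concat (map g us)) - (\<Sum>u\<leftarrow>us. I (g u))) \<le> C * (length us + 1)"
  using us
proof (induction us)
  case Nil
  then show ?case using qa[of "[]" "[]"] by simp
next
  case (Cons a us)
  have "norm (I (concat (map g (a # us))) - (\<Sum>u\<leftarrow>a # us. I (g u))) =
      norm ((I (g a @ concat (map g us)) - I (g a) - I (concat (map g us))) +
        (I (concat (map g us)) - (\<Sum>u\<leftarrow>us. I (g u))))"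
    by (simp add: algebra_simps)
  also have "\<dots> \<le> C + C * (length us + 1)"
    using Cons by (intro norm_triangle_le add_mono qa Cons.IH) auto
  finally show ?case by (simp add: algebra_simps)
qed

lemma sum_list_map_eq_sum_count_list:
  fixes f :: "'a \<Rightarrow> 'b :: comm_semiring_1"
  assumes "set xs \<subseteq> X" and X: "finite X"
  shows "(\<Sum>x\<leftarrow>xs. f x) = (\<Sum>x\<in>X. of_nat (count_list xs x) * f x)"
  using assms(1)
proof (induction xs)
  case (Cons a xs)
  have "(\<Sum>x\<in>X. of_nat (count_list (a # xs) x) * f x) =
      (\<Sum>x\<in>X. (if x = a then f x else 0) + of_nat (count_list xs x) * f x)"
    by (intro sum.cong) (auto simp: algebra_simps)
  also have "\<dots> = f a + (\<Sum>x\<in>X. of_nat (count_list xs x) * f x)"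
    using X Cons.prems by (simp add: sum.distrib)
  finally show ?case using Cons by simp
qed simp

locale gap_tiling = self_similar_tiling +
  fixes \<theta>\<^sub>2 :: real and zs :: "complex list"
  assumes eigenvalues: "eigenvalue_list (subst_matrix m \<zeta>) (complex_of_real \<theta> # complex_of_real \<theta>\<^sub>2 # zs)"
    and \<theta>\<^sub>2_less: "\<theta>\<^sub>2 < \<theta>" and \<theta>\<^sub>2_gt_1: "1 < \<theta>\<^sub>2" and zs_less: "\<And>z. z \<in> set zs \<Longrightarrow> norm z < \<theta>\<^sub>2"
begin

definition legal :: "nat list \<Rightarrow> bool" where
  "legal w \<longleftrightarrow> (\<exists>a<m. \<exists>n. sublist w (sub n [a]))"

abbreviation S\<^sub>C :: "complex mat" where
  "S\<^sub>C \<equiv> map_mat complex_of_real (subst_matrix m \<zeta>)"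

lemma S\<^sub>C_carrier: "S\<^sub>C \<in> carrier_mat m m"
  by (simp add: subst_matrix_def)

lemma char_poly_S\<^sub>C: "char_poly S\<^sub>C = (\<Prod>z\<leftarrow>complex_of_real \<theta> # complex_of_real \<theta>\<^sub>2 # zs. [:- z, 1:])"
  using eigenvalues unfolding eigenvalue_list_def .

lemma row_times_subst_matrix:
  assumes j: "j < m"
  shows "(\<Sum>i<m. x i * S\<^sub>C $$ (i, j)) = (\<Sum>b\<leftarrow>\<zeta> j. x b)"
proof -
  have "(\<Sum>b\<leftarrow>\<zeta> j. x b) = (\<Sum>b<m. of_nat (count_list (\<zeta> j) b) * x b)"
    by (rule sum_list_map_eq_sum_count_list[OF word_\<zeta>[OF j]]) simp
  also have "\<dots> = (\<Sum>i<m. x i * S\<^sub>C $$ (i, j))"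
    using j by (intro sum.cong) (auto simp: subst_matrix_def mult.commute)
  finally show ?thesis by simp
qed

lemma word_sub_letter: "b < m \<Longrightarrow> word (sub n [b])"
  using word_sub[of "[b]"] by simp

lemma sub_Suc_letter: "sub (Suc n) [a] = concat (map (\<lambda>b. sub n [b]) (\<zeta> a))"
proof -
  have "sub (Suc n) [a] = sub n (\<zeta> a)" by (simp add: funpow_swap1 subst_word_def)
  then show ?thesis using subst_word_concat[of n \<zeta> "\<zeta> a"] by simp
qed

lemma word_legal: "legal w \<Longrightarrow> word w"
proof -
  assume "legal w"
  then obtain a n where a: "a < m" and "sublist w (sub n [a])" by (auto simp: legal_def)
  then have "set w \<subseteq> set (sub n [a])" by (intro set_mono_sublist)
  with word_sub[of "[a]" n] a show ?thesis by auto
qed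

text \<open>Every legal word is, up to bounded ends, a concatenation of words \<open>\<zeta>\<^sup>n(b)\<close>, and \<open>I (\<zeta>\<^sup>n(b))\<close> satisfies the
  matrix recursion up to bounded errors. This is what unique ergodicity amounts to here.\<close>

lemma quasi_additive_average:
  fixes I :: "nat list \<Rightarrow> complex"
  assumes qa: "\<And>v w. word v \<Longrightarrow> word w \<Longrightarrow> norm (I (v @ w) - I v - I w) \<le> C"
  obtains \<kappa> :: complex where "\<And>a. a < m \<Longrightarrow> (\<lambda>n. I (sub n [a]) / \<theta> ^ n) \<longlonglongrightarrow> \<kappa> * s $ a"
    and "\<And>\<epsilon>. 0 < \<epsilon> \<Longrightarrow> \<exists>K. \<forall>w. legal w \<longrightarrow> norm (I w - \<kappa> * wlen s w) \<le> \<epsilon> * wlen s w + K"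
proof -
  have C0: "0 \<le> C" using order_trans[OF norm_ge_zero qa[of "[]" "[]"]] by simp
  define x where "x n j = I (sub n [j])" for n j
  define e where "e n j = x (Suc n) j - (\<Sum>b\<leftarrow>\<zeta> j. x n b)" for n j
  define L where "L = Max ((\<lambda>a. real (length (\<zeta> a))) ` {..<m})"
  have L: "length (\<zeta> a) \<le> L" if "a < m" for a unfolding L_def using that by (intro Max_ge) auto
  have e: "norm (e n j) \<le> C * (L + 1)" if j: "j < m" for n j
  proof -
    have "norm (e n j) \<le> C * (length (\<zeta> j) + 1)"
      unfolding e_def x_def sub_Suc_letter
    proof (rule quasi_additive_concat[where A = "{..<m}", OF qa])
      show "word (sub n [u])" if "u \<in> set (\<zeta> j)" for u
        using that word_\<zeta>[OF j] by (intro word_sub_letter) auto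
    qed
    also have "\<dots> \<le> C * (L + 1)" using L[OF j] C0 by (intro mult_left_mono) auto
    finally show ?thesis .
  qed
  have dom: "norm z < \<theta>" if "z \<in> set (complex_of_real \<theta>\<^sub>2 # zs)" for z
    using that \<theta>\<^sub>2_less \<theta>\<^sub>2_gt_1 zs_less[of z] by auto
  have s_left: "(\<Sum>i<m. complex_of_real (s $ i) * S\<^sub>C $$ (i, j)) = \<theta> * complex_of_real (s $ j)" if j: "j < m" for j
  proof -
    have "(\<Sum>b\<leftarrow>w. complex_of_real (s $ b)) = complex_of_real (wlen s w)" for w
      by (induction w) simp_all
    then show ?thesis unfolding row_times_subst_matrix[OF j] by (simp add: wlen_subst_letter[OF j])
  qed
  have rec: "x (Suc n) j = (\<Sum>i<m. x n i * S\<^sub>C $$ (i, j)) + e n j" if "j < m" for n j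
    unfolding row_times_subst_matrix[OF that] e_def by simp
  have sm: "complex_of_real (s $ 0) \<noteq> 0" using s_pos[OF m_pos] by simp
  obtain \<kappa> where \<kappa>: "\<And>a. a < m \<Longrightarrow> (\<lambda>n. x n a / \<theta> ^ n) \<longlonglongrightarrow> \<kappa> * complex_of_real (s $ a)"
    by (rule dominant_row_recursion[where m = m and A = "S\<^sub>C" and x = x and e = e and k = 0 and zs = "complex_of_real \<theta>\<^sub>2 # zs"
          and s = "\<lambda>i. complex_of_real (s $ i)", OF S\<^sub>C_carrier char_poly_S\<^sub>C dom \<theta>_gt_1 rec e s_left m_pos sm]) (assumption | blast)+
  have "\<exists>K. \<forall>w. legal w \<longrightarrow> norm (I w - \<kappa> * wlen s w) \<le> \<epsilon> * wlen s w + K" if \<epsilon>: "0 < \<epsilon>" for \<epsilon>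
  proof -
    have "\<forall>\<^sub>F n in sequentially. \<forall>a\<in>{..<m}. norm (x n a / \<theta> ^ n - \<kappa> * s $ a) < \<epsilon> / 2 * s $ a"
    proof (intro eventually_ball_finite ballI)
      fix a assume "a \<in> {..<m}"
      then have a: "a < m" by simp
      from tendstoD[OF \<kappa>[OF a], of "\<epsilon> / 2 * s $ a"]
      show "\<forall>\<^sub>F n in sequentially. norm (x n a / \<theta> ^ n - \<kappa> * s $ a) < \<epsilon> / 2 * s $ a"
        using \<epsilon> s_pos[OF a] by (simp add: dist_norm)
    qed simp
    \<comment> \<open>The error C of appending one block is spread over a block of length at least
      \<theta>^n smin.\<close>
    moreover have "\<forall>\<^sub>F n in sequentially. C * (1 / \<theta>) ^ n < \<epsilon> / 2 * smin"
    proof (rule order_tendstoD)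
      show "(\<lambda>n. C * (1 / \<theta>) ^ n) \<longlonglongrightarrow> C * 0"
        using \<theta>_gt_1 by (intro tendsto_mult tendsto_const LIMSEQ_power_zero) simp
      show "C * 0 < \<epsilon> / 2 * smin" using \<epsilon> smin_pos by simp
    qed
    ultimately obtain n where n1: "\<And>a. a < m \<Longrightarrow> norm (x n a / \<theta> ^ n - \<kappa> * s $ a) < \<epsilon> / 2 * s $ a"
      and n2: "C * (1 / \<theta>) ^ n < \<epsilon> / 2 * smin"
      using eventually_happens'[OF sequentially_bot eventually_conj] by (metis (mono_tags, lifting) lessThan_iff)
    have \<theta>n: "0 < \<theta> ^ n" using \<theta>_gt_1 by simp
    have n1': "norm (x n a - \<kappa> * wlen s (sub n [a])) \<le> \<epsilon> / 2 * wlen s (sub n [a])" if a: "a < m" for a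
    proof -
      have "norm (x n a - \<kappa> * wlen s (sub n [a])) = \<theta> ^ n * norm (x n a / \<theta> ^ n - \<kappa> * s $ a)"
      proof -
        have "x n a - \<kappa> * wlen s (sub n [a]) = complex_of_real (\<theta> ^ n) * (x n a / \<theta> ^ n - \<kappa> * s $ a)"
          using \<theta>_gt_1 a by (simp add: wlen_sub field_simps)
        then show ?thesis using \<theta>n by (simp only: norm_mult norm_of_real abs_of_pos)
      qed
      also have "\<dots> \<le> \<theta> ^ n * (\<epsilon> / 2 * s $ a)" using n1[OF a] \<theta>n by (intro mult_left_mono) auto
      finally show ?thesis using a by (simp add: wlen_sub mult_ac)
    qed
    \<comment> \<open>Bounds the two ends of a decomposition and also all words found at a level k
      \<le> n. Only finitely many words have length at most l, and K absorbs them.\<close>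
    define l where "l = Max ((\<lambda>(k, a). length (sub k [a])) ` ({..n} \<times> {..<m}))"
    have l: "length (sub k [a]) \<le> l" if "k \<le> n" "a < m" for k a
      unfolding l_def using that by (intro Max_ge) (auto intro!: image_eqI[of _ _ "(k, a)"])
    define W where "W = {w. word w \<and> length w \<le> l}"
    have "finite W" unfolding W_def by (rule finite_lists_length_le) simp
    define K where "K = Max ((\<lambda>w. norm (I w - \<kappa> * wlen s w)) ` W)"
    have K: "norm (I w - \<kappa> * wlen s w) \<le> K" if "w \<in> W" for w
      unfolding K_def using \<open>finite W\<close> that by (intro Max_ge) auto
    have "[] \<in> W" by (simp add: W_def)
    have K0: "0 \<le> K" by (rule order_trans[OF norm_ge_zero K[OF \<open>[] \<in> W\<close>]])
    \<comment> \<open>K for each of the two ends, C for each of the two cuts, and C for the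
      additional 1 in \<open>quasi_additive_concat\<close>. Of \<epsilon>, one half pays for gluing
      the blocks and the other for the averages over single blocks.\<close>
    have "norm (I w - \<kappa> * wlen s w) \<le> \<epsilon> * wlen s w + (2 * K + 3 * C)" if w_legal: "legal w" for w
    proof -
      have w: "word w" by (rule word_legal[OF w_legal])
      obtain a k where a: "a < m" and k: "sublist w (sub k [a])" using w_legal by (auto simp: legal_def)
      show ?thesis
      proof (cases "k \<le> n")
        case True
        have "length w \<le> l" using sublist_length_le[OF k] l[OF True a] by simp
        then have "norm (I w - \<kappa> * wlen s w) \<le> K" using w by (intro K) (simp add: W_def)
        then show ?thesis using K0 C0 \<epsilon> wlen_nonneg[OF w]
          by (smt (verit) mult_nonneg_nonneg)
      next
        case False
        define v where "v = sub (k - n) [a]"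
        have v: "word v" unfolding v_def using a by (intro word_sub) simp
        have "sub k [a] = sub n v" unfolding v_def using False
          by (metis comp_apply funpow_add le_add_diff_inverse nat_le_linear)
        then have "sublist w (concat (map (\<lambda>b. sub n [b]) v))" using k subst_word_concat by metis
        then obtain p us q where dec: "w = p @ concat (map (\<lambda>b. sub n [b]) us) @ q"
          and pq: "length p \<le> l" "length q \<le> l" and us: "set us \<subseteq> set v"
          using sublist_concat_decomposition[of w "\<lambda>b. sub n [b]" v l] l[of n] v by blast
        define c where "c = concat (map (\<lambda>b. sub n [b]) us)"
        have cu: "c = sub n us" unfolding c_def by (rule subst_word_concat[symmetric])
        have us_word: "word us" using us v by auto
        have wpq: "word p" "word q" "word c" using w dec by (auto simp: c_def)
        have lc: "wlen s c = \<theta> ^ n * wlen s us" unfolding cu by (rule wlen_sub[OF us_word])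
        have 1: "norm (I c - (\<Sum>b\<leftarrow>us. x n b)) \<le> C * (length us + 1)"
          unfolding c_def x_def
        proof (rule quasi_additive_concat[where A = "{..<m}", OF qa])
          show "word (sub n [u])" if "u \<in> set us" for u
            using that us_word by (intro word_sub_letter) auto
        qed
        have "C * length us \<le> \<epsilon> / 2 * wlen s c"
        proof -
          have "C * length us = (C * (1 / \<theta>) ^ n) * (\<theta> ^ n * length us)"
            using \<theta>_gt_1 by (simp add: power_divide)
          also have "\<dots> \<le> (\<epsilon> / 2 * smin) * (\<theta> ^ n * length us)"
            using n2 \<theta>n by (intro mult_right_mono) auto
          also have "\<dots> = \<epsilon> / 2 * (\<theta> ^ n * (smin * length us))" by (simp add: mult_ac)
          also have "\<dots> \<le> \<epsilon> / 2 * (\<theta> ^ n * wlen s us)"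
            using \<epsilon> \<theta>n length_le_wlen[OF us_word] by (intro mult_left_mono) auto
          finally show ?thesis by (simp add: lc)
        qed
        with 1 have 1: "norm (I c - (\<Sum>b\<leftarrow>us. x n b)) \<le> \<epsilon> / 2 * wlen s c + C" by (simp add: algebra_simps)
        have 2: "norm ((\<Sum>b\<leftarrow>us. x n b) - \<kappa> * wlen s c) \<le> \<epsilon> / 2 * wlen s c"
          unfolding c_def using us_word
        proof (induction us)
          case (Cons b us)
          have "norm ((\<Sum>b\<leftarrow>b # us. x n b) - \<kappa> * wlen s (concat (map (\<lambda>b. sub n [b]) (b # us)))) =
              norm ((x n b - \<kappa> * wlen s (sub n [b])) + ((\<Sum>b\<leftarrow>us. x n b) - \<kappa> * wlen s (concat (map (\<lambda>b. sub n [b]) us))))"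
            by (simp add: algebra_simps)
          also have "\<dots> \<le> \<epsilon> / 2 * wlen s (sub n [b]) + \<epsilon> / 2 * wlen s (concat (map (\<lambda>b. sub n [b]) us))"
            using Cons by (intro norm_triangle_le add_mono n1' Cons.IH) auto
          finally show ?case by (simp add: algebra_simps)
        qed simp
        have 3: "norm (I w - I p - I c - I q) \<le> 2 * C"
        proof -
          have "norm (I w - I p - I c - I q) = norm ((I (p @ (c @ q)) - I p - I (c @ q)) + (I (c @ q) - I c - I q))"
            by (simp add: dec c_def algebra_simps)
          also have "\<dots> \<le> C + C" using wpq by (intro norm_triangle_le add_mono qa) auto
          finally show ?thesis by simp
        qed
        have p: "norm (I p - \<kappa> * wlen s p) \<le> K" "norm (I q - \<kappa> * wlen s q) \<le> K"
          using wpq pq by (auto intro!: K simp: W_def)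
        have wl: "wlen s w = wlen s p + wlen s c + wlen s q" by (simp add: dec c_def)
        have "norm (I w - \<kappa> * wlen s w) = norm ((I w - I p - I c - I q) + ((I p - \<kappa> * wlen s p) +
            ((I q - \<kappa> * wlen s q) + ((I c - (\<Sum>b\<leftarrow>us. x n b)) + ((\<Sum>b\<leftarrow>us. x n b) - \<kappa> * wlen s c)))))"
          by (simp add: wl algebra_simps)
        also have "\<dots> \<le> 2 * C + (K + (K + ((\<epsilon> / 2 * wlen s c + C) + \<epsilon> / 2 * wlen s c)))"
          by (intro norm_triangle_le add_mono 1 2 3 p)
        also have "\<dots> = \<epsilon> * wlen s c + (2 * K + 3 * C)" by (simp add: algebra_simps)
        also have "\<dots> \<le> \<epsilon> * wlen s w + (2 * K + 3 * C)"
          using \<epsilon> wlen_nonneg[OF wpq(1)] wlen_nonneg[OF wpq(2)] wl by simp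
        finally show ?thesis .
      qed
    qed
    then show ?thesis by blast
  qed
  with \<kappa> show thesis using that[of \<kappa>] unfolding x_def by blast
qed

end

section \<open>Correlations and renormalization\<close>

text \<open>When P consists of tile integrals of f, this is the orbit integral over a window of
  length R with lag t, times the conjugate of the one without lag, seen from the position \<tau> in
  w.\<close>

definition corr_density :: "real vec \<Rightarrow> (nat \<Rightarrow> real \<Rightarrow> complex) \<Rightarrow> real \<Rightarrow> real \<Rightarrow> nat list \<Rightarrow> real \<Rightarrow> complex" where
  "corr_density s P t R w \<tau> = (acc s P w (\<tau> + t + R) - acc s P w (\<tau> + t)) * cnj (acc s P w (\<tau> + R) - acc s P w \<tau>)"

text \<open>Near the end of \<open>w\<close> the density looks beyond \<open>w\<close>, where \<open>acc\<close> is constant. No truncation is made, since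
  the effect is bounded in terms of \<open>t + R\<close> only.\<close>

definition corr :: "real vec \<Rightarrow> (nat \<Rightarrow> real \<Rightarrow> complex) \<Rightarrow> real \<Rightarrow> real \<Rightarrow> nat list \<Rightarrow> complex" where
  "corr s P t R w = integral {0..wlen s w} (corr_density s P t R w)"

context self_similar_tiling
begin

definition admissible :: "real \<Rightarrow> (nat \<Rightarrow> real \<Rightarrow> complex) \<Rightarrow> bool" where
  "admissible B P \<longleftrightarrow> (\<forall>a<m. P a 0 = 0 \<and> continuous_on {0..s $ a} (P a) \<and> (\<forall>u\<in>{0..s $ a}. norm (P a u) \<le> B))"

lemma admissibleD:
  assumes "admissible B P" "a < m"
  shows "P a 0 = 0" "continuous_on {0..s $ a} (P a)" "0 \<le> u \<Longrightarrow> u \<le> s $ a \<Longrightarrow> norm (P a u) \<le> B"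
  using assms by (auto simp: admissible_def)

definition qbound :: "real \<Rightarrow> real \<Rightarrow> real" where
  "qbound B R = (B * (3 + R / smin))\<^sup>2"

context
  fixes P :: "nat \<Rightarrow> real \<Rightarrow> complex" and B :: real
  assumes P: "admissible B P"
begin

lemmas P_zero = admissibleD(1)[OF P] and P_cont = admissibleD(2)[OF P] and P_bound = admissibleD(3)[OF P]

lemma continuous_corr_density:
  assumes w: "word w" shows "continuous_on A (corr_density s P t R w)"
proof -
  have *: "continuous_on A (\<lambda>\<tau>. acc s P w (\<tau> + c))" for c
    by (rule continuous_on_compose2[OF continuous_acc[OF P_zero P_cont w]]) (auto intro!: continuous_intros)
  show ?thesis
    unfolding corr_density_def using *[of 0] *[of "t + R"] *[of t] *[of R]
    by (intro continuous_intros) (simp_all add: add.assoc)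
qed

lemma corr_density_bound:
  assumes w: "word w" and R: "0 \<le> R"
  shows "norm (corr_density s P t R w \<tau>) \<le> qbound B R"
proof -
  have *: "norm (acc s P w (x + R) - acc s P w x) \<le> B * (3 + R / smin)" for x
    by (rule norm_acc_diff_le[of P, OF P_zero P_bound w R])
  show ?thesis unfolding corr_density_def qbound_def power2_eq_square norm_mult complex_mod_cnj
    using *[of "\<tau> + t"] *[of \<tau>] by (intro mult_mono) (auto intro: order_trans[OF norm_ge_zero])
qed

lemma qbound_nonneg: "0 \<le> qbound B R"
  by (simp add: qbound_def)

lemma corr_density_append_right:
  assumes "word v" "0 \<le> t" "0 \<le> R" "0 \<le> \<tau>"
  shows "corr_density s P t R (v @ w) (wlen s v + \<tau>) = corr_density s P t R w \<tau>"
  using acc_append_right[of P, OF P_zero assms(1), of "\<tau> + t + R" w] acc_append_right[of P, OF P_zero assms(1), of "\<tau> + t" w]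
    acc_append_right[of P, OF P_zero assms(1), of "\<tau> + R" w] acc_append_right[of P, OF P_zero assms(1), of "\<tau>" w] assms
  unfolding corr_density_def by (simp add: add.assoc)

lemma corr_density_append_left:
  assumes "word v" "word w" "0 \<le> t" "0 \<le> R" "\<tau> + t + R \<le> wlen s v"
  shows "corr_density s P t R (v @ w) \<tau> = corr_density s P t R v \<tau>"
  using assms unfolding corr_density_def by (simp add: acc_append_left[of P, OF P_zero])

text \<open>Windows only look forward, so from the end of v on the density is that of w alone, and
  the whole defect of additivity sits on v.\<close>

lemma integral_corr_density_append:
  assumes v: "word v" and w: "word w" and t: "0 \<le> t" and R: "0 \<le> R"
  shows "corr s P t R (v @ w) = integral {0..wlen s v} (corr_density s P t R (v @ w)) + corr s P t R w"
proof -
  have vw: "word (v @ w)" using v w by simp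
  have i: "corr_density s P t R (v @ w) integrable_on {a..b}" for a b
    by (rule integrable_continuous_interval[OF continuous_corr_density[OF vw]])
  have "corr s P t R (v @ w) = integral {0..wlen s v} (corr_density s P t R (v @ w)) +
      integral {wlen s v..wlen s v + wlen s w} (corr_density s P t R (v @ w))"
    unfolding corr_def
    by (subst Henstock_Kurzweil_Integration.integral_combine) (use wlen_nonneg v w i in auto)
  also have "integral {wlen s v..wlen s v + wlen s w} (corr_density s P t R (v @ w)) =
      integral {0..wlen s w} (corr_density s P t R (v @ w) \<circ> (+) (wlen s v))"
    by (subst integral_shift_Icc_real) (simp add: add.commute)
  also have "\<dots> = corr s P t R w"
    unfolding corr_def
    by (rule Henstock_Kurzweil_Integration.integral_cong) (use corr_density_append_right[OF v t R] in auto)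
  finally show ?thesis .
qed

text \<open>Only positions in the last t + R time units of v have windows that reach into w; there
  two densities bounded by \<open>qbound B R\<close> are compared.\<close>

lemma corr_append:
  assumes v: "word v" and w: "word w" and t: "0 \<le> t" and R: "0 \<le> R"
  shows "norm (corr s P t R (v @ w) - corr s P t R v - corr s P t R w) \<le> 2 * qbound B R * (t + R)"
proof -
  have vw: "word (v @ w)" using v w by simp
  define g where "g \<tau> = corr_density s P t R (v @ w) \<tau> - corr_density s P t R v \<tau>" for \<tau>
  define c where "c = max 0 (wlen s v - (t + R))"
  have c: "0 \<le> c" "c \<le> wlen s v" "wlen s v - c \<le> t + R"
    using wlen_nonneg[OF v] t R by (auto simp: c_def)
  have gc: "continuous_on A g" for A
    unfolding g_def by (intro continuous_intros continuous_corr_density v vw)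
  have "corr s P t R (v @ w) - corr s P t R v - corr s P t R w = integral {0..wlen s v} g"
    unfolding integral_corr_density_append[OF v w t R] g_def corr_def[of s P t R v]
    using Henstock_Kurzweil_Integration.integral_diff[OF integrable_continuous_interval[OF continuous_corr_density[OF vw]]
        integrable_continuous_interval[OF continuous_corr_density[OF v]]] by simp
  also have "\<dots> = integral {0..c} g + integral {c..wlen s v} g"
    using c by (subst Henstock_Kurzweil_Integration.integral_combine) (auto intro!: integrable_continuous_interval gc)
  also have "integral {0..c} g = integral {0..c} (\<lambda>_. 0)"
  proof (cases "wlen s v \<le> t + R")
    case False
    then show ?thesis
      by (intro Henstock_Kurzweil_Integration.integral_cong)
        (auto simp: g_def c_def intro!: corr_density_append_left[OF v w t R])
  qed (simp add: c_def)
  finally have eq: "corr s P t R (v @ w) - corr s P t R v - corr s P t R w = integral {c..wlen s v} g" by simp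
  have "norm (integral {c..wlen s v} g) \<le> (2 * qbound B R) * (wlen s v - c)"
  proof (rule integral_bound[OF c(2) gc])
    show "norm (g \<tau>) \<le> 2 * qbound B R" for \<tau>
      unfolding g_def using corr_density_bound[OF vw R, of t \<tau>] corr_density_bound[OF v R, of t \<tau>]
      by (intro norm_triangle_le_diff) simp
  qed
  also have "\<dots> \<le> 2 * qbound B R * (t + R)"
    using c(3) qbound_nonneg by (intro mult_left_mono) auto
  finally show ?thesis unfolding eq .
qed

text \<open>At lag 0 the density is a squared norm, so discarding positions lowers the integral.
  What is kept are the windows that lie inside a single copy of the tile a.\<close>

lemma corr_ge_count:
  assumes w: "word w" and R: "0 \<le> R" "R \<le> s $ a"
  shows "count_list w a * integral {0..s $ a - R} (\<lambda>\<tau>. (norm (P a (\<tau> + R) - P a \<tau>))\<^sup>2) \<le> Re (corr s P 0 R w)"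
  using w
proof (induction w)
  case Nil
  then show ?case by (simp add: corr_def)
next
  case (Cons b w)
  then have b: "b < m" and wb: "word [b]" and w: "word w" by auto
  define r where "r \<tau> = (norm (acc s P (b # w) (\<tau> + R) - acc s P (b # w) \<tau>))\<^sup>2" for \<tau>
  have qr: "corr_density s P 0 R (b # w) \<tau> = complex_of_real (r \<tau>)" for \<tau>
    unfolding corr_density_def r_def by (simp only: add_0_right complex_norm_square)
  have rc: "continuous_on A r" for A
  proof -
    have "continuous_on A (\<lambda>\<tau>. Re (corr_density s P 0 R (b # w) \<tau>))"
      by (intro continuous_intros continuous_corr_density Cons.prems)
    then show ?thesis by (simp add: qr)
  qed
  have "Re (corr s P 0 R (b # w)) = integral {0..s $ b} r + Re (corr s P 0 R w)"
  proof -
    have "integral {0..s $ b} (\<lambda>\<tau>. complex_of_real (r \<tau>)) = complex_of_real (integral {0..s $ b} r)"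
      by (intro integral_unique has_integral_of_real integrable_integral integrable_continuous_interval rc)
    moreover have "corr_density s P 0 R (b # w) = (\<lambda>\<tau>. complex_of_real (r \<tau>))" using qr by (rule ext)
    ultimately show ?thesis using integral_corr_density_append[OF wb w order_refl R(1)] by simp
  qed
  moreover have "(if b = a then 1 else 0) * integral {0..s $ a - R} (\<lambda>\<tau>. (norm (P a (\<tau> + R) - P a \<tau>))\<^sup>2) \<le> integral {0..s $ b} r"
  proof (cases "b = a")
    case True
    have "integral {0..s $ a - R} (\<lambda>\<tau>. (norm (P a (\<tau> + R) - P a \<tau>))\<^sup>2) = integral {0..s $ a - R} r"
    proof (rule Henstock_Kurzweil_Integration.integral_cong)
      fix \<tau> assume \<tau>: "\<tau> \<in> {0..s $ a - R}"
      have "acc s P (b # w) x = P a x" if "0 \<le> x" "x \<le> s $ a" for x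
        using that acc_nonpos[of P, OF P_zero w, of "x - s $ a"] True by (simp add: clip_def)
      then show "(norm (P a (\<tau> + R) - P a \<tau>))\<^sup>2 = r \<tau>" using \<tau> R(1) by (simp add: r_def)
    qed
    also have "\<dots> \<le> integral {0..s $ b} r"
      using True R by (intro integral_subset_le integrable_continuous_interval rc) (auto simp: r_def)
    finally show ?thesis using True by simp
  next
    case False
    have "0 \<le> integral {0..s $ b} r"
      by (rule Henstock_Kurzweil_Integration.integral_nonneg[OF integrable_continuous_interval[OF rc]]) (simp add: r_def)
    then show ?thesis using False by simp
  qed
  ultimately show ?case using Cons.IH[OF w] by (auto simp: algebra_simps split: if_splits)
qed

end

section \<open>Renormalized tile profiles and their limit\<close>

text \<open>\<open>lev P n a\<close> describes the word \<open>\<zeta>\<^sup>n(a)\<close>, rescaled in time by \<open>\<theta>\<^sup>-\<^sup>n\<close> to the length of the tile \<open>a\<close>.\<close>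

primrec lev :: "(nat \<Rightarrow> real \<Rightarrow> complex) \<Rightarrow> nat \<Rightarrow> nat \<Rightarrow> real \<Rightarrow> complex" where
  "lev P 0 = P"
| "lev P (Suc n) = (\<lambda>a u. acc s (lev P n) (\<zeta> a) (\<theta> * u))"

lemma lev_zero:
  assumes "\<And>a. a < m \<Longrightarrow> P a 0 = 0" shows "a < m \<Longrightarrow> lev P n a 0 = 0"
proof (induction n arbitrary: a)
  case (Suc n)
  then show ?case using acc_nonpos[of "lev P n", OF Suc.IH word_\<zeta>] by simp
qed (use assms in simp)

lemma lev_continuous:
  assumes "\<And>a. a < m \<Longrightarrow> P a 0 = 0" "\<And>a. a < m \<Longrightarrow> continuous_on {0..s $ a} (P a)"
  shows "a < m \<Longrightarrow> continuous_on {0..s $ a} (lev P n a)"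
proof (induction n arbitrary: a)
  case (Suc n)
  have "continuous_on UNIV (acc s (lev P n) (\<zeta> a))"
    by (rule continuous_acc[OF lev_zero[of P, OF assms(1)] Suc.IH word_\<zeta>[OF Suc.prems]])
  then have "continuous_on {0..s $ a} (\<lambda>u. acc s (lev P n) (\<zeta> a) (\<theta> * u))"
    by (rule continuous_on_compose2) (auto intro!: continuous_intros)
  then show ?case by simp
qed (use assms in simp)

lemma acc_lev:
  assumes P0: "\<And>a. a < m \<Longrightarrow> P a 0 = 0"
  shows "word w \<Longrightarrow> acc s (lev P n) w \<tau> = acc s P (sub n w) (\<theta> ^ n * \<tau>)"
proof (induction n arbitrary: w \<tau>)
  case (Suc n)
  have w: "word (subst_word \<zeta> w)" using word_sub[OF Suc.prems, of 1] by simp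
  have "acc s (lev P (Suc n)) w \<tau> = acc s (lev P n) (subst_word \<zeta> w) (\<theta> * \<tau>)"
    using acc_subst_word[of "lev P n", OF lev_zero[of P, OF P0] Suc.prems] by simp
  also have "\<dots> = acc s P (sub n (subst_word \<zeta> w)) (\<theta> ^ n * (\<theta> * \<tau>))"
    by (rule Suc.IH[OF w])
  finally show ?case by (simp add: funpow_swap1 mult_ac)
qed simp

lemma tot_lev:
  assumes P0: "\<And>a. a < m \<Longrightarrow> P a 0 = 0" and w: "word w"
  shows "tot s (lev P n) w = tot s P (sub n w)"
proof -
  have "tot s (lev P n) w = acc s (lev P n) w (wlen s w)"
    using acc_ge_wlen[of "lev P n", OF lev_zero[of P, OF P0] w] by simp
  also have "\<dots> = acc s P (sub n w) (wlen s (sub n w))"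
    by (simp add: acc_lev[of P, OF P0 w] wlen_sub[OF w])
  also have "\<dots> = tot s P (sub n w)"
    using acc_ge_wlen[of P, OF P0 word_sub[OF w]] by simp
  finally show ?thesis .
qed

text \<open>The densities agree pointwise by \<open>acc_lev\<close>; the outer factor is the
  Jacobian of the change of time scale.\<close>

lemma corr_lev:
  assumes P: "admissible B P" and w: "word w"
  shows "corr s P (\<theta> ^ n * t) (\<theta> ^ n * R) (sub n w) = \<theta> ^ n * corr s (lev P n) t R w"
proof -
  define c where "c = \<theta> ^ n"
  have c: "0 < c" using \<theta>_gt_1 by (simp add: c_def)
  define g where "g = corr_density s P (c * t) (c * R) (sub n w)"
  have "g integrable_on {0..c * wlen s w}" unfolding g_def
    by (intro integrable_continuous_interval continuous_corr_density[OF P] word_sub w)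
  then have "(g has_integral corr s P (c * t) (c * R) (sub n w)) {0..c * wlen s w}"
    unfolding corr_def g_def by (simp add: wlen_sub[OF w] c_def integrable_integral)
  from has_integral_stretch_real[OF this, of c]
  have "((\<lambda>x. g (c * x)) has_integral (1 / c) *\<^sub>R corr s P (c * t) (c * R) (sub n w)) {0..wlen s w}"
    using c by (simp add: image_divide_atLeastAtMost)
  moreover have al: "acc s (lev P n) w \<tau> = acc s P (sub n w) (\<theta> ^ n * \<tau>)" for \<tau>
    by (rule acc_lev[of P, OF admissibleD(1)[OF P] w])
  have "g (c * x) = corr_density s (lev P n) t R w x" for x
    unfolding g_def corr_density_def c_def by (simp add: distrib_left al)
  ultimately have "corr s (lev P n) t R w = (1 / c) *\<^sub>R corr s P (c * t) (c * R) (sub n w)"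
    unfolding corr_def by (intro integral_unique) simp
  then show ?thesis using \<theta>_gt_1 unfolding c_def by (simp add: scaleR_conv_of_real)
qed

definition nlev :: "real \<Rightarrow> (nat \<Rightarrow> real \<Rightarrow> complex) \<Rightarrow> nat \<Rightarrow> nat \<Rightarrow> real \<Rightarrow> complex" where
  "nlev rate P n a u = lev P n a u / rate ^ n"

text \<open>Passing to the next level divides by the rate, so the normalised levels contract towards a limit
  as soon as their values at the ends of the tiles converge.\<close>

lemma nlev_limit:
  fixes P :: "nat \<Rightarrow> real \<Rightarrow> complex" and rate :: real
  assumes P: "admissible B0 P" and rate: "1 < rate"
    and ends: "\<And>a. a < m \<Longrightarrow> (\<lambda>n. nlev rate P n a (s $ a)) \<longlonglongrightarrow> l a"
  obtains p B where "admissible B p" "\<And>n. admissible B (nlev rate P n)"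
    and "\<And>a u. a < m \<Longrightarrow> 0 \<le> u \<Longrightarrow> u \<le> s $ a \<Longrightarrow> (\<lambda>n. nlev rate P n a u) \<longlonglongrightarrow> p a u"
    and "\<And>a. a < m \<Longrightarrow> p a (s $ a) = l a"
proof -
  define pn where "pn n = nlev rate P n" for n
  have r0: "rate \<noteq> 0" "0 < rate" using rate by auto
  have pn_eq: "pn n = (\<lambda>a u. complex_of_real (1 / rate ^ n) * lev P n a u)" for n
    by (intro ext) (simp add: pn_def nlev_def)
  have pn_Suc: "pn (Suc n) a u = acc s (pn n) (\<zeta> a) (\<theta> * u) / rate" for n a u
    unfolding pn_eq[of n] acc_scale using r0 by (simp add: pn_def nlev_def)
  have pn0: "pn n a 0 = 0" if "a < m" for n a
    using lev_zero[of P, OF admissibleD(1)[OF P] that] by (simp add: pn_def nlev_def)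
  have pnc: "continuous_on {0..s $ a} (pn n a)" if "a < m" for n a
    unfolding pn_eq using lev_continuous[of P, OF admissibleD(1,2)[OF P] that] by (intro continuous_intros)
  define L where "L = Max ((\<lambda>a. real (length (\<zeta> a))) ` {..<m})"
  have L: "length (\<zeta> a) \<le> L" if "a < m" for a unfolding L_def using that by (intro Max_ge) auto
  have L0: "0 \<le> L" using L[OF m_pos] by simp
  have step: "norm (pn (Suc n) a u - pn (Suc k) a u) \<le> (L * e + d) / rate"
    if "a < m" and e: "\<And>a. a < m \<Longrightarrow> norm (pn n a (s $ a) - pn k a (s $ a)) \<le> e"
      and d: "\<And>a u. a < m \<Longrightarrow> 0 \<le> u \<Longrightarrow> u \<le> s $ a \<Longrightarrow> norm (pn n a u - pn k a u) \<le> d"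
    for n k a u e d
  proof -
    have e0: "0 \<le> e" by (rule order_trans[OF norm_ge_zero e[OF m_pos]])
    have "norm (acc s (pn n) (\<zeta> a) (\<theta> * u) - acc s (pn k) (\<zeta> a) (\<theta> * u)) \<le> length (\<zeta> a) * e + d"
      by (rule acc_diff_le[OF pn0 pn0 e d word_\<zeta>[OF \<open>a < m\<close>]])
    also have "\<dots> \<le> L * e + d" using L[OF \<open>a < m\<close>] e0 by (intro add_right_mono mult_right_mono)
    finally show ?thesis unfolding pn_Suc diff_divide_distrib[symmetric] norm_divide
      using r0 by (simp add: divide_right_mono)
  qed
  have "\<exists>W. \<forall>n. \<forall>a<m. norm (pn n a (s $ a)) \<le> W"
  proof -
    have "\<forall>a. \<exists>W. a < m \<longrightarrow> (\<forall>n. norm (pn n a (s $ a)) \<le> W)"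
      using convergent_imp_Bseq[OF convergentI[OF ends]] unfolding pn_def Bseq_def by metis
    then obtain Wf where Wf: "\<And>a n. a < m \<Longrightarrow> norm (pn n a (s $ a)) \<le> Wf a" by metis
    have "norm (pn n a (s $ a)) \<le> Max (Wf ` {..<m})" if "a < m" for n a
      by (rule order_trans[OF Wf[OF that] Max_ge]) (use that in auto)
    then show ?thesis by blast
  qed
  then obtain W where W: "\<And>n a. a < m \<Longrightarrow> norm (pn n a (s $ a)) \<le> W" by metis
  \<comment> \<open>Every B \<ge> L W / (rate - 1) satisfies (L W + B) / rate \<le> B, so the bound
    passes from one level to the next; B0 covers level 0.\<close>
  define B where "B = max B0 (L * W / (rate - 1))"
  have "L * W / (rate - 1) \<le> B" by (simp add: B_def)
  then have LWB: "L * W + B \<le> B * rate" using rate by (simp add: field_simps)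
  have W0: "0 \<le> W" by (rule order_trans[OF norm_ge_zero W[OF m_pos]])
  have pnB: "norm (pn n a u) \<le> B" if "a < m" "0 \<le> u" "u \<le> s $ a" for n a u
    using that
  proof (induction n arbitrary: a u)
    case 0
    then show ?case using admissibleD(3)[OF P, of a u] by (simp add: pn_def nlev_def B_def)
  next
    case (Suc n)
    \<comment> \<open>A bound on \<open>acc\<close> comes from \<open>acc_diff_le\<close> by
      comparison with the zero profile.\<close>
    have z: "acc s (\<lambda>_ _. 0) w \<tau> = 0" for w \<tau> by (induction w arbitrary: \<tau>) simp_all
    have "norm (acc s (pn n) (\<zeta> a) (\<theta> * u) - acc s (\<lambda>_ _. 0) (\<zeta> a) (\<theta> * u)) \<le> length (\<zeta> a) * W + B"
      by (rule acc_diff_le[of "pn n" "\<lambda>_ _. 0", OF pn0 _ _ _ word_\<zeta>[OF Suc.prems(1)]]) (use W Suc.IH in auto)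
    then have "norm (acc s (pn n) (\<zeta> a) (\<theta> * u)) \<le> length (\<zeta> a) * W + B" by (simp add: z)
    also have "\<dots> \<le> L * W + B" using L[OF Suc.prems(1)] W0 by (intro add_right_mono mult_right_mono)
    also have "\<dots> \<le> B * rate" by (rule LWB)
    finally show ?case using r0 by (simp add: pn_Suc norm_divide field_simps)
  qed
  have B0: "0 \<le> B" by (rule order_trans[OF norm_ge_zero pnB[OF m_pos order_refl]]) (use s_pos[OF m_pos] in simp)
  have cauchy: "\<exists>N. \<forall>n\<ge>N. \<forall>k\<ge>N. \<forall>a<m. \<forall>u\<in>{0..s $ a}. norm (pn n a u - pn k a u) < \<epsilon>" if \<epsilon>: "0 < \<epsilon>" for \<epsilon>
  proof -
    \<comment> \<open>L e / (rate - 1) is the fixed point of d \<mapsto> (L e + d) / rate, the map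
      that governs the error from level to level; this e keeps it below \<epsilon> / 2. The initial
      error 2 B decays geometrically on top of it.\<close>
    define e where "e = \<epsilon> / 2 * (rate - 1) / (L + 1)"
    have e: "0 < e" using \<epsilon> rate L0 by (simp add: e_def)
    have Le: "L * e / (rate - 1) \<le> \<epsilon> / 2"
    proof -
      have "L * e / (rate - 1) = \<epsilon> / 2 * (L / (L + 1))" using rate by (simp add: e_def)
      also have "\<dots> \<le> \<epsilon> / 2 * 1" using L0 \<epsilon> by (intro mult_left_mono) (auto simp: field_simps)
      finally show ?thesis by simp
    qed
    have "\<forall>a\<in>{..<m}. \<exists>N. \<forall>n\<ge>N. \<forall>k\<ge>N. norm (pn n a (s $ a) - pn k a (s $ a)) < e"
      using CauchyD[OF LIMSEQ_imp_Cauchy[OF ends] e] unfolding pn_def by auto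
    then obtain Nf where Nf: "\<And>a n k. a < m \<Longrightarrow> Nf a \<le> n \<Longrightarrow> Nf a \<le> k \<Longrightarrow> norm (pn n a (s $ a) - pn k a (s $ a)) < e"
      by (metis lessThan_iff)
    define N1 where "N1 = Max (Nf ` {..<m})"
    have N1: "norm (pn n a (s $ a) - pn k a (s $ a)) \<le> e" if "a < m" "N1 \<le> n" "N1 \<le> k" for a n k
    proof -
      have "Nf a \<le> N1" unfolding N1_def using that(1) by (intro Max_ge) auto
      then show ?thesis using Nf[OF that(1), of n k] that by simp
    qed
    have bd: "norm (pn n a u - pn k a u) \<le> 2 * B / rate ^ j + L * e / (rate - 1)"
      if "N1 + j \<le> n" "N1 + j \<le> k" "a < m" "0 \<le> u" "u \<le> s $ a" for j n k a u
      using that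
    proof (induction j arbitrary: n k a u)
      case 0
      have "norm (pn n a u - pn k a u) \<le> B + B"
        using 0 by (intro norm_triangle_le_diff add_mono pnB) auto
      then show ?case using L0 e rate by (simp add: add_increasing2)
    next
      case (Suc j)
      obtain n' k' where nk: "n = Suc n'" "k = Suc k'" using Suc.prems(1,2) by (metis add_Suc_right Suc_le_D)
      have "norm (pn n a u - pn k a u) \<le> (L * e + (2 * B / rate ^ j + L * e / (rate - 1))) / rate"
        unfolding nk using Suc.prems nk by (intro step Suc.IH N1) auto
      also have "\<dots> = 2 * B / rate ^ Suc j + L * e / (rate - 1)"
      proof -
        define X where "X = L * e / (rate - 1)"
        have "L * e = X * (rate - 1)" using rate by (simp add: X_def)
        then have eq: "L * e + (2 * B / rate ^ j + X) = 2 * B / rate ^ j + X * rate" by (simp add: algebra_simps)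
        have "(2 * B / rate ^ j + X * rate) / rate = 2 * B / rate ^ Suc j + X"
          using r0 by (simp add: add_divide_distrib mult.commute)
        then show ?thesis unfolding X_def[symmetric] eq .
      qed
      finally show ?case .
    qed
    have "(\<lambda>j. 2 * B * (1 / rate) ^ j) \<longlonglongrightarrow> 2 * B * 0"
      using rate by (intro tendsto_mult tendsto_const LIMSEQ_power_zero) simp
    then have "\<forall>\<^sub>F j in sequentially. 2 * B * (1 / rate) ^ j < \<epsilon> / 2"
      by (rule order_tendstoD) (use \<epsilon> in simp)
    then obtain j where j: "2 * B / rate ^ j < \<epsilon> / 2"
      by (auto simp: eventually_sequentially power_divide)
    have "norm (pn n a u - pn k a u) < \<epsilon>" if "N1 + j \<le> n" "N1 + j \<le> k" "a < m" "u \<in> {0..s $ a}" for n k a u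
    proof -
      have "norm (pn n a u - pn k a u) \<le> 2 * B / rate ^ j + L * e / (rate - 1)" using that by (intro bd) auto
      then show ?thesis using j Le by linarith
    qed
    then show ?thesis by blast
  qed
  have unif: "\<exists>p. uniform_limit {0..s $ a} (\<lambda>n. pn n a) p sequentially" if a: "a < m" for a
  proof -
    have "uniformly_Cauchy_on {0..s $ a} (\<lambda>n. pn n a)"
      unfolding uniformly_Cauchy_on_def dist_norm using cauchy a by metis
    then show ?thesis using Cauchy_uniformly_convergent uniformly_convergent_on_def by metis
  qed
  then obtain p where p: "\<And>a. a < m \<Longrightarrow> uniform_limit {0..s $ a} (\<lambda>n. pn n a) (p a) sequentially" by metis
  have lim: "(\<lambda>n. pn n a u) \<longlonglongrightarrow> p a u" if "a < m" "0 \<le> u" "u \<le> s $ a" for a u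
    using tendsto_uniform_limitI[OF p[OF that(1)], of u] that by simp
  show thesis
  proof (rule that[of B p])
    show "admissible B (nlev rate P n)" for n
      unfolding admissible_def using pn0 pnc pnB by (auto simp: pn_def)
    show "(\<lambda>n. nlev rate P n a u) \<longlonglongrightarrow> p a u" if "a < m" "0 \<le> u" "u \<le> s $ a" for a u
      using lim[OF that] by (simp add: pn_def)
    show "p a (s $ a) = l a" if "a < m" for a
      using LIMSEQ_unique[OF lim[OF that] ends[OF that, folded pn_def]] s_pos[OF that] by simp
    show "admissible B p"
      unfolding admissible_def
    proof (intro allI impI conjI ballI)
      fix a assume a: "a < m"
      show "p a 0 = 0" using LIMSEQ_unique[OF lim[OF a order_refl]] pn0[OF a] s_pos[OF a] by simp
      show "continuous_on {0..s $ a} (p a)"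
        by (rule uniform_limit_theorem[OF _ p[OF a]]) (use pnc[OF a] in auto)
      show "norm (p a u) \<le> B" if "u \<in> {0..s $ a}" for u
        by (rule LIMSEQ_le_const2[OF tendsto_norm[OF lim[OF a]]]) (use that pnB[OF a] in auto)
    qed
  qed
qed

end

section \<open>The suspension flow\<close>

definition shift :: "int \<Rightarrow> (int \<Rightarrow> nat) \<Rightarrow> int \<Rightarrow> nat" where
  "shift k y = (\<lambda>i. y (i + k))"

definition pre :: "(int \<Rightarrow> nat) \<Rightarrow> nat \<Rightarrow> nat list" where
  "pre y n = map (\<lambda>i. y (int i)) [0..<n]"

lemma shift_shift [simp]: "shift j (shift k y) = shift (j + k) y"
  by (simp add: shift_def add.assoc)

lemma shift_0 [simp]: "shift 0 y = y"
  by (simp add: shift_def)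

lemma pre_0 [simp]: "pre y 0 = []"
  by (simp add: pre_def)

lemma pre_Suc: "pre y (Suc n) = pre y n @ [y (int n)]"
  by (simp add: pre_def)

lemma pre_add: "pre y (k + n) = pre y k @ pre (shift (int k) y) n"
  by (induction n) (simp_all add: pre_Suc shift_def add.commute)

lemma return_time_0 [simp]: "return_time s y 0 = 0"
  by (simp add: return_time_def)

lemma return_time_Suc: "return_time s y (n + 1) = return_time s y n + s $ y n"
proof (cases "0 \<le> n")
  case True
  have "{0..<n + 1} = insert n {0..<n}" using True by auto
  then show ?thesis using True by (simp add: return_time_def)
next
  case False
  have "{n..<0} = insert n {n + 1..<0}" using False by auto
  then show ?thesis using False by (simp add: return_time_def)
qed

lemma return_time_pre: "return_time s y (int n) = wlen s (pre y n)"
  by (induction n) (simp_all add: pre_Suc return_time_Suc add.commute[of 1])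

text \<open>The cocycle identity behind the group law of the flow.\<close>

lemma return_time_shift: "return_time s (shift k y) n = return_time s y (n + k) - return_time s y k"
proof (induction n rule: int_induct[where k = 0])
  case (step1 i)
  then show ?case
    using return_time_Suc[of s "shift k y" i] return_time_Suc[of s y "i + k"]
    by (simp add: shift_def add.commute add.left_commute)
next
  case (step2 i)
  then show ?case
    using return_time_Suc[of s "shift k y" "i - 1"] return_time_Suc[of s y "i - 1 + k"]
    by (simp add: shift_def algebra_simps)
qed simp

context gap_tiling
begin

lemma subst_space_letter:
  assumes y: "y \<in> subst_space m \<zeta>" shows "y i < m"
proof -
  have "\<exists>a<m. \<exists>n. sublist (map y [i..i]) (sub n [a])"
    using y unfolding subst_space_def by blast
  then obtain a n where a: "a < m" and "sublist (map y [i..i]) (sub n [a])" by blast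
  then have "y i \<in> set (sub n [a])" using set_mono_sublist by force
  then show ?thesis using word_sub_letter[OF a, of n] by auto
qed

lemma map_shift_upto: "map (shift k y) [i..j] = map y [i + k..j + k]"
  by (rule nth_equalityI) (auto simp: shift_def algebra_simps)

lemma subst_space_shift:
  assumes y: "y \<in> subst_space m \<zeta>" shows "shift k y \<in> subst_space m \<zeta>"
  using y unfolding subst_space_def mem_Collect_eq map_shift_upto by blast

lemma pre_legal:
  assumes y: "y \<in> subst_space m \<zeta>" shows "legal (pre y n)"
proof -
  have "pre y n = map y [0..int n - 1]"
    unfolding pre_def by (rule nth_equalityI) auto
  then show ?thesis using y by (auto simp: subst_space_def legal_def)
qed

lemma word_pre: "y \<in> subst_space m \<zeta> \<Longrightarrow> word (pre y n)"
  by (rule word_legal[OF pre_legal])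

lemma return_time_strict_mono:
  assumes y: "y \<in> subst_space m \<zeta>" shows "strict_mono (return_time s y)"
proof (rule strict_monoI)
  fix i j :: int assume "i < j"
  then show "return_time s y i < return_time s y j"
  proof (induction j rule: int_gr_induct)
    case base
    then show ?case using return_time_Suc[of s y i] s_pos[OF subst_space_letter[OF y]] by simp
  next
    case (step j)
    then show ?case using return_time_Suc[of s y j] s_pos[OF subst_space_letter[OF y, of j]] by simp
  qed
qed

lemma return_time_unbounded:
  assumes y: "y \<in> subst_space m \<zeta>"
  shows "smin * real n \<le> return_time s y (int n)" "return_time s y (- int n) \<le> - smin * real n"
proof -
  show "smin * real n \<le> return_time s y (int n)"
    using length_le_wlen[OF word_pre[OF y, of n]] by (simp add: return_time_pre pre_def)
  show "return_time s y (- int n) \<le> - smin * real n"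
  proof (induction n)
    case (Suc n)
    then show ?case
      using return_time_Suc[of s y "- int (Suc n)"] smin_le[OF subst_space_letter[OF y, of "- int (Suc n)"]]
      by (simp add: algebra_simps)
  qed simp
qed

text \<open>Justifies the definite description in \<open>suspension_flow\<close>: the arrival times
  increase strictly and, tiles being at least \<open>smin\<close> long, tend to infinity in both
  directions.\<close>

lemma return_time_interval_ex1:
  assumes y: "y \<in> subst_space m \<zeta>"
  shows "\<exists>!n. return_time s y n \<le> \<tau> \<and> \<tau> < return_time s y (n + 1)"
proof -
  obtain N :: nat where N: "\<bar>\<tau>\<bar> / smin < N" using reals_Archimedean2 by blast
  then have N': "\<bar>\<tau>\<bar> < smin * N" using smin_pos by (simp add: field_simps)
  define M where "M = {n. return_time s y n \<le> \<tau>} \<inter> {- int N..int N}"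
  have "finite M" by (simp add: M_def)
  moreover have "- int N \<in> M" using return_time_unbounded(2)[OF y, of N] N' by (simp add: M_def)
  ultimately have Max: "Max M \<in> M" using Max_in by blast
  define n where "n = Max M"
  have n: "return_time s y n \<le> \<tau>" "- int N \<le> n" "n \<le> int N" using Max by (auto simp: M_def n_def)
  have "\<tau> < return_time s y (n + 1)"
  proof (rule ccontr)
    assume *: "\<not> \<tau> < return_time s y (n + 1)"
    have "n + 1 \<le> int N"
    proof (rule ccontr)
      assume "\<not> n + 1 \<le> int N"
      then have "n = int N" using n by simp
      then show False using n(1) return_time_unbounded(1)[OF y, of N] N' by simp
    qed
    then have "n + 1 \<in> M" using * n by (simp add: M_def)
    then show False using Max_ge[OF \<open>finite M\<close>] n_def by fastforce
  qed
  moreover have "n' = n" if "return_time s y n' \<le> \<tau>" "\<tau> < return_time s y (n' + 1)" for n'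
  proof (rule ccontr)
    assume "n' \<noteq> n"
    then consider "n' + 1 \<le> n" | "n + 1 \<le> n'" by linarith
    then show False
    proof cases
      case 1
      then show False using strict_mono_less_eq[OF return_time_strict_mono[OF y], of "n' + 1" n] that n by simp
    next
      case 2
      then show False using strict_mono_less_eq[OF return_time_strict_mono[OF y], of "n + 1" n'] that
          \<open>\<tau> < return_time s y (n + 1)\<close> by simp
    qed
  qed
  ultimately show ?thesis using n(1) by blast
qed

lemma suspension_flow_eq:
  assumes y: "y \<in> subst_space m \<zeta>" and n: "return_time s y n \<le> u + t" "u + t < return_time s y (n + 1)"
  shows "suspension_flow s t (y, u) = (shift n y, u + t - return_time s y n)"
proof -
  have "(THE n. return_time s y n \<le> u + t \<and> u + t < return_time s y (n + 1)) = n"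
    using return_time_interval_ex1[OF y, of "u + t"] n by (intro the1_equality) auto
  then show ?thesis by (simp add: suspension_flow_def shift_def Let_def)
qed

lemma suspension_flow_cases:
  assumes y: "y \<in> subst_space m \<zeta>"
  obtains n where "return_time s y n \<le> u + t" "u + t < return_time s y (n + 1)"
    "suspension_flow s t (y, u) = (shift n y, u + t - return_time s y n)"
  using return_time_interval_ex1[OF y, of "u + t"] suspension_flow_eq[OF y] by blast

text \<open>If time r leads to the tile n and time r + t to the tile k, then the second stage
  crosses k - n tiles, counted from the shifted sequence.\<close>

lemma suspension_flow_add:
  assumes x: "x \<in> suspension m \<zeta> s"
  shows "suspension_flow s t (suspension_flow s r x) = suspension_flow s (r + t) x"
proof -
  obtain y u where xy: "x = (y, u)" and y: "y \<in> subst_space m \<zeta>" using x by (auto simp: suspension_def)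
  obtain n where n: "return_time s y n \<le> u + r" "u + r < return_time s y (n + 1)"
    "suspension_flow s r (y, u) = (shift n y, u + r - return_time s y n)"
    by (rule suspension_flow_cases[OF y])
  obtain k where k: "return_time s y k \<le> u + (r + t)" "u + (r + t) < return_time s y (k + 1)"
    "suspension_flow s (r + t) (y, u) = (shift k y, u + (r + t) - return_time s y k)"
    by (rule suspension_flow_cases[OF y])
  have "suspension_flow s t (shift n y, u + r - return_time s y n) =
      (shift (k - n) (shift n y), u + r - return_time s y n + t - return_time s (shift n y) (k - n))"
  proof (rule suspension_flow_eq[OF subst_space_shift[OF y]])
    show "return_time s (shift n y) (k - n) \<le> u + r - return_time s y n + t"
      using k(1) by (simp add: return_time_shift)
    have "k - n + 1 + n = k + 1" by simp
    then show "u + r - return_time s y n + t < return_time s (shift n y) (k - n + 1)"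
      using k(2) unfolding return_time_shift by simp
  qed
  then show ?thesis unfolding xy n(3) k(3) by (simp add: return_time_shift)
qed

lemma suspension_flow_vertical:
  assumes "(y, u) \<in> suspension m \<zeta> s"
  shows "suspension_flow s u (y, 0) = (y, u)"
  using assms suspension_flow_eq[of y 0 0 u] return_time_Suc[of s y 0] by (auto simp: suspension_def)

lemma suspension_base: "(y, u) \<in> suspension m \<zeta> s \<Longrightarrow> (y, 0) \<in> suspension m \<zeta> s"
  by (auto simp: suspension_def)

lemma suspension_flow_from_base:
  assumes "(y, u) \<in> suspension m \<zeta> s"
  shows "suspension_flow s t (y, u) = suspension_flow s (u + t) (y, 0)"
  using suspension_flow_add[OF suspension_base[OF assms], of t u] suspension_flow_vertical[OF assms] by simp

lemma suspension_flow_mem: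
  assumes x: "x \<in> suspension m \<zeta> s" shows "suspension_flow s t x \<in> suspension m \<zeta> s"
proof -
  obtain y u where xy: "x = (y, u)" and y: "y \<in> subst_space m \<zeta>" using x by (auto simp: suspension_def)
  obtain n where n: "return_time s y n \<le> u + t" "u + t < return_time s y (n + 1)"
    "suspension_flow s t (y, u) = (shift n y, u + t - return_time s y n)"
    by (rule suspension_flow_cases[OF y])
  then show ?thesis unfolding xy n(3) using subst_space_shift[OF y, of n] return_time_Suc[of s y n]
    by (auto simp: suspension_def shift_def)
qed

lemma suspension_flow_forward:
  assumes y: "y \<in> subst_space m \<zeta>" and \<tau>: "0 \<le> \<tau>"
  obtains k :: nat where "wlen s (pre y k) \<le> \<tau>" "\<tau> < wlen s (pre y (Suc k))"
    "suspension_flow s \<tau> (y, 0) = (shift (int k) y, \<tau> - wlen s (pre y k))"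
proof -
  obtain n where n: "return_time s y n \<le> \<tau>" "\<tau> < return_time s y (n + 1)"
    "suspension_flow s \<tau> (y, 0) = (shift n y, \<tau> - return_time s y n)"
    using suspension_flow_cases[OF y, of 0 \<tau>] by auto
  have "0 \<le> n"
  proof (rule ccontr)
    assume "\<not> 0 \<le> n"
    then have "n + 1 \<le> 0" by simp
    then have "return_time s y (n + 1) \<le> return_time s y 0"
      using strict_mono_less_eq[OF return_time_strict_mono[OF y]] by blast
    then show False using n(2) \<tau> by simp
  qed
  then obtain k where k: "n = int k" using nonneg_int_cases by blast
  have "int k + 1 = int (Suc k)" by simp
  with n show thesis unfolding k by (intro that[of k]) (simp_all only: return_time_pre)
qed

text \<open>For \<tau> \<ge> 0 this is the integrand whose integral is \<open>acc\<close>. The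
  default 0 past the last tile corresponds to \<open>acc\<close> being constant there.\<close>

primrec tile_value :: "(nat \<Rightarrow> real \<Rightarrow> complex) \<Rightarrow> nat list \<Rightarrow> real \<Rightarrow> complex" where
  "tile_value \<psi> [] \<tau> = 0"
| "tile_value \<psi> (a # w) \<tau> = (if \<tau> < s $ a then \<psi> a \<tau> else tile_value \<psi> w (\<tau> - s $ a))"

lemma cylindrical_flow:
  assumes f: "\<And>y u. (y, u) \<in> suspension m \<zeta> s \<Longrightarrow> f (y, u) = \<psi> (y 0) u"
    and y: "y \<in> subst_space m \<zeta>" and \<tau>: "0 \<le> \<tau>" "\<tau> < wlen s (pre y n)"
  shows "f (suspension_flow s \<tau> (y, 0)) = tile_value \<psi> (pre y n) \<tau>"
  using y \<tau>
proof (induction n arbitrary: y \<tau>)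
  case (Suc n)
  have pre: "pre y (Suc n) = y 0 # pre (shift 1 y) n"
    using pre_add[of y 1 n] by (simp add: pre_def)
  have base: "(y, 0) \<in> suspension m \<zeta> s"
    using Suc.prems(1) s_pos[OF subst_space_letter[OF Suc.prems(1)]] by (simp add: suspension_def)
  show ?case
  proof (cases "\<tau> < s $ y 0")
    case True
    then have "(y, \<tau>) \<in> suspension m \<zeta> s" using Suc.prems by (simp add: suspension_def)
    then show ?thesis using f True by (simp add: suspension_flow_vertical pre)
  next
    case False
    have r1: "return_time s y 1 = s $ y 0" using return_time_Suc[of s y 0] by simp
    have r2: "return_time s y (1 + 1) = s $ y 0 + s $ y 1" using return_time_Suc[of s y 1] r1 by simp
    have "suspension_flow s (s $ y 0) (y, 0) = (shift 1 y, 0)"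
      using suspension_flow_eq[OF Suc.prems(1), of 1 0 "s $ y 0"] r1 r2 s_pos[OF subst_space_letter[OF Suc.prems(1), of 1]]
      by simp
    then have "suspension_flow s \<tau> (y, 0) = suspension_flow s (\<tau> - s $ y 0) (shift 1 y, 0)"
      using suspension_flow_add[OF base, of "\<tau> - s $ y 0" "s $ y 0"] by simp
    then show ?thesis
      using Suc.IH[OF subst_space_shift[OF Suc.prems(1)], of "\<tau> - s $ y 0" 1] Suc.prems False by (simp add: pre)
  qed
qed simp

end

section \<open>Ergodic averages\<close>

locale suspended_tiling = gap_tiling +
  fixes \<mu> :: "((int \<Rightarrow> nat) \<times> real) measure"
  assumes invariant: "invariant_prob m \<zeta> s \<mu>"
begin

sublocale prob_space \<mu>
  using invariant by (simp add: invariant_prob_def)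

abbreviation flow :: "real \<Rightarrow> (int \<Rightarrow> nat) \<times> real \<Rightarrow> (int \<Rightarrow> nat) \<times> real" where
  "flow \<equiv> suspension_flow s"

lemma sets_\<mu>: "sets \<mu> = sets (restrict_space ((\<Pi>\<^sub>M i\<in>UNIV. count_space UNIV) \<Otimes>\<^sub>M borel) (suspension m \<zeta> s))"
  using invariant by (simp add: invariant_prob_def suspension_algebra_def)

lemma space_\<mu>: "space \<mu> = suspension m \<zeta> s"
  using sets_eq_imp_space_eq[OF sets_\<mu>] by (simp add: space_restrict_space space_pair_measure space_PiM)

lemma measurable_id_\<mu>: "(\<lambda>x. x) \<in> \<mu> \<rightarrow>\<^sub>M (\<Pi>\<^sub>M i\<in>UNIV. count_space UNIV) \<Otimes>\<^sub>M borel"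
  unfolding measurable_cong_sets[OF sets_\<mu> refl] by (rule measurable_restrict_space1) simp

lemma measurable_letter [measurable]: "(\<lambda>x. fst x i) \<in> \<mu> \<rightarrow>\<^sub>M count_space UNIV"
proof -
  have "fst \<in> \<mu> \<rightarrow>\<^sub>M (\<Pi>\<^sub>M i\<in>UNIV. count_space UNIV)"
    using measurable_compose[OF measurable_id_\<mu> measurable_fst] by simp
  then show ?thesis by (rule measurable_compose) (rule measurable_component_singleton, simp)
qed

lemma measurable_height [measurable]: "snd \<in> borel_measurable \<mu>"
  using measurable_compose[OF measurable_id_\<mu> measurable_snd] by simp

lemma measurable_return_time [measurable]: "(\<lambda>x. return_time s (fst x) k) \<in> borel_measurable \<mu>"
proof -
  have "(\<lambda>x. s $ fst x i) \<in> borel_measurable \<mu>" for i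
    by (rule measurable_compose[OF measurable_letter]) simp
  then show ?thesis unfolding return_time_def by (intro borel_measurable_diff borel_measurable_sum)
qed

lemma measurable_pre [measurable]: "(\<lambda>x. pre (fst x) n) \<in> \<mu> \<rightarrow>\<^sub>M count_space UNIV"
proof (induction n)
  case (Suc n)
  have "(\<lambda>x. (\<lambda>v w. v @ w) (pre (fst x) n) [fst x (int n)]) \<in> \<mu> \<rightarrow>\<^sub>M count_space UNIV"
  proof (rule measurable_compose_countable[OF _ Suc])
    fix v
    show "(\<lambda>x. v @ [fst x (int n)]) \<in> \<mu> \<rightarrow>\<^sub>M count_space UNIV"
      by (rule measurable_compose[OF measurable_letter[of "int n"]]) simp
  qed
  then show ?case by (simp add: pre_Suc)
qed simp

lemma measurable_flow: "flow t \<in> \<mu> \<rightarrow>\<^sub>M \<mu>" and distr_flow: "distr \<mu> \<mu> (flow t) = \<mu>"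
  using invariant by (auto simp: invariant_prob_def)

text \<open>Needed for Fubini in time and space. The number of crossed tiles takes countably many
  values, and for each fixed value the flow is an explicit measurable map.\<close>

lemma measurable_flow_joint: "(\<lambda>p. flow (fst p) (snd p)) \<in> lborel \<Otimes>\<^sub>M \<mu> \<rightarrow>\<^sub>M \<mu>"
proof -
  define N where "N p = (THE n. return_time s (fst (snd p)) n \<le> snd (snd p) + fst p \<and>
      snd (snd p) + fst p < return_time s (fst (snd p)) (n + 1))" for p :: "real \<times> (int \<Rightarrow> nat) \<times> real"
  have sp: "fst (snd p) \<in> subst_space m \<zeta>" if "p \<in> space (lborel \<Otimes>\<^sub>M \<mu>)" for p
    using that by (auto simp: space_pair_measure space_\<mu> suspension_def)
  have N: "N \<in> lborel \<Otimes>\<^sub>M \<mu> \<rightarrow>\<^sub>M count_space UNIV"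
  proof (subst measurable_count_space_eq2_countable, intro conjI ballI)
    fix k :: int
    have "N -` {k} \<inter> space (lborel \<Otimes>\<^sub>M \<mu>) = {p \<in> space (lborel \<Otimes>\<^sub>M \<mu>).
        return_time s (fst (snd p)) k \<le> snd (snd p) + fst p \<and>
        snd (snd p) + fst p < return_time s (fst (snd p)) (k + 1)}" (is "?L = ?R")
    proof (rule Set.set_eqI)
      fix p
      show "p \<in> ?L \<longleftrightarrow> p \<in> ?R"
      proof (cases "p \<in> space (lborel \<Otimes>\<^sub>M \<mu>)")
        case True
        note ex1 = return_time_interval_ex1[OF sp[OF True], of "snd (snd p) + fst p"]
        have "N p = k \<longleftrightarrow> return_time s (fst (snd p)) k \<le> snd (snd p) + fst p \<and>
            snd (snd p) + fst p < return_time s (fst (snd p)) (k + 1)"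
          using theI'[OF ex1] the1_equality[OF ex1, of k] unfolding N_def by auto
        then show ?thesis using True by simp
      qed simp
    qed
    also have "\<dots> \<in> sets (lborel \<Otimes>\<^sub>M \<mu>)"
      using measurable_compose[OF measurable_snd measurable_return_time]
        measurable_compose[OF measurable_snd measurable_height] by measurable
    finally show "N -` {k} \<inter> space (lborel \<Otimes>\<^sub>M \<mu>) \<in> sets (lborel \<Otimes>\<^sub>M \<mu>)" .
  qed auto
  have "(\<lambda>p. (\<lambda>k q. (shift k (fst (snd q)), snd (snd q) + fst q - return_time s (fst (snd q)) k)) (N p) p)
      \<in> lborel \<Otimes>\<^sub>M \<mu> \<rightarrow>\<^sub>M (\<Pi>\<^sub>M i\<in>UNIV. count_space UNIV) \<Otimes>\<^sub>M borel"
  proof (rule measurable_compose_countable[OF _ N])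
    fix k
    show "(\<lambda>q. (shift k (fst (snd q)), snd (snd q) + fst q - return_time s (fst (snd q)) k))
        \<in> lborel \<Otimes>\<^sub>M \<mu> \<rightarrow>\<^sub>M (\<Pi>\<^sub>M i\<in>UNIV. count_space UNIV) \<Otimes>\<^sub>M borel"
    proof (rule measurable_Pair)
      show "(\<lambda>q. shift k (fst (snd q))) \<in> lborel \<Otimes>\<^sub>M \<mu> \<rightarrow>\<^sub>M (\<Pi>\<^sub>M i\<in>UNIV. count_space UNIV)"
        unfolding shift_def
        by (rule measurable_abs_UNIV) (rule measurable_compose[OF measurable_snd measurable_letter])
      show "(\<lambda>q. snd (snd q) + fst q - return_time s (fst (snd q)) k) \<in> borel_measurable (lborel \<Otimes>\<^sub>M \<mu>)"
        using measurable_compose[OF measurable_snd measurable_return_time]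
          measurable_compose[OF measurable_snd measurable_height] by measurable
    qed
  qed
  moreover have "flow (fst p) (snd p) =
      (\<lambda>k q. (shift k (fst (snd q)), snd (snd q) + fst q - return_time s (fst (snd q)) k)) (N p) p" for p
    by (simp add: N_def suspension_flow_def shift_def Let_def split_beta)
  ultimately have "(\<lambda>p. flow (fst p) (snd p)) \<in> lborel \<Otimes>\<^sub>M \<mu> \<rightarrow>\<^sub>M (\<Pi>\<^sub>M i\<in>UNIV. count_space UNIV) \<Otimes>\<^sub>M borel"
    by simp
  moreover have "flow (fst p) (snd p) \<in> suspension m \<zeta> s" if "p \<in> space (lborel \<Otimes>\<^sub>M \<mu>)" for p
    using that by (intro suspension_flow_mem) (auto simp: space_pair_measure space_\<mu>)
  ultimately show ?thesis
    unfolding measurable_cong_sets[OF refl sets_\<mu>] by (intro measurable_restrict_space2) auto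
qed

lemma integral_flow:
  fixes F :: "_ \<Rightarrow> 'b :: {banach, second_countable_topology}"
  assumes F: "F \<in> borel_measurable \<mu>"
  shows "(LINT x|\<mu>. F (flow t x)) = (LINT x|\<mu>. F x)"
  using integral_distr[OF measurable_flow[of t] F] by (simp add: distr_flow)

lemma integrable_flow:
  fixes F :: "_ \<Rightarrow> 'b :: {banach, second_countable_topology}"
  assumes F: "integrable \<mu> F"
  shows "integrable \<mu> (\<lambda>x. F (flow t x))"
proof -
  have "integrable (distr \<mu> \<mu> (flow t)) F" using F by (simp only: distr_flow)
  then show ?thesis by (subst (asm) integrable_distr_eq[OF measurable_flow]) (use F in auto)
qed

text \<open>Fubini, after which invariance makes the inner space integral independent of
  \<tau>.\<close>

lemma time_average:
  fixes F :: "_ \<Rightarrow> complex"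
  assumes F: "integrable \<mu> F" and T: "0 < T"
  shows "integrable \<mu> (\<lambda>x. LINT \<tau>:{0..<T}|lborel. F (flow \<tau> x))"
    and "(LINT x|\<mu>. (LINT \<tau>:{0..<T}|lborel. F (flow \<tau> x))) = of_real T * (LINT x|\<mu>. F x)"
proof -
  interpret P: pair_sigma_finite lborel \<mu> ..
  have Fm [measurable]: "F \<in> borel_measurable \<mu>" using F by auto
  have g_meas: "(\<lambda>(\<tau>, x). indicator {0..<T} \<tau> *\<^sub>R F (flow \<tau> x)) \<in> borel_measurable (lborel \<Otimes>\<^sub>M \<mu>)"
    unfolding split_beta using measurable_compose[OF measurable_flow_joint Fm] by measurable
  have g: "integrable (lborel \<Otimes>\<^sub>M \<mu>) (\<lambda>(\<tau>, x). indicator {0..<T} \<tau> *\<^sub>R F (flow \<tau> x))"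
  proof (rule P.Fubini_integrable[OF g_meas])
    have nf: "(LINT x|\<mu>. norm (indicator {0..<T} \<tau> *\<^sub>R F (flow \<tau> x))) = indicator {0..<T} \<tau> * (LINT x|\<mu>. norm (F x))" for \<tau> :: real
      using integral_flow[of "\<lambda>x. norm (F x)" \<tau>] by (simp add: indicator_def)
    show "integrable lborel (\<lambda>\<tau>. LINT x|\<mu>. norm (case (\<tau>, x) of (\<tau>, x) \<Rightarrow> indicator {0..<T} \<tau> *\<^sub>R F (flow \<tau> x)))"
      unfolding prod.case nf using T by simp
    show "AE \<tau> in lborel. integrable \<mu> (\<lambda>x. case (\<tau>, x) of (\<tau>, x) \<Rightarrow> indicator {0..<T} \<tau> *\<^sub>R F (flow \<tau> x))"
      using integrable_flow[OF F] by (intro AE_I2) auto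
  qed
  show "integrable \<mu> (\<lambda>x. LINT \<tau>:{0..<T}|lborel. F (flow \<tau> x))"
    unfolding set_lebesgue_integral_def by (rule P.integrable_snd[OF g])
  have "(LINT x|\<mu>. (LINT \<tau>:{0..<T}|lborel. F (flow \<tau> x))) = (LINT \<tau>|lborel. LINT x|\<mu>. indicator {0..<T} \<tau> *\<^sub>R F (flow \<tau> x))"
    unfolding set_lebesgue_integral_def by (rule P.Fubini_integral[OF g])
  also have "\<dots> = (LINT \<tau>|lborel. indicator {0..<T} \<tau> *\<^sub>R (LINT x|\<mu>. F x))"
    using integral_flow[OF Fm] by simp
  also have "\<dots> = of_real T * (LINT x|\<mu>. F x)"
    using T by (subst integral_scaleR_left) (auto simp: scaleR_conv_of_real)
  finally show "(LINT x|\<mu>. (LINT \<tau>:{0..<T}|lborel. F (flow \<tau> x))) = of_real T * (LINT x|\<mu>. F x)" .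
qed

text \<open>By \<open>close\<close>, the time integral differs from I of a legal prefix by a
  constant that may depend on the point but not on T; so the time averages tend to \<kappa> at every
  point. Each of them has the same mean as F by invariance, and \<open>bound\<close> supplies the
  dominating constant.\<close>

lemma ergodic_average:
  fixes F :: "_ \<Rightarrow> complex" and I :: "nat list \<Rightarrow> complex" and \<kappa> :: complex and D :: real
  assumes F: "integrable \<mu> F"
    and \<kappa>: "\<And>\<epsilon>. 0 < \<epsilon> \<Longrightarrow> \<exists>K. \<forall>w. legal w \<longrightarrow> norm (I w - \<kappa> * wlen s w) \<le> \<epsilon> * wlen s w + K"
    and close: "\<And>y u. (y, u) \<in> suspension m \<zeta> s \<Longrightarrow> \<exists>C. \<forall>T\<ge>0. \<forall>k. wlen s (pre y k) \<le> T \<longrightarrow> T < wlen s (pre y (Suc k)) \<longrightarrow>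
      norm ((LINT \<tau>:{0..<T}|lborel. F (flow \<tau> (y, u))) - I (pre y k)) \<le> C"
    and bound: "\<And>T x. 1 \<le> T \<Longrightarrow> x \<in> suspension m \<zeta> s \<Longrightarrow> norm (LINT \<tau>:{0..<T}|lborel. F (flow \<tau> x)) \<le> D * T"
  shows "(LINT x|\<mu>. F x) = \<kappa>"
proof -
  define A where "A j x = (LINT \<tau>:{0..<real (Suc j)}|lborel. F (flow \<tau> x)) / real (Suc j)" for j x
  have "(\<lambda>j. LINT x|\<mu>. A j x) \<longlonglongrightarrow> (LINT x|\<mu>. \<kappa>)"
  proof (rule integral_dominated_convergence[where w = "\<lambda>_. D"])
    show "A j \<in> borel_measurable \<mu>" for j
      unfolding A_def using time_average(1)[OF F, of "real (Suc j)"] by (intro borel_measurable_divide) auto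
    show "AE x in \<mu>. norm (A j x) \<le> D" for j
    proof (rule AE_I2)
      fix x assume "x \<in> space \<mu>"
      then show "norm (A j x) \<le> D"
        using bound[of "real (Suc j)" x]
        unfolding A_def norm_divide space_\<mu> norm_of_real abs_of_nat
        by (subst pos_divide_le_eq) auto
    qed
    show "AE x in \<mu>. (\<lambda>j. A j x) \<longlonglongrightarrow> \<kappa>"
    proof (rule AE_I2)
      fix x assume "x \<in> space \<mu>"
      then obtain y u where x: "x = (y, u)" and yu: "(y, u) \<in> suspension m \<zeta> s" and y: "y \<in> subst_space m \<zeta>"
        unfolding space_\<mu> by (auto simp: suspension_def)
      obtain C where C: "\<And>T k. 0 \<le> T \<Longrightarrow> wlen s (pre y k) \<le> T \<Longrightarrow> T < wlen s (pre y (Suc k)) \<Longrightarrow>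
          norm ((LINT \<tau>:{0..<T}|lborel. F (flow \<tau> (y, u))) - I (pre y k)) \<le> C"
        using close[OF yu] by blast
      show "(\<lambda>j. A j x) \<longlonglongrightarrow> \<kappa>"
      proof (rule LIMSEQ_I)
        fix r :: real assume r: "0 < r"
        obtain K where K: "\<And>w. legal w \<Longrightarrow> norm (I w - \<kappa> * wlen s w) \<le> r / 2 * wlen s w + K"
          using \<kappa>[of "r / 2"] r by auto
        \<comment> \<open>C from \<open>close\<close>, K from the word average, and the last term
          for the incomplete tile between the end of the prefix and T.\<close>
        define E where "E = C + K + norm \<kappa> * smax"
        have "(\<lambda>j. E / real (Suc j)) \<longlonglongrightarrow> 0"
          using tendsto_mult[OF tendsto_const[of E] LIMSEQ_inverse_real_of_nat] by (simp add: field_simps)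
        then have "\<forall>\<^sub>F j in sequentially. E / real (Suc j) < r / 2"
          by (rule order_tendstoD) (use r in simp)
        then obtain j0 where j0: "\<And>j. j0 \<le> j \<Longrightarrow> E / real (Suc j) < r / 2" by (auto simp: eventually_sequentially)
        have "norm (A j x - \<kappa>) < r" if "j0 \<le> j" for j
        proof -
          define T where "T = real (Suc j)"
          have T: "0 < T" by (simp add: T_def)
          obtain k where k: "wlen s (pre y k) \<le> T" "T < wlen s (pre y (Suc k))"
            by (rule suspension_flow_forward[OF y less_imp_le[OF T]])
          define l where "l = wlen s (pre y k)"
          have l: "T - l \<le> smax" "0 \<le> T - l"
            using k smax_ge[OF subst_space_letter[OF y, of "int k"]] by (auto simp: pre_Suc l_def)
          define a where "a = (LINT \<tau>:{0..<T}|lborel. F (flow \<tau> (y, u)))"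
          have "norm (a - \<kappa> * T) = norm ((a - I (pre y k)) + ((I (pre y k) - \<kappa> * l) + \<kappa> * (l - T)))"
            by (simp add: algebra_simps)
          also have "\<dots> \<le> C + ((r / 2 * l + K) + norm \<kappa> * smax)"
          proof (intro norm_triangle_le add_mono)
            show "norm (a - I (pre y k)) \<le> C" unfolding a_def using T k by (intro C) auto
            show "norm (I (pre y k) - \<kappa> * l) \<le> r / 2 * l + K"
              unfolding l_def by (rule K[OF pre_legal[OF y]])
            show "norm (\<kappa> * (l - T)) \<le> norm \<kappa> * smax"
              unfolding norm_mult using l by (intro mult_left_mono) (auto simp: norm_of_real simp flip: of_real_diff)
          qed
          also have "\<dots> \<le> r / 2 * T + E" using l r by (simp add: E_def mult_left_mono)
          finally have *: "norm (a - \<kappa> * T) \<le> r / 2 * T + E" .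
          have "A j x = a / T" by (simp only: A_def a_def x T_def)
          then have "A j x - \<kappa> = (a - \<kappa> * T) / T" using T by (simp add: field_simps)
          then have "norm (A j x - \<kappa>) = norm (a - \<kappa> * T) / T" using T by (simp add: norm_divide)
          also have "\<dots> \<le> (r / 2 * T + E) / T" using * T by (intro divide_right_mono) auto
          also have "\<dots> = r / 2 + E / T" using T by (simp add: add_divide_distrib)
          also have "\<dots> < r" using j0[OF that] unfolding T_def by linarith
          finally show ?thesis .
        qed
        then show "\<exists>no. \<forall>j\<ge>no. norm (A j x - \<kappa>) < r" by blast
      qed
    qed
  qed auto
  moreover have "(LINT x|\<mu>. A j x) = (LINT x|\<mu>. F x)" for j
  proof -
    have "complex_of_real (real (Suc j)) \<noteq> 0" unfolding of_real_eq_0_iff by simp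
    moreover have "(LINT x|\<mu>. A j x) = complex_of_real (real (Suc j)) * (LINT x|\<mu>. F x) / complex_of_real (real (Suc j))"
      unfolding A_def integral_divide_zero by (subst time_average(2)[OF F]) simp_all
    moreover have "c * z / c = z" if "c \<noteq> 0" for c z :: complex using that by simp
    ultimately show ?thesis by presburger
  qed
  ultimately have "(\<lambda>j. LINT x|\<mu>. F x) \<longlonglongrightarrow> \<kappa>" by (simp add: prob_space)
  then show ?thesis by (simp add: LIMSEQ_const_iff)
qed

end

lemma set_integral_Ico_continuous:
  fixes g :: "real \<Rightarrow> complex"
  assumes g: "continuous_on UNIV g"
  shows "(LINT \<tau>:{0..<T}|lborel. g \<tau>) = integral {0..T} g"
proof -
  have "set_integrable lborel {0..T} g"
    unfolding set_integrable_def by (rule borel_integrable_compact) (auto intro: continuous_on_subset[OF g])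
  then have "set_integrable lborel {0..<T} g"
    by (rule set_integrable_subset) auto
  then have "(LINT \<tau>:{0..<T}|lborel. g \<tau>) = integral {0..<T} g"
    by (rule set_borel_integral_eq_integral)
  also have "\<dots> = integral {0..T} g"
  proof (rule integral_spike_set)
    show "negligible {x \<in> {0..<T} - {0..T}. g x \<noteq> 0}" by (rule negligible_subset[of "{}"]) auto
    show "negligible {x \<in> {0..T} - {0..<T}. g x \<noteq> 0}" by (rule negligible_subset[of "{T}"]) auto
  qed
  finally show ?thesis .
qed

section \<open>Correlations of words as space means\<close>

context suspended_tiling
begin

lemma wlen_pre_ge: "y \<in> subst_space m \<zeta> \<Longrightarrow> smin * real n \<le> wlen s (pre y n)"
  using return_time_unbounded(1)[of y n] by (simp add: return_time_pre)

text \<open>So many tiles, each at least \<open>smin\<close> long, cover a span of length D that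
  starts anywhere in the first tile; \<open>smax\<close> allows for the starting height.\<close>

definition window :: "real \<Rightarrow> nat" where
  "window D = nat \<lceil>(smax + D) / smin\<rceil>"

lemma wlen_window: "y \<in> subst_space m \<zeta> \<Longrightarrow> smax + D \<le> wlen s (pre y (window D))"
proof -
  assume y: "y \<in> subst_space m \<zeta>"
  have "(smax + D) / smin \<le> real (window D)" unfolding window_def by linarith
  then have "smax + D \<le> smin * real (window D)" using smin_pos by (simp add: field_simps)
  with wlen_pre_ge[OF y, of "window D"] show ?thesis by simp
qed

text \<open>The window is long enough for the first letters of the sequence to determine the value.\<close>

definition flow_corr :: "(nat \<Rightarrow> real \<Rightarrow> complex) \<Rightarrow> real \<Rightarrow> real \<Rightarrow> (int \<Rightarrow> nat) \<times> real \<Rightarrow> complex" where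
  "flow_corr P t R x = corr_density s P t R (pre (fst x) (window (t + R))) (snd x)"

lemma suspension_height: "(y, u) \<in> suspension m \<zeta> s \<Longrightarrow> 0 \<le> u \<and> u < smax"
  using smax_ge[OF subst_space_letter[of y 0]] by (fastforce simp: suspension_def)

lemma suspension_sequence: "(y, u) \<in> suspension m \<zeta> s \<Longrightarrow> y \<in> subst_space m \<zeta>"
  by (simp add: suspension_def)

context
  fixes P :: "nat \<Rightarrow> real \<Rightarrow> complex" and B t R :: real
  assumes P: "admissible B P" and t: "0 \<le> t" and R: "0 \<le> R"
begin

lemma corr_density_pre_cong:
  assumes y: "y \<in> subst_space m \<zeta>" and "\<tau> + t + R \<le> wlen s (pre y n)" "\<tau> + t + R \<le> wlen s (pre y k)"
  shows "corr_density s P t R (pre y n) \<tau> = corr_density s P t R (pre y k) \<tau>"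
proof -
  have *: "corr_density s P t R (pre y n) \<tau> = corr_density s P t R (pre y (n + j)) \<tau>" if "\<tau> + t + R \<le> wlen s (pre y n)" for n j
    unfolding pre_add
    by (rule corr_density_append_left[OF P _ _ t R that, symmetric]) (intro word_pre y subst_space_shift)+
  consider j where "k = n + j" | j where "n = k + j" by (metis le_Suc_ex nat_le_linear)
  then show ?thesis using * assms by cases auto
qed

lemma flow_corr_flow:
  assumes y: "y \<in> subst_space m \<zeta>" and \<tau>: "0 \<le> \<tau>" "\<tau> + t + R \<le> wlen s (pre y n)"
  shows "flow_corr P t R (flow \<tau> (y, 0)) = corr_density s P t R (pre y n) \<tau>"
proof -
  obtain k where k: "wlen s (pre y k) \<le> \<tau>" "\<tau> < wlen s (pre y (Suc k))"
    "flow \<tau> (y, 0) = (shift (int k) y, \<tau> - wlen s (pre y k))"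
    by (rule suspension_flow_forward[OF y \<tau>(1)])
  define v where "v = \<tau> - wlen s (pre y k)"
  have v: "0 \<le> v" "v < smax"
    using k smax_ge[OF subst_space_letter[OF y, of "int k"]] by (auto simp: v_def pre_Suc)
  have "flow_corr P t R (flow \<tau> (y, 0)) = corr_density s P t R (pre (shift (int k) y) (window (t + R))) v"
    by (simp add: flow_corr_def k v_def)
  also have "\<dots> = corr_density s P t R (pre y (k + window (t + R))) (wlen s (pre y k) + v)"
    unfolding pre_add by (rule corr_density_append_right[OF P word_pre[OF y] t R v(1), symmetric])
  also have "wlen s (pre y k) + v = \<tau>" by (simp add: v_def)
  also have "corr_density s P t R (pre y (k + window (t + R))) \<tau> = corr_density s P t R (pre y n) \<tau>"
  proof (rule corr_density_pre_cong[OF y _ \<tau>(2)])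
    show "\<tau> + t + R \<le> wlen s (pre y (k + window (t + R)))"
      using wlen_window[OF subst_space_shift[OF y, of "int k"], of "t + R"] v
      by (simp add: pre_add v_def)
  qed
  finally show ?thesis .
qed

lemma flow_corr_eq:
  assumes "(y, u) \<in> suspension m \<zeta> s" "u + t + R \<le> wlen s (pre y n)"
  shows "flow_corr P t R (y, u) = corr_density s P t R (pre y n) u"
  using flow_corr_flow[OF suspension_sequence[OF assms(1)] _ assms(2)] suspension_flow_vertical[OF assms(1)]
    suspension_height[OF assms(1)] by simp

lemma flow_corr_bound: "x \<in> suspension m \<zeta> s \<Longrightarrow> norm (flow_corr P t R x) \<le> qbound B R"
  unfolding flow_corr_def by (rule corr_density_bound[OF P word_pre R]) (auto simp: suspension_def)

lemma measurable_flow_corr: "flow_corr P t R \<in> borel_measurable \<mu>"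
proof -
  \<comment> \<open>The prefix takes countably many values, so it can be fixed. The guard restricts
    the claim to words over the alphabet, for which the density is continuous; prefixes of points of
    the suspension always pass it.\<close>
  have "(\<lambda>x. (\<lambda>w x. if word w then corr_density s P t R w (snd x) else 0) (pre (fst x) (window (t + R))) x) \<in> borel_measurable \<mu>"
  proof (rule measurable_compose_countable[OF _ measurable_pre])
    fix w :: "nat list"
    show "(\<lambda>x. if word w then corr_density s P t R w (snd x) else 0) \<in> borel_measurable \<mu>"
    proof (cases "word w")
      case True
      then show ?thesis
        using measurable_compose[OF measurable_height borel_measurable_continuous_onI[OF continuous_corr_density[OF P True]]]
        by simp
    qed simp
  qed
  then show ?thesis
    by (rule measurable_cong[THEN iffD1, rotated])
      (use word_pre in \<open>auto simp: flow_corr_def space_\<mu> suspension_def subset_iff\<close>)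
qed

lemma integrable_flow_corr: "integrable \<mu> (flow_corr P t R)"
  by (rule integrable_const_bound[OF _ measurable_flow_corr, of "qbound B R"]) (auto simp: space_\<mu> flow_corr_bound)

lemma integral_flow_flow_corr:
  assumes yu: "(y, u) \<in> suspension m \<zeta> s" and T: "0 \<le> T" and n: "u + T + t + R \<le> wlen s (pre y n)"
  shows "(LINT \<tau>:{0..<T}|lborel. flow_corr P t R (flow \<tau> (y, u))) = integral {u..u + T} (corr_density s P t R (pre y n))"
proof -
  have y: "y \<in> subst_space m \<zeta>" and u: "0 \<le> u" using yu by (auto simp: suspension_def)
  define g where "g = corr_density s P t R (pre y n)"
  have g: "continuous_on A g" for A unfolding g_def by (rule continuous_corr_density[OF P word_pre[OF y]])
  have "(LINT \<tau>:{0..<T}|lborel. flow_corr P t R (flow \<tau> (y, u))) = (LINT \<tau>:{0..<T}|lborel. (g \<circ> (+) u) \<tau>)"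
  proof (rule set_lebesgue_integral_cong)
    show "\<forall>\<tau>. \<tau> \<in> {0..<T} \<longrightarrow> flow_corr P t R (flow \<tau> (y, u)) = (g \<circ> (+) u) \<tau>"
    proof (intro allI impI)
      fix \<tau> assume \<tau>: "\<tau> \<in> {0..<T}"
      have "flow_corr P t R (flow \<tau> (y, u)) = flow_corr P t R (flow (u + \<tau>) (y, 0))"
        by (simp only: suspension_flow_from_base[OF yu])
      also have "\<dots> = g (u + \<tau>)"
        unfolding g_def using \<tau> u n by (intro flow_corr_flow[OF y]) auto
      finally show "flow_corr P t R (flow \<tau> (y, u)) = (g \<circ> (+) u) \<tau>" by simp
    qed
  qed simp
  also have "\<dots> = integral {0..T} (g \<circ> (+) u)"
    by (rule set_integral_Ico_continuous, rule continuous_on_compose) (auto intro!: g continuous_intros)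
  also have "\<dots> = integral {u..u + T} g"
    by (subst integral_shift_Icc_real) (simp add: add.commute)
  finally show ?thesis by (simp add: g_def)
qed

text \<open>By \<open>corr_append\<close> the correlation of words is additive up to a bounded
  error, so it has an average \<kappa>. The time integral of \<open>flow_corr\<close> and the
  correlation of the prefix differ by a bounded amount, which identifies \<kappa> with the space
  mean.\<close>

lemma corr_average:
  assumes a: "a < m"
  shows "(\<lambda>n. corr s P t R (sub n [a]) / \<theta> ^ n) \<longlonglongrightarrow> (LINT x|\<mu>. flow_corr P t R x) * s $ a"
proof -
  define C where "C = 2 * qbound B R * (t + R)"
  obtain \<kappa> :: complex where \<kappa>1: "\<And>a. a < m \<Longrightarrow> (\<lambda>n. corr s P t R (sub n [a]) / \<theta> ^ n) \<longlonglongrightarrow> \<kappa> * s $ a"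
    and \<kappa>2: "\<And>\<epsilon>. 0 < \<epsilon> \<Longrightarrow> \<exists>K. \<forall>w. legal w \<longrightarrow> norm (corr s P t R w - \<kappa> * wlen s w) \<le> \<epsilon> * wlen s w + K"
    by (rule quasi_additive_average[of "corr s P t R" C, OF corr_append[OF P _ _ t R, folded C_def]]) auto
  have qb: "0 \<le> qbound B R" by (rule qbound_nonneg[OF P])
  have "(LINT x|\<mu>. flow_corr P t R x) = \<kappa>"
  proof (rule ergodic_average[OF integrable_flow_corr \<kappa>2])
    fix y u assume yu: "(y, u) \<in> suspension m \<zeta> s"
    have y: "y \<in> subst_space m \<zeta>" and u: "0 \<le> u" using yu by (auto simp: suspension_def)
    \<comment> \<open>C for windows that reach beyond the first k tiles, the second term for the
      incomplete tile, and the last two for moving the time interval from [0, T] to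
      [u, u + T].\<close>
    define E where "E = C + qbound B R * smax + (qbound B R * u + qbound B R * u)"
    have "norm ((LINT \<tau>:{0..<T}|lborel. flow_corr P t R (flow \<tau> (y, u))) - corr s P t R (pre y k)) \<le> E"
      if T: "0 \<le> T" and k: "wlen s (pre y k) \<le> T" "T < wlen s (pre y (Suc k))" for T k
    proof -
      define w where "w = pre (shift (int k) y) (window (u + t + R))"
      define l where "l = wlen s (pre y k)"
      have w: "word w" unfolding w_def by (intro word_pre subst_space_shift y)
      have l: "0 \<le> l" "l \<le> T" "T - l \<le> smax"
        using k smax_ge[OF subst_space_letter[OF y, of "int k"]] wlen_nonneg[OF word_pre[OF y]]
        by (auto simp: pre_Suc l_def)
      have pkw: "pre y (k + window (u + t + R)) = pre y k @ w" by (simp add: pre_add w_def)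
      define g where "g = corr_density s P t R (pre y k @ w)"
      have wd: "word (pre y k @ w)" using w word_pre[OF y] by simp
      have gc: "continuous_on A g" for A unfolding g_def by (rule continuous_corr_density[OF P wd])
      have gi: "g integrable_on {p..q}" for p q by (rule integrable_continuous_interval[OF gc])
      have gb: "norm (integral {p..q} g) \<le> qbound B R * (q - p)" if "p \<le> q" for p q
        by (rule integral_bound[OF that gc]) (use corr_density_bound[OF P wd R] in \<open>auto simp: g_def\<close>)
      have "u + T + t + R \<le> wlen s (pre y (k + window (u + t + R)))"
        using wlen_window[OF subst_space_shift[OF y, of "int k"], of "u + t + R"] l
        by (simp add: pre_add l_def)
      from integral_flow_flow_corr[OF yu T this]
      have A: "(LINT \<tau>:{0..<T}|lborel. flow_corr P t R (flow \<tau> (y, u))) = integral {u..u + T} g"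
        by (simp add: pkw g_def)
      have "integral {0..u} g + integral {u..u + T} g = integral {0..u + T} g"
        using u T by (intro Henstock_Kurzweil_Integration.integral_combine gi) auto
      moreover have "integral {0..T} g + integral {T..u + T} g = integral {0..u + T} g"
        using u T by (intro Henstock_Kurzweil_Integration.integral_combine gi) auto
      moreover have "integral {0..l} g + integral {l..T} g = integral {0..T} g"
        using l by (intro Henstock_Kurzweil_Integration.integral_combine gi) auto
      ultimately have eq: "integral {u..u + T} g - corr s P t R (pre y k) =
          ((integral {0..l} g - corr s P t R (pre y k)) + integral {l..T} g) + (integral {T..u + T} g - integral {0..u} g)"
        by (simp add: algebra_simps)
      have 1: "norm (integral {0..l} g - corr s P t R (pre y k)) \<le> C"
        using corr_append[OF P word_pre[OF y] w t R, of k]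
          integral_corr_density_append[OF P word_pre[OF y] w t R, of k]
        by (simp add: C_def g_def l_def algebra_simps)
      have 2: "norm (integral {l..T} g) \<le> qbound B R * smax"
        using gb[OF l(2)] l(3) qb by (meson mult_left_mono order_trans)
      have 3: "norm (integral {T..u + T} g) \<le> qbound B R * u" "norm (integral {0..u} g) \<le> qbound B R * u"
        using gb[of T "u + T"] gb[of 0 u] u by auto
      show ?thesis unfolding A eq E_def
        by (intro norm_triangle_le add_mono 1 2 norm_triangle_le_diff 3)
    qed
    then show "\<exists>C. \<forall>T\<ge>0. \<forall>k. wlen s (pre y k) \<le> T \<longrightarrow> T < wlen s (pre y (Suc k)) \<longrightarrow>
        norm ((LINT \<tau>:{0..<T}|lborel. flow_corr P t R (flow \<tau> (y, u))) - corr s P t R (pre y k)) \<le> C" by blast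
  next
    fix T :: real and x assume T: "1 \<le> T" and x: "x \<in> suspension m \<zeta> s"
    obtain y u where xy: "x = (y, u)" by (cases x)
    have yu: "(y, u) \<in> suspension m \<zeta> s" using x xy by simp
    have y: "y \<in> subst_space m \<zeta>" and u: "0 \<le> u" "u < smax" using suspension_sequence[OF yu] suspension_height[OF yu] by auto
    have n: "u + T + t + R \<le> wlen s (pre y (window (T + t + R)))" using wlen_window[OF y, of "T + t + R"] u by simp
    have "norm (integral {u..u + T} (corr_density s P t R (pre y (window (T + t + R))))) \<le> qbound B R * (u + T - u)"
      using T by (intro integral_bound continuous_corr_density[OF P word_pre[OF y]] corr_density_bound[OF P word_pre[OF y] R]) auto
    then show "norm (LINT \<tau>:{0..<T}|lborel. flow_corr P t R (flow \<tau> x)) \<le> qbound B R * T"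
      using integral_flow_flow_corr[OF yu _ n] T by (simp add: xy)
  qed
  with \<kappa>1[OF a] show ?thesis by simp
qed

end

text \<open>Both sides are limits of the same averages, along \<open>\<zeta>\<^sup>n\<^sup>+\<^sup>N(0)\<close> and \<open>\<zeta>\<^sup>n(0)\<close>. This replaces the invariance of
  \<open>\<mu>\<close> under the substitution, so that recognizability is not needed.\<close>

lemma flow_corr_renormalize:
  assumes P: "admissible B P" and t: "0 \<le> t" and R: "0 \<le> R" and lP: "admissible B' (lev P N)"
  shows "(LINT x|\<mu>. flow_corr P (\<theta> ^ N * t) (\<theta> ^ N * R) x) = (LINT x|\<mu>. flow_corr (lev P N) t R x)"
proof -
  have tN: "0 \<le> \<theta> ^ N * t" "0 \<le> \<theta> ^ N * R" using t R \<theta>_gt_1 by auto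
  have "(\<lambda>n. corr s P (\<theta> ^ N * t) (\<theta> ^ N * R) (sub (n + N) [0]) / \<theta> ^ (n + N)) \<longlonglongrightarrow>
      (LINT x|\<mu>. flow_corr P (\<theta> ^ N * t) (\<theta> ^ N * R) x) * s $ 0"
    by (rule LIMSEQ_ignore_initial_segment[OF corr_average[OF P tN m_pos]])
  moreover have "corr s P (\<theta> ^ N * t) (\<theta> ^ N * R) (sub (n + N) [0]) / \<theta> ^ (n + N) =
      corr s (lev P N) t R (sub n [0]) / \<theta> ^ n" for n
  proof -
    have "sub (n + N) [0] = sub N (sub n [0])" by (simp add: funpow_add add.commute[of n])
    then have "corr s P (\<theta> ^ N * t) (\<theta> ^ N * R) (sub (n + N) [0]) = \<theta> ^ N * corr s (lev P N) t R (sub n [0])"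
      using corr_lev[OF P word_sub_letter[OF m_pos]] by simp
    then show ?thesis using \<theta>_gt_1 by (simp add: power_add)
  qed
  ultimately have "(\<lambda>n. corr s (lev P N) t R (sub n [0]) / \<theta> ^ n) \<longlonglongrightarrow>
      (LINT x|\<mu>. flow_corr P (\<theta> ^ N * t) (\<theta> ^ N * R) x) * s $ 0" by simp
  from LIMSEQ_unique[OF this corr_average[OF lP t R m_pos]] show ?thesis using s_pos[OF m_pos] by simp
qed

lemma flow_corr_scale: "flow_corr (\<lambda>a u. c * P a u) t R x = (norm c)\<^sup>2 * flow_corr P t R x"
proof -
  have "(complex_of_real (norm c))\<^sup>2 = c * cnj c" using complex_norm_square[of c] by simp
  then show ?thesis
    unfolding flow_corr_def corr_density_def acc_scale right_diff_distrib[symmetric] complex_cnj_mult by simp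
qed

end

section \<open>Orbit integrals of cylindrical functions\<close>

context gap_tiling
begin

text \<open>Half-open intervals fit together without overlap at the tile boundaries; replacing the
  closed intervals of the profiles changes only a null set.\<close>

lemma has_integral_tile_value:
  assumes \<psi>: "\<And>a. a < m \<Longrightarrow> set_integrable lborel {0..s $ a} (\<psi> a)" and w: "word w"
  shows "has_bochner_integral lborel (\<lambda>\<tau>. indicator {0..<T} \<tau> *\<^sub>R tile_value \<psi> w \<tau>) (acc s (\<lambda>a u. integral {0..u} (\<psi> a)) w T)"
  using w
proof (induction w arbitrary: T)
  case Nil
  then show ?case by (simp add: has_bochner_integral_zero)
next
  case (Cons a w)
  then have a: "a < m" and w: "word w" by auto
  define c where "c = clip (s $ a) T"
  have c: "0 \<le> c" "c \<le> s $ a" using clip_range[OF less_imp_le[OF s_pos[OF a]], of T] by (auto simp: c_def)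
  have i1: "set_integrable lborel {0..c} (\<psi> a)"
    by (rule set_integrable_subset[OF \<psi>[OF a]]) (use c in auto)
  have i2: "set_integrable lborel {0..<c} (\<psi> a)"
    by (rule set_integrable_subset[OF i1]) auto
  have "(LINT x:{0..<c}|lborel. \<psi> a x) = (LINT x:{0..c}|lborel. \<psi> a x)"
    unfolding set_lebesgue_integral_def
  proof (rule integral_cong_AE)
    show "AE x in lborel. indicator {0..<c} x *\<^sub>R \<psi> a x = indicator {0..c} x *\<^sub>R \<psi> a x"
      using AE_lborel_singleton[of c] by eventually_elim (auto simp: indicator_def)
  qed (use i1 i2 in \<open>auto simp: set_integrable_def\<close>)
  also have "\<dots> = integral {0..c} (\<psi> a)" by (rule set_borel_integral_eq_integral[OF i1])
  finally have "has_bochner_integral lborel (\<lambda>\<tau>. indicator {0..<c} \<tau> *\<^sub>R \<psi> a \<tau>) (integral {0..c} (\<psi> a))"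
    using i2 by (simp add: has_bochner_integral_iff set_integrable_def set_lebesgue_integral_def)
  moreover have "has_bochner_integral lborel (\<lambda>\<tau>. indicator {0..<T - s $ a} (\<tau> - s $ a) *\<^sub>R tile_value \<psi> w (\<tau> - s $ a))
      (acc s (\<lambda>a u. integral {0..u} (\<psi> a)) w (T - s $ a))"
    using Cons.IH[OF w, of "T - s $ a"]
      lborel_has_bochner_integral_real_affine_iff[of 1 "\<lambda>\<tau>. indicator {0..<T - s $ a} \<tau> *\<^sub>R tile_value \<psi> w \<tau>" _ "- (s $ a)"]
    by simp
  ultimately have "has_bochner_integral lborel
      (\<lambda>\<tau>. indicator {0..<c} \<tau> *\<^sub>R \<psi> a \<tau> + indicator {0..<T - s $ a} (\<tau> - s $ a) *\<^sub>R tile_value \<psi> w (\<tau> - s $ a))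
      (acc s (\<lambda>a u. integral {0..u} (\<psi> a)) (a # w) T)"
    unfolding acc.simps c_def[symmetric] by (rule has_bochner_integral_add)
  moreover have "indicator {0..<c} \<tau> *\<^sub>R \<psi> a \<tau> + indicator {0..<T - s $ a} (\<tau> - s $ a) *\<^sub>R tile_value \<psi> w (\<tau> - s $ a) =
      indicator {0..<T} \<tau> *\<^sub>R tile_value \<psi> (a # w) \<tau>" for \<tau>
    using s_pos[OF a] by (auto simp: c_def clip_def indicator_def max_def min_def)
  ultimately show ?case by simp
qed

lemma primitive_admissible:
  assumes \<psi>: "\<And>a. a < m \<Longrightarrow> set_integrable lborel {0..s $ a} (\<psi> a)"
  obtains B where "admissible B (\<lambda>a u. integral {0..u} (\<psi> a :: real \<Rightarrow> complex))"
proof -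
  define P where "P a u = integral {0..u} (\<psi> a)" for a u
  have cont: "continuous_on {0..s $ a} (P a)" if "a < m" for a
    unfolding P_def by (rule indefinite_integral_continuous_1[OF set_borel_integral_eq_integral(1)[OF \<psi>[OF that]]])
  have "\<exists>B. \<forall>u\<in>{0..s $ a}. norm (P a u) \<le> B" if "a < m" for a
    using compact_imp_bounded[OF compact_continuous_image[OF cont[OF that] compact_Icc]]
    by (auto simp: bounded_iff)
  then obtain Bf where Bf: "\<And>a u. a < m \<Longrightarrow> u \<in> {0..s $ a} \<Longrightarrow> norm (P a u) \<le> Bf a" by metis
  have "norm (P a u) \<le> Max (Bf ` {..<m})" if "a < m" "u \<in> {0..s $ a}" for a u
    by (rule order_trans[OF Bf[OF that] Max_ge]) (use that in auto)
  then have "admissible (Max (Bf ` {..<m})) P"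
    unfolding admissible_def using cont by (auto simp: P_def)
  then show thesis using that unfolding P_def by blast
qed

end

locale cylindrical_tiling = suspended_tiling +
  fixes \<psi> :: "nat \<Rightarrow> real \<Rightarrow> complex" and f :: "(int \<Rightarrow> nat) \<times> real \<Rightarrow> complex"
  assumes cylindrical: "cylindrical m \<zeta> s \<psi> f" and square_integrable: "square_integrable \<mu> f"
begin

definition P\<^sub>0 :: "nat \<Rightarrow> real \<Rightarrow> complex" where
  "P\<^sub>0 a u = integral {0..u} (\<psi> a)"

lemma \<psi>_integrable: "a < m \<Longrightarrow> set_integrable lborel {0..s $ a} (\<psi> a)"
  and f_\<psi>: "(y, u) \<in> suspension m \<zeta> s \<Longrightarrow> f (y, u) = \<psi> (y 0) u"
  using cylindrical by (auto simp: cylindrical_def)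

definition B\<^sub>0 :: real where "B\<^sub>0 = (SOME B. admissible B P\<^sub>0)"

lemma P\<^sub>0_admissible: "admissible B\<^sub>0 P\<^sub>0"
proof -
  obtain B where "admissible B P\<^sub>0"
    using primitive_admissible[OF \<psi>_integrable] unfolding P\<^sub>0_def[abs_def] by blast
  then show ?thesis unfolding B\<^sub>0_def by (rule someI)
qed

lemma f_measurable [measurable]: "f \<in> borel_measurable \<mu>"
  and f_square: "integrable \<mu> (\<lambda>x. (norm (f x))\<^sup>2)"
  using square_integrable by (auto simp: square_integrable_def)

lemma f_integrable: "integrable \<mu> f"
proof (rule Bochner_Integration.integrable_bound)
  show "integrable \<mu> (\<lambda>x. 1 + (norm (f x))\<^sup>2)" using f_square by simp
  have "norm z \<le> 1 + (norm z)\<^sup>2" for z :: complex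
    using sum_squares_bound[of 1 "norm z"] zero_le_power2[of "norm z"] by (simp add: power2_eq_square) (smt (verit) norm_ge_zero)
  then show "AE x in \<mu>. norm (f x) \<le> norm (1 + (norm (f x))\<^sup>2)" by (intro AE_I2) (simp add: abs_of_nonneg)
qed simp

lemma orbit_integral:
  assumes y: "y \<in> subst_space m \<zeta>" and r: "0 \<le> r" and T: "0 \<le> T" and n: "r + T \<le> wlen s (pre y n)"
  shows "set_integrable lborel {0..<T} (\<lambda>\<tau>. f (flow (r + \<tau>) (y, 0)))"
    and "(LINT \<tau>:{0..<T}|lborel. f (flow (r + \<tau>) (y, 0))) = acc s P\<^sub>0 (pre y n) (r + T) - acc s P\<^sub>0 (pre y n) r"
proof -
  have acc: "acc s P\<^sub>0 = acc s (\<lambda>a u. integral {0..u} (\<psi> a))" by (simp add: P\<^sub>0_def[abs_def])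
  have w: "word (pre y n)" by (rule word_pre[OF y])
  define v where "v = tile_value \<psi> (pre y n)"
  have "has_bochner_integral lborel (\<lambda>\<tau>. indicator {0..<r + T} \<tau> *\<^sub>R v \<tau> - indicator {0..<r} \<tau> *\<^sub>R v \<tau>)
      (acc s P\<^sub>0 (pre y n) (r + T) - acc s P\<^sub>0 (pre y n) r)"
    unfolding acc v_def by (intro has_bochner_integral_diff has_integral_tile_value \<psi>_integrable w)
  also have "(\<lambda>\<tau>. indicator {0..<r + T} \<tau> *\<^sub>R v \<tau> - indicator {0..<r} \<tau> *\<^sub>R v \<tau>) = (\<lambda>\<tau>. indicator {r..<r + T} \<tau> *\<^sub>R v \<tau>)"
    using r T by (intro ext) (auto simp: indicator_def)
  finally have "has_bochner_integral lborel (\<lambda>\<tau>. indicator {r..<r + T} (r + \<tau>) *\<^sub>R v (r + \<tau>))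
      (acc s P\<^sub>0 (pre y n) (r + T) - acc s P\<^sub>0 (pre y n) r)"
    using lborel_has_bochner_integral_real_affine_iff[of 1 "\<lambda>\<tau>. indicator {r..<r + T} \<tau> *\<^sub>R v \<tau>" _ r] by simp
  also have "(\<lambda>\<tau>. indicator {r..<r + T} (r + \<tau>) *\<^sub>R v (r + \<tau>)) = (\<lambda>\<tau>. indicator {0..<T} \<tau> *\<^sub>R f (flow (r + \<tau>) (y, 0)))"
  proof
    fix \<tau>
    show "indicator {r..<r + T} (r + \<tau>) *\<^sub>R v (r + \<tau>) = indicator {0..<T} \<tau> *\<^sub>R f (flow (r + \<tau>) (y, 0))"
      using cylindrical_flow[of f \<psi>, OF f_\<psi> y, of "r + \<tau>" n] r n by (auto simp: indicator_def v_def)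
  qed
  finally have *: "has_bochner_integral lborel (\<lambda>\<tau>. indicator {0..<T} \<tau> *\<^sub>R f (flow (r + \<tau>) (y, 0)))
      (acc s P\<^sub>0 (pre y n) (r + T) - acc s P\<^sub>0 (pre y n) r)" .
  from * show "set_integrable lborel {0..<T} (\<lambda>\<tau>. f (flow (r + \<tau>) (y, 0)))"
    unfolding set_integrable_def by (rule integrable.intros)
  from * show "(LINT \<tau>:{0..<T}|lborel. f (flow (r + \<tau>) (y, 0))) = acc s P\<^sub>0 (pre y n) (r + T) - acc s P\<^sub>0 (pre y n) r"
    unfolding set_lebesgue_integral_def by (rule has_bochner_integral_integral_eq)
qed

definition orbit_sum :: "real \<Rightarrow> (int \<Rightarrow> nat) \<times> real \<Rightarrow> complex" where
  "orbit_sum R x = (LINT a:{0..<R}|lborel. f (flow a x))"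

lemma orbit_sum_flow:
  assumes yu: "(y, u) \<in> suspension m \<zeta> s" and t: "0 \<le> t" and R: "0 \<le> R" and n: "u + t + R \<le> wlen s (pre y n)"
  shows "orbit_sum R (flow t (y, u)) = acc s P\<^sub>0 (pre y n) (u + t + R) - acc s P\<^sub>0 (pre y n) (u + t)"
proof -
  have "flow a (flow t (y, u)) = flow (u + t + a) (y, 0)" for a
    using suspension_flow_add[OF yu, of a t] suspension_flow_from_base[OF yu, of "t + a"] by (simp add: add.assoc)
  then show ?thesis unfolding orbit_sum_def
    using orbit_integral(2)[OF suspension_sequence[OF yu] _ R n] suspension_height[OF yu] t by simp
qed

lemma flow_0: "x \<in> suspension m \<zeta> s \<Longrightarrow> flow 0 x = x"
  using suspension_flow_from_base[of "fst x" "snd x" 0] suspension_flow_vertical[of "fst x" "snd x"] by simp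

lemma orbit_sum_flow_corr:
  assumes x: "x \<in> suspension m \<zeta> s" and t: "0 \<le> t" and R: "0 \<le> R"
  shows "orbit_sum R (flow t x) * cnj (orbit_sum R x) = flow_corr P\<^sub>0 t R x"
proof -
  obtain y u where xy: "x = (y, u)" and yu: "(y, u) \<in> suspension m \<zeta> s" using x by (cases x) auto
  have n: "u + t + R \<le> wlen s (pre y (window (t + R)))" "u + 0 + R \<le> wlen s (pre y (window (t + R)))"
    using wlen_window[OF suspension_sequence[OF yu], of "t + R"] suspension_height[OF yu] t by auto
  have "orbit_sum R (y, u) = acc s P\<^sub>0 (pre y (window (t + R))) (u + R) - acc s P\<^sub>0 (pre y (window (t + R))) u"
    using orbit_sum_flow[OF yu order_refl R n(2)] flow_0[OF yu] by simp
  then show ?thesis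
    unfolding xy orbit_sum_flow[OF yu t R n(1)] flow_corr_def corr_density_def by simp
qed

lemma norm_orbit_sum:
  assumes x: "x \<in> suspension m \<zeta> s" and R: "0 \<le> R"
  shows "norm (orbit_sum R x) \<le> B\<^sub>0 * (3 + R / smin)"
proof -
  obtain y u where xy: "x = (y, u)" and yu: "(y, u) \<in> suspension m \<zeta> s" using x by (cases x) auto
  have n: "u + 0 + R \<le> wlen s (pre y (window R))"
    using wlen_window[OF suspension_sequence[OF yu], of R] suspension_height[OF yu] by auto
  show ?thesis
    using orbit_sum_flow[OF yu order_refl R n] flow_0[OF yu]
      norm_acc_diff_le[of P\<^sub>0, OF admissibleD(1)[OF P\<^sub>0_admissible] admissibleD(3)[OF P\<^sub>0_admissible] word_pre[OF suspension_sequence[OF yu]] R]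
    by (simp add: xy)
qed

text \<open>Tile totals are exactly additive, so they have an average, and
  \<open>ergodic_average\<close> identifies it with the mean of f. Zero mean therefore removes the
  growth of order \<theta>^n, which is the input of
  \<open>subdominant_row_iteration\<close>.\<close>

lemma zero_mean_total:
  assumes mean: "(LINT x|\<mu>. f x) = 0" and a: "a < m"
  shows "(\<lambda>n. tot s P\<^sub>0 (sub n [a]) / \<theta> ^ n) \<longlonglongrightarrow> 0"
proof -
  note P0 = P\<^sub>0_admissible
  have accd: "norm (acc s P\<^sub>0 w (\<tau> + R) - acc s P\<^sub>0 w \<tau>) \<le> B\<^sub>0 * (3 + R / smin)" if "word w" "0 \<le> R" for w \<tau> R
    by (rule norm_acc_diff_le[of P\<^sub>0, OF admissibleD(1)[OF P0] admissibleD(3)[OF P0] that])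
  have B0: "0 \<le> B\<^sub>0" by (rule B_nonneg[of P\<^sub>0, OF admissibleD(1)[OF P0] admissibleD(3)[OF P0]])
  obtain \<kappa> :: complex where \<kappa>1: "\<And>a. a < m \<Longrightarrow> (\<lambda>n. tot s P\<^sub>0 (sub n [a]) / \<theta> ^ n) \<longlonglongrightarrow> \<kappa> * s $ a"
    and \<kappa>2: "\<And>\<epsilon>. 0 < \<epsilon> \<Longrightarrow> \<exists>K. \<forall>w. legal w \<longrightarrow> norm (tot s P\<^sub>0 w - \<kappa> * wlen s w) \<le> \<epsilon> * wlen s w + K"
    by (rule quasi_additive_average[of "tot s P\<^sub>0" 0]) auto
  have "(LINT x|\<mu>. f x) = \<kappa>"
  proof (rule ergodic_average[OF f_integrable \<kappa>2])
    fix y u assume yu: "(y, u) \<in> suspension m \<zeta> s"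
    have y: "y \<in> subst_space m \<zeta>" and u: "0 \<le> u" using yu by (auto simp: suspension_def)
    \<comment> \<open>The orbit integral is an increment of \<open>acc\<close> over [u, u + T] and
      the total one over [0, l]. They differ by the increments over [l, u + T] and [0, u], of
      lengths at most u + smax and u.\<close>
    have "norm ((LINT \<tau>:{0..<T}|lborel. f (flow \<tau> (y, u))) - tot s P\<^sub>0 (pre y k)) \<le>
        B\<^sub>0 * (3 + (u + smax) / smin) + B\<^sub>0 * (3 + u / smin)"
      if T: "0 \<le> T" and k: "wlen s (pre y k) \<le> T" "T < wlen s (pre y (Suc k))" for T k
    proof -
      define l where "l = wlen s (pre y k)"
      have l: "0 \<le> l" "l \<le> T" "T - l \<le> smax"
        using k smax_ge[OF subst_space_letter[OF y, of "int k"]] wlen_nonneg[OF word_pre[OF y]]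
        by (auto simp: pre_Suc l_def)
      define w where "w = pre y (k + window (u + T))"
      have w: "word w" unfolding w_def by (rule word_pre[OF y])
      have "u + 0 + T \<le> wlen s w"
        using wlen_window[OF subst_space_shift[OF y, of "int k"], of "u + T"] l smin_pos smin_le[OF m_pos] smax_ge[OF m_pos]
        by (simp add: w_def pre_add l_def)
      from orbit_sum_flow[OF yu order_refl T this[unfolded w_def]]
      have A: "(LINT \<tau>:{0..<T}|lborel. f (flow \<tau> (y, u))) = acc s P\<^sub>0 w (u + T) - acc s P\<^sub>0 w u"
        unfolding flow_0[OF yu] orbit_sum_def w_def by simp
      have tk: "tot s P\<^sub>0 (pre y k) = acc s P\<^sub>0 w l"
        unfolding w_def pre_add
        using acc_append_right[of P\<^sub>0, OF admissibleD(1)[OF P0] word_pre[OF y], of 0 k "pre (shift (int k) y) (window (u + T))"]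
          acc_nonpos[of P\<^sub>0, OF admissibleD(1)[OF P0] word_pre[OF subst_space_shift[OF y]], of 0]
        by (simp add: l_def)
      have 0: "acc s P\<^sub>0 w 0 = 0" by (rule acc_nonpos[of P\<^sub>0, OF admissibleD(1)[OF P0] w order_refl])
      have "norm (acc s P\<^sub>0 w (l + (u + T - l)) - acc s P\<^sub>0 w l) \<le> B\<^sub>0 * (3 + (u + T - l) / smin)"
        using l u by (intro accd w) auto
      also have "\<dots> \<le> B\<^sub>0 * (3 + (u + smax) / smin)"
        using l smin_pos by (intro mult_left_mono B0 add_left_mono divide_right_mono) auto
      finally have 1: "norm (acc s P\<^sub>0 w (u + T) - acc s P\<^sub>0 w l) \<le> B\<^sub>0 * (3 + (u + smax) / smin)" by simp
      have 2: "norm (acc s P\<^sub>0 w u) \<le> B\<^sub>0 * (3 + u / smin)" using accd[OF w u, of 0] by (simp add: 0)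
      have "norm ((acc s P\<^sub>0 w (u + T) - acc s P\<^sub>0 w l) - acc s P\<^sub>0 w u) \<le> B\<^sub>0 * (3 + (u + smax) / smin) + B\<^sub>0 * (3 + u / smin)"
        by (rule norm_triangle_le_diff[OF add_mono[OF 1 2]])
      then show ?thesis unfolding A tk by (simp add: algebra_simps)
    qed
    then show "\<exists>C. \<forall>T\<ge>0. \<forall>k. wlen s (pre y k) \<le> T \<longrightarrow> T < wlen s (pre y (Suc k)) \<longrightarrow>
        norm ((LINT \<tau>:{0..<T}|lborel. f (flow \<tau> (y, u))) - tot s P\<^sub>0 (pre y k)) \<le> C" by blast
  next
    fix T :: real and x assume T: "1 \<le> T" and x: "x \<in> suspension m \<zeta> s"
    have "norm (LINT \<tau>:{0..<T}|lborel. f (flow \<tau> x)) \<le> B\<^sub>0 * (3 + T / smin)"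
      using norm_orbit_sum[OF x] T unfolding orbit_sum_def by simp
    also have "\<dots> \<le> B\<^sub>0 * (3 * T + T / smin)" using T B0 by (intro mult_left_mono) auto
    also have "\<dots> = B\<^sub>0 * (3 + 1 / smin) * T" by (simp add: algebra_simps)
    finally show "norm (LINT \<tau>:{0..<T}|lborel. f (flow \<tau> x)) \<le> B\<^sub>0 * (3 + 1 / smin) * T" .
  qed
  with \<kappa>1[OF a] mean show ?thesis by simp
qed

end

section \<open>Spectral measures and Fejer kernels\<close>

abbreviation wave :: "real \<Rightarrow> real \<Rightarrow> complex" where
  "wave \<omega> t \<equiv> exp (2 * of_real pi * \<i> * of_real \<omega> * of_real t)"

definition dirichlet :: "real \<Rightarrow> real \<Rightarrow> complex" where
  "dirichlet R \<omega> = (LINT a:{0..<R}|lborel. wave \<omega> a)"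

lemma borel_measurable_cnj [measurable (raw)]:
  "g \<in> borel_measurable M \<Longrightarrow> (\<lambda>x. cnj (g x)) \<in> borel_measurable M"
  by (rule borel_measurable_continuous_on[of cnj]) (auto intro!: continuous_intros)

lemma norm_wave [simp]: "norm (wave \<omega> t) = 1"
proof -
  have "wave \<omega> t = exp (\<i> * of_real (2 * pi * \<omega> * t))" by (simp add: mult_ac)
  then show ?thesis by (simp only: norm_exp_i_times)
qed

lemma wave_add_diff: "wave \<omega> (t + a - b) = wave \<omega> t * wave \<omega> a * cnj (wave \<omega> b)"
proof -
  have "cnj (wave \<omega> b) = wave \<omega> (- b)" by (simp add: exp_cnj)
  then show ?thesis by (simp add: exp_add[symmetric] algebra_simps)
qed

lemma norm_dirichlet:
  assumes R: "0 \<le> R"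
  shows "(norm (dirichlet R \<omega>))\<^sup>2 = R\<^sup>2 * (sinc (pi * \<omega> * R))\<^sup>2"
proof (cases "\<omega> = 0 \<or> R = 0")
  case True
  have "dirichlet R \<omega> = integral {0..R} (wave \<omega>)"
    unfolding dirichlet_def by (rule set_integral_Ico_continuous) (intro continuous_intros)
  also have "\<dots> = R" using True R by (auto simp: scaleR_conv_of_real)
  finally show ?thesis using True by auto
next
  case False
  define c where "c = 2 * of_real pi * \<i> * complex_of_real \<omega>"
  define \<theta> where "\<theta> = pi * \<omega> * R"
  have c: "c \<noteq> 0" using False by (simp add: c_def)
  have "((\<lambda>a. exp (c * of_real a)) has_integral exp (c * of_real R) / c - exp (c * of_real 0) / c) {0..R}"
  proof (rule fundamental_theorem_of_calculus[OF R])
    fix a assume "a \<in> {0..R}"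
    have "((\<lambda>z. exp (c * z) / c) has_field_derivative exp (c * of_real a)) (at (of_real a))"
      using c by (auto intro!: derivative_eq_intros)
    from has_vector_derivative_real_field[OF this]
    show "((\<lambda>a. exp (c * of_real a) / c) has_vector_derivative exp (c * of_real a)) (at a within {0..R})"
      by (simp add: has_vector_derivative_at_within)
  qed
  then have "integral {0..R} (wave \<omega>) = (exp (c * of_real R) - 1) / c"
    by (intro integral_unique) (simp add: c_def diff_divide_distrib)
  moreover have "dirichlet R \<omega> = integral {0..R} (wave \<omega>)"
    unfolding dirichlet_def by (rule set_integral_Ico_continuous) (intro continuous_intros)
  ultimately have D: "dirichlet R \<omega> = (exp (c * of_real R) - 1) / c" by simp
  have "exp (c * of_real R) = cis (2 * \<theta>)"
    by (simp add: c_def \<theta>_def cis_conv_exp mult_ac)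
  then have "(norm (exp (c * of_real R) - 1))\<^sup>2 = (cos (2 * \<theta>) - 1)\<^sup>2 + (sin (2 * \<theta>))\<^sup>2"
    by (simp add: cmod_power2)
  also have "\<dots> = 4 * (sin \<theta>)\<^sup>2"
  proof -
    have "(cos (2 * \<theta>) - 1)\<^sup>2 + (sin (2 * \<theta>))\<^sup>2 = ((sin (2 * \<theta>))\<^sup>2 + (cos (2 * \<theta>))\<^sup>2) + 1 - 2 * cos (2 * \<theta>)"
      by (simp add: power2_eq_square algebra_simps)
    also have "\<dots> = 2 - 2 * cos (2 * \<theta>)" by (simp only: sin_cos_squared_add)
    also have "\<dots> = 4 * (sin \<theta>)\<^sup>2" using cos_double_sin[of \<theta>] by simp
    finally show ?thesis .
  qed
  finally have "(norm (dirichlet R \<omega>))\<^sup>2 = 4 * (sin \<theta>)\<^sup>2 / (norm c)\<^sup>2"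
    by (simp add: D norm_divide power_divide)
  also have "(norm c)\<^sup>2 = 4 * (pi * \<omega>)\<^sup>2"
    by (simp add: c_def norm_mult power_mult_distrib)
  also have "4 * (sin \<theta>)\<^sup>2 / (4 * (pi * \<omega>)\<^sup>2) = R\<^sup>2 * (sinc \<theta>)\<^sup>2"
    using False by (simp add: \<theta>_def power_mult_distrib power_divide field_simps)
  finally show ?thesis by (simp add: \<theta>_def)
qed

context cylindrical_tiling
begin

text \<open>From |z v| \<le> |z|^2 + |v|^2 and invariance. The bound is uniform in the two times, as
  Fubini over window positions requires.\<close>

lemma integrable_correlation:
  "integrable \<mu> (\<lambda>x. f (flow r x) * cnj (f (flow q x)))"
  "(LINT x|\<mu>. norm (f (flow r x) * cnj (f (flow q x)))) \<le> 2 * (LINT x|\<mu>. (norm (f x))\<^sup>2)"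
proof -
  have [measurable]: "(\<lambda>x. f (flow r x)) \<in> borel_measurable \<mu>" for r
    by (rule measurable_compose[OF measurable_flow f_measurable])
  have i: "integrable \<mu> (\<lambda>x. (norm (f (flow r x)))\<^sup>2)" for r by (rule integrable_flow[OF f_square])
  have b: "norm (z * cnj v) \<le> (norm z)\<^sup>2 + (norm v)\<^sup>2" for z v :: complex
    using sum_squares_bound[of "norm z" "norm v"] mult_nonneg_nonneg[OF norm_ge_zero[of z] norm_ge_zero[of v]]
    unfolding norm_mult complex_mod_cnj by linarith
  show int: "integrable \<mu> (\<lambda>x. f (flow r x) * cnj (f (flow q x)))"
  proof (rule Bochner_Integration.integrable_bound)
    show "integrable \<mu> (\<lambda>x. (norm (f (flow r x)))\<^sup>2 + (norm (f (flow q x)))\<^sup>2)" using i by simp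
    show "AE x in \<mu>. norm (f (flow r x) * cnj (f (flow q x))) \<le> norm ((norm (f (flow r x)))\<^sup>2 + (norm (f (flow q x)))\<^sup>2)"
      using b by (intro AE_I2) simp
  qed simp
  have "(LINT x|\<mu>. norm (f (flow r x) * cnj (f (flow q x)))) \<le> (LINT x|\<mu>. (norm (f (flow r x)))\<^sup>2 + (norm (f (flow q x)))\<^sup>2)"
    by (rule integral_mono) (use int i b in auto)
  also have "\<dots> = 2 * (LINT x|\<mu>. (norm (f x))\<^sup>2)"
    using i integral_flow[of "\<lambda>x. (norm (f x))\<^sup>2"] by simp
  finally show "(LINT x|\<mu>. norm (f (flow r x) * cnj (f (flow q x)))) \<le> 2 * (LINT x|\<mu>. (norm (f x))\<^sup>2)" .
qed

text \<open>The squared norm of \<open>dirichlet\<close> is a double integral of waves at a - b over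
  window positions a and b. Integrating the wave at t + a - b against \<sigma> gives a correlation
  of f, and carrying out the integrals over a and b inside the space integral turns it into a
  correlation of orbit integrals.\<close>

lemma spectral_orbit_sum:
  assumes \<sigma>: "spectral_measure \<mu> flow f \<sigma>" and R: "0 \<le> R"
  shows "(LINT \<omega>|\<sigma>. wave \<omega> t * of_real ((norm (dirichlet R \<omega>))\<^sup>2)) =
    (LINT x|\<mu>. orbit_sum R (flow t x) * cnj (orbit_sum R x))"
proof -
  have [measurable_cong]: "sets \<sigma> = sets borel" using \<sigma> by (simp add: spectral_measure_def)
  interpret \<sigma>: finite_measure \<sigma> using \<sigma> by (simp add: spectral_measure_def)
  \<comment> \<open>A finite measure on window positions, so that bounded functions are integrable
    in all the products below.\<close>
  define L where "L = restrict_space lborel {0..<R}"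
  have spL: "space L = {0..<R}" by (simp add: L_def space_restrict_space)
  have "emeasure L (space L) = ennreal R" using R by (simp add: L_def spL[unfolded L_def] emeasure_restrict_space)
  then interpret L: finite_measure L by (intro finite_measureI) simp
  have intL: "(LINT a|L. g a) = (LINT a:{0..<R}|lborel. g a)" for g :: "real \<Rightarrow> complex"
    unfolding L_def set_lebesgue_integral_def by (rule integral_restrict_space) simp
  have idL [measurable]: "(\<lambda>a. a) \<in> borel_measurable L"
    unfolding L_def by (rule measurable_restrict_space1) simp
  interpret LL: pair_sigma_finite L L ..
  interpret LLf: finite_measure "L \<Otimes>\<^sub>M L" by (rule finite_measure_pair_measure) unfold_locales
  have fst_m [measurable]: "fst \<in> borel_measurable (L \<Otimes>\<^sub>M L)" and snd_m [measurable]: "snd \<in> borel_measurable (L \<Otimes>\<^sub>M L)"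
    using measurable_compose[OF measurable_fst idL] measurable_compose[OF measurable_snd idL] by auto
  interpret \<sigma>L: pair_sigma_finite \<sigma> "L \<Otimes>\<^sub>M L" ..
  interpret \<sigma>Lf: finite_measure "\<sigma> \<Otimes>\<^sub>M (L \<Otimes>\<^sub>M L)" by (rule finite_measure_pair_measure) unfold_locales
  interpret L\<mu>: pair_sigma_finite "L \<Otimes>\<^sub>M L" \<mu> ..

  have inner: "(LINT p|(L \<Otimes>\<^sub>M L). wave \<omega> (t + fst p - snd p)) = wave \<omega> t * of_real ((norm (dirichlet R \<omega>))\<^sup>2)" for \<omega>
  proof -
    have "integrable (L \<Otimes>\<^sub>M L) (\<lambda>p. wave \<omega> (t + fst p - snd p))"
    proof (rule LLf.integrable_const_bound[where B = 1])
      show "(\<lambda>p. wave \<omega> (t + fst p - snd p)) \<in> borel_measurable (L \<Otimes>\<^sub>M L)" by measurable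
    qed simp
    from LL.integral_fst'[OF this]
    have "(LINT p|(L \<Otimes>\<^sub>M L). wave \<omega> (t + fst p - snd p)) = (LINT a|L. LINT b|L. wave \<omega> (t + a - b))"
      by (simp only: fst_conv snd_conv)
    also have "\<dots> = (LINT a|L. LINT b|L. (wave \<omega> t * wave \<omega> a) * cnj (wave \<omega> b))"
      by (simp only: wave_add_diff)
    also have "\<dots> = wave \<omega> t * ((LINT a|L. wave \<omega> a) * cnj (LINT b|L. wave \<omega> b))"
      by (simp only: integral_mult_right_zero integral_mult_left_zero Bochner_Integration.integral_cnj mult.assoc)
    also have "\<dots> = wave \<omega> t * of_real ((norm (dirichlet R \<omega>))\<^sup>2)"
      by (simp only: intL dirichlet_def[symmetric] complex_norm_square)
    finally show ?thesis .
  qed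

  define h where "h p x = f (flow (t + fst p) x) * cnj (f (flow (snd p) x))" for p :: "real \<times> real" and x
  have corr_p: "(LINT \<omega>|\<sigma>. wave \<omega> (t + fst p - snd p)) = (LINT x|\<mu>. h p x)" for p
  proof -
    define g where "g x = f (flow (t + fst p - snd p) x) * cnj (f x)" for x
    have gm: "g \<in> borel_measurable \<mu>"
      unfolding g_def using measurable_compose[OF measurable_flow f_measurable] by measurable
    have "(LINT \<omega>|\<sigma>. wave \<omega> (t + fst p - snd p)) = (LINT x|\<mu>. g x)"
      using \<sigma> unfolding spectral_measure_def g_def by blast
    \<comment> \<open>Invariance turns the single lag t + a - b into the pair of times t + a and
      b.\<close>
    also have "\<dots> = (LINT x|\<mu>. g (flow (snd p) x))" by (rule integral_flow[OF gm, symmetric])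
    also have "\<dots> = (LINT x|\<mu>. h p x)"
    proof (rule Bochner_Integration.integral_cong[OF refl])
      fix x assume "x \<in> space \<mu>"
      then show "g (flow (snd p) x) = h p x"
        using suspension_flow_add[of x "t + fst p - snd p" "snd p"] by (simp add: g_def h_def space_\<mu>)
    qed
    finally show ?thesis .
  qed

  have flow_m: "(\<lambda>q. f (flow (c q) (snd q))) \<in> borel_measurable ((L \<Otimes>\<^sub>M L) \<Otimes>\<^sub>M \<mu>)"
    if c: "c \<in> borel_measurable ((L \<Otimes>\<^sub>M L) \<Otimes>\<^sub>M \<mu>)" for c
  proof -
    have "(\<lambda>q. (c q, snd q)) \<in> (L \<Otimes>\<^sub>M L) \<Otimes>\<^sub>M \<mu> \<rightarrow>\<^sub>M lborel \<Otimes>\<^sub>M \<mu>"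
      by (rule measurable_Pair) (use c in simp_all)
    from measurable_compose[OF this measurable_compose[OF measurable_flow_joint f_measurable]]
    show ?thesis by simp
  qed
  have hm: "(\<lambda>(p, x). h p x) \<in> borel_measurable ((L \<Otimes>\<^sub>M L) \<Otimes>\<^sub>M \<mu>)"
    unfolding h_def split_beta
    using flow_m[of "\<lambda>q. t + fst (fst q)"] flow_m[of "\<lambda>q. snd (fst q)"]
      measurable_compose[OF measurable_fst fst_m] measurable_compose[OF measurable_fst snd_m] by measurable
  have h: "integrable ((L \<Otimes>\<^sub>M L) \<Otimes>\<^sub>M \<mu>) (\<lambda>(p, x). h p x)"
  proof (rule L\<mu>.Fubini_integrable[OF hm])
    show "AE p in L \<Otimes>\<^sub>M L. integrable \<mu> (\<lambda>x. case (p, x) of (p, x) \<Rightarrow> h p x)"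
      unfolding h_def prod.case by (intro AE_I2 integrable_correlation(1))
    show "integrable (L \<Otimes>\<^sub>M L) (\<lambda>p. LINT x|\<mu>. norm (case (p, x) of (p, x) \<Rightarrow> h p x))"
    proof (rule LLf.integrable_const_bound[where B = "2 * (LINT x|\<mu>. (norm (f x))\<^sup>2)"])
      show "AE p in L \<Otimes>\<^sub>M L. norm (LINT x|\<mu>. norm (case (p, x) of (p, x) \<Rightarrow> h p x)) \<le> 2 * (LINT x|\<mu>. (norm (f x))\<^sup>2)"
        unfolding h_def prod.case using integrable_correlation(2) by (intro AE_I2) (simp add: abs_of_nonneg)
      have "(\<lambda>q. norm (case q of (p, x) \<Rightarrow> h p x)) \<in> borel_measurable ((L \<Otimes>\<^sub>M L) \<Otimes>\<^sub>M \<mu>)"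
        using hm by measurable
      then show "(\<lambda>p. LINT x|\<mu>. norm (case (p, x) of (p, x) \<Rightarrow> h p x)) \<in> borel_measurable (L \<Otimes>\<^sub>M L)"
        by (intro borel_measurable_lebesgue_integral) (simp add: split_beta)
    qed
  qed

  have "(LINT \<omega>|\<sigma>. wave \<omega> t * of_real ((norm (dirichlet R \<omega>))\<^sup>2)) =
      (LINT \<omega>|\<sigma>. LINT p|(L \<Otimes>\<^sub>M L). wave \<omega> (t + fst p - snd p))"
    by (simp only: inner)
  also have "\<dots> = (LINT p|(L \<Otimes>\<^sub>M L). LINT \<omega>|\<sigma>. wave \<omega> (t + fst p - snd p))"
  proof (rule \<sigma>L.Fubini_integral[symmetric])
    show "integrable (\<sigma> \<Otimes>\<^sub>M (L \<Otimes>\<^sub>M L)) (\<lambda>(\<omega>, p). wave \<omega> (t + fst p - snd p))"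
    proof (rule \<sigma>Lf.integrable_const_bound[where B = 1])
      show "(\<lambda>(\<omega>, p). wave \<omega> (t + fst p - snd p)) \<in> borel_measurable (\<sigma> \<Otimes>\<^sub>M (L \<Otimes>\<^sub>M L))"
        unfolding split_beta
        using measurable_compose[OF measurable_snd fst_m, of \<sigma>] measurable_compose[OF measurable_snd snd_m, of \<sigma>]
        by measurable
    qed (simp add: split_beta)
  qed
  also have "\<dots> = (LINT p|(L \<Otimes>\<^sub>M L). LINT x|\<mu>. h p x)" by (simp only: corr_p)
  also have "\<dots> = (LINT x|\<mu>. LINT p|(L \<Otimes>\<^sub>M L). h p x)" by (rule L\<mu>.Fubini_integral[OF h, symmetric])
  also have "\<dots> = (LINT x|\<mu>. orbit_sum R (flow t x) * cnj (orbit_sum R x))"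
  proof (rule integral_cong_AE)
    have "(\<lambda>x. LINT p|(L \<Otimes>\<^sub>M L). h p x) \<in> borel_measurable \<mu>"
      using L\<mu>.integrable_snd[OF h] by auto
    then show "(\<lambda>x. LINT p|(L \<Otimes>\<^sub>M L). h p x) \<in> borel_measurable \<mu>" .
    have om: "orbit_sum R \<in> borel_measurable \<mu>"
    proof (cases "R = 0")
      case True
      then show ?thesis by (simp add: orbit_sum_def[abs_def] set_lebesgue_integral_def)
    next
      case False
      then show ?thesis using time_average(1)[OF f_integrable, of R] R unfolding orbit_sum_def[abs_def] by auto
    qed
    show "(\<lambda>x. orbit_sum R (flow t x) * cnj (orbit_sum R x)) \<in> borel_measurable \<mu>"
      using measurable_compose[OF measurable_flow om] om by measurable
    have "AE x in \<mu>. integrable (L \<Otimes>\<^sub>M L) (\<lambda>p. h p x)"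
      using L\<mu>.AE_integrable_snd[OF h] by simp
    moreover have "AE x in \<mu>. x \<in> suspension m \<zeta> s" by (rule AE_I2) (simp add: space_\<mu>)
    ultimately show "AE x in \<mu>. (LINT p|(L \<Otimes>\<^sub>M L). h p x) = orbit_sum R (flow t x) * cnj (orbit_sum R x)"
    proof eventually_elim
      case (elim x)
      have "(LINT p|(L \<Otimes>\<^sub>M L). h p x) = (LINT a|L. LINT b|L. h (a, b) x)"
        by (rule LL.integral_fst'[OF elim(1), symmetric])
      also have "\<dots> = (LINT a|L. f (flow (t + a) x)) * cnj (LINT b|L. f (flow b x))"
        unfolding h_def fst_conv snd_conv
        by (simp only: integral_mult_right_zero integral_mult_left_zero Bochner_Integration.integral_cnj)
      also have "\<dots> = orbit_sum R (flow t x) * cnj (orbit_sum R x)"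
        unfolding intL orbit_sum_def suspension_flow_add[OF elim(2)] ..
      finally show ?case .
    qed
  qed
  finally show ?thesis .
qed

lemma spectral_flow_corr:
  assumes \<sigma>: "spectral_measure \<mu> flow f \<sigma>" and R: "0 \<le> R" and t: "0 \<le> t"
  shows "(LINT \<omega>|\<sigma>. wave \<omega> t * of_real (R\<^sup>2 * (sinc (pi * \<omega> * R))\<^sup>2)) = (LINT x|\<mu>. flow_corr P\<^sub>0 t R x)"
proof -
  have "(LINT x|\<mu>. orbit_sum R (flow t x) * cnj (orbit_sum R x)) = (LINT x|\<mu>. flow_corr P\<^sub>0 t R x)"
    by (rule Bochner_Integration.integral_cong) (simp_all add: space_\<mu> orbit_sum_flow_corr t R)
  with spectral_orbit_sum[OF \<sigma> R, of t] show ?thesis by (simp only: norm_dirichlet[OF R])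
qed

end

section \<open>The scaling limit\<close>

text \<open>The Fejer kernel of length R: for R \<ge> 0 the squared norm of
  \<open>dirichlet R \<omega>\<close>, by \<open>norm_dirichlet\<close>.\<close>

definition weight :: "real \<Rightarrow> real \<Rightarrow> real" where
  "weight R \<omega> = R\<^sup>2 * (sinc (pi * \<omega> * R))\<^sup>2"

lemma weight_continuous: "continuous_on A (weight R)"
  unfolding weight_def by (intro continuous_intros)

lemma weight_even: "weight R (- \<omega>) = weight R \<omega>"
  by (simp add: weight_def)

lemma weight_nonneg: "0 \<le> weight R \<omega>"
  by (simp add: weight_def)

lemma weight_le: "weight R \<omega> \<le> R\<^sup>2"
proof -
  have "\<bar>sinc x\<bar> \<le> 1" for x :: real
    using abs_sin_x_le_abs_x[of x] by (auto simp: abs_divide divide_le_eq)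
  then have "(sinc x)\<^sup>2 \<le> 1" for x by (simp add: abs_square_le_1)
  from mult_left_mono[OF this[of "pi * \<omega> * R"], of "R\<^sup>2"] show ?thesis by (simp add: weight_def)
qed

text \<open>For incommensurable lengths the two Fejer kernels have no common zero.\<close>

lemma weight_pos:
  assumes R: "0 < R" and r: "0 < r" "r \<notin> \<rat>"
  shows "0 < weight R \<omega> + weight (r * R) \<omega>"
proof (rule ccontr)
  assume "\<not> 0 < weight R \<omega> + weight (r * R) \<omega>"
  then have "weight R \<omega> = 0" "weight (r * R) \<omega> = 0"
    using weight_nonneg[of R \<omega>] weight_nonneg[of "r * R" \<omega>] by auto
  then have \<omega>: "\<omega> \<noteq> 0" and "sin (pi * \<omega> * R) = 0" "sin (pi * \<omega> * (r * R)) = 0"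
    using R r by (auto simp: weight_def split: if_splits)
  then obtain i j :: int where i: "pi * \<omega> * R = of_int i * pi" and j: "pi * \<omega> * (r * R) = of_int j * pi"
    unfolding sin_zero_iff_int2 by blast
  have i': "\<omega> * R = of_int i" using i by simp
  have "\<omega> * R * r = of_int j" using j by (simp add: mult_ac)
  then have "of_int i * r = of_int j" by (simp add: i')
  moreover have "i \<noteq> 0" using i' \<omega> R by auto
  ultimately have "r = of_int j / of_int i" by (simp add: field_simps)
  then show False using r(2) by simp
qed

lemma irrational_exists: "\<exists>r::real. 0 < r \<and> r \<notin> \<rat>"
proof (rule ccontr)
  assume "\<not> (\<exists>r::real. 0 < r \<and> r \<notin> \<rat>)"
  then have "{0<..<1::real} \<subseteq> \<rat>" by auto
  then have "countable {0<..<1::real}" using countable_rat countable_subset by blast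
  then show False using uncountable_open_interval[of 0 "1::real"] by simp
qed

section \<open>Letter frequencies and positivity of the limit correlation\<close>

lemma count_list_concat: "count_list (concat (map g w)) i = (\<Sum>b\<leftarrow>w. count_list (g b) i)"
  by (induction w) simp_all

context gap_tiling
begin

lemma subst_matrix_power:
  assumes i: "i < m" shows "j < m \<Longrightarrow> (subst_matrix m \<zeta> ^\<^sub>m n) $$ (i, j) = real (count_list (sub n [j]) i)"
proof (induction n arbitrary: j)
  case 0
  then show ?case using i by (simp add: subst_matrix_def)
next
  case (Suc n)
  have A: "subst_matrix m \<zeta> \<in> carrier_mat m m" by (simp add: subst_matrix_def)
  have An: "subst_matrix m \<zeta> ^\<^sub>m n \<in> carrier_mat m m" by (rule pow_carrier_mat[OF A])
  have "(subst_matrix m \<zeta> ^\<^sub>m Suc n) $$ (i, j) = (\<Sum>l<m. (subst_matrix m \<zeta> ^\<^sub>m n) $$ (i, l) * subst_matrix m \<zeta> $$ (l, j))"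
    using A An i Suc.prems by (simp add: scalar_prod_def lessThan_atLeast0)
  also have "\<dots> = (\<Sum>l<m. of_nat (count_list (\<zeta> j) l) * real (count_list (sub n [l]) i))"
    using Suc by (intro sum.cong) (auto simp: subst_matrix_def)
  also have "\<dots> = (\<Sum>b\<leftarrow>\<zeta> j. real (count_list (sub n [b]) i))"
    by (rule sum_list_map_eq_sum_count_list[symmetric]) (use word_\<zeta>[OF Suc.prems] in auto)
  also have "\<dots> = real (count_list (sub (Suc n) [j]) i)"
  proof -
    have "(\<Sum>b\<leftarrow>w. real (count_list (sub n [b]) i)) = real (\<Sum>b\<leftarrow>w. count_list (sub n [b]) i)" for w
      by (induction w) simp_all
    then show ?thesis unfolding sub_Suc_letter count_list_concat by simp
  qed
  finally show ?case .
qed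

text \<open>A power of the matrix with positive entries puts the letter a into every block
  \<zeta>^k(b), one occurrence per letter of w.\<close>

lemma count_lower_bound:
  assumes prim: "primitive_subst m \<zeta>" and a: "a < m"
  obtains k where "\<And>w. word w \<Longrightarrow> length w \<le> count_list (sub k w) a"
proof -
  obtain k where k: "\<And>i j. i < m \<Longrightarrow> j < m \<Longrightarrow> (subst_matrix m \<zeta> ^\<^sub>m k) $$ (i, j) > 0"
    using prim by (auto simp: primitive_subst_def)
  have c: "1 \<le> count_list (sub k [b]) a" if "b < m" for b
    using k[OF a that] unfolding subst_matrix_power[OF a that] by simp
  have "length w \<le> count_list (sub k w) a" if "word w" for w
    using that
  proof (induction w)
    case (Cons b w)
    have "sub k (b # w) = sub k [b] @ sub k w" using subst_word_append[of k \<zeta> "[b]" w] by simp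
    then show ?case using Cons c[of b] by (simp add: add_mono)
  qed simp
  then show thesis by (rule that)
qed

end

context suspended_tiling
begin

text \<open>Half the length of the tile is chosen because two windows then fill the tile. If the
  increments of p over windows inside the tile all vanished, those starting at 0 and at R would give
  p(2R) = p(R) = p(0) = 0, against \<open>ne\<close>. As a recurs with positive frequency, its
  contribution survives in the average.\<close>

lemma autocorrelation_pos:
  assumes prim: "primitive_subst m \<zeta>" and p: "admissible B p" and a: "a < m" and ne: "p a (s $ a) \<noteq> 0"
  shows "0 < Re (LINT x|\<mu>. flow_corr p 0 (s $ a / 2) x)"
proof -
  define R where "R = s $ a / 2"
  have R: "0 < R" "s $ a - R = R" "R + R = s $ a" using s_pos[OF a] by (auto simp: R_def)
  define g where "g \<tau> = (norm (p a (\<tau> + R) - p a \<tau>))\<^sup>2" for \<tau>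
  define J where "J = integral {0..R} g"
  have pc: "continuous_on {0..s $ a} (p a)" by (rule admissibleD(2)[OF p a])
  have gc: "continuous_on {0..R} g"
    unfolding g_def
    by (intro continuous_intros continuous_on_compose2[OF pc]) (use R in auto)
  have J0: "0 \<le> J" unfolding J_def
    by (rule Henstock_Kurzweil_Integration.integral_nonneg[OF integrable_continuous_interval[OF gc]]) (simp add: g_def)
  have "J \<noteq> 0"
  proof
    assume "J = 0"
    then have z: "\<forall>\<tau>\<in>{0..R}. g \<tau> = 0"
      unfolding J_def by (subst (asm) integral_eq_0_iff[OF gc R(1)]) (auto simp: g_def)
    have "g 0 = 0" "g R = 0" using z R(1) by auto
    then have "p a R = p a 0" "p a (s $ a) = p a R" by (simp_all add: g_def R(3))
    then show False using ne admissibleD(1)[OF p a] by simp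
  qed
  then have J: "0 < J" using J0 by simp
  obtain k where k: "\<And>w. word w \<Longrightarrow> length w \<le> count_list (sub k w) a"
    by (rule count_lower_bound[OF prim a]) blast
  define \<kappa> where "\<kappa> = (LINT x|\<mu>. flow_corr p 0 R x)"
  \<comment> \<open>The word \<zeta>^n(0) has at least \<theta>^n s_0 / smax letters; each yields a
    copy of a in \<zeta>^(n+k)(0), which contributes J. The division is by \<theta>^(n+k).\<close>
  define b where "b = s $ 0 / smax / \<theta> ^ k * J"
  have smax: "0 < smax" using smax_ge[OF m_pos] s_pos[OF m_pos] by simp
  have b: "0 < b" using J smax s_pos[OF m_pos] \<theta>_gt_1 by (simp add: b_def)
  have "(\<lambda>n. Re (corr s p 0 R (sub (n + k) [0]) / \<theta> ^ (n + k))) \<longlonglongrightarrow> Re (\<kappa> * s $ 0)"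
    unfolding \<kappa>_def using R(1)
    by (intro tendsto_Re LIMSEQ_ignore_initial_segment[OF corr_average[OF p order_refl _ m_pos]]) simp
  moreover have "b \<le> Re (corr s p 0 R (sub (n + k) [0]) / \<theta> ^ (n + k))" for n
  proof -
    have sub: "sub (n + k) [0] = sub k (sub n [0])" by (simp add: funpow_add add.commute[of n])
    have w: "word (sub n [0])" "word (sub (n + k) [0])" by (intro word_sub_letter m_pos)+
    have "\<theta> ^ n * s $ 0 \<le> smax * length (sub n [0])"
      using wlen_le_length[OF w(1)] wlen_sub[of "[0]" n] m_pos by simp
    then have "\<theta> ^ n * s $ 0 / smax \<le> length (sub n [0])" using smax by (simp add: field_simps)
    also have "\<dots> \<le> count_list (sub (n + k) [0]) a" using k[OF w(1)] unfolding sub by simp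
    finally have "\<theta> ^ n * s $ 0 / smax * J \<le> count_list (sub (n + k) [0]) a * J"
      using J by (intro mult_right_mono) auto
    also have "\<dots> \<le> Re (corr s p 0 R (sub (n + k) [0]))"
      using corr_ge_count[OF p w(2), of R a] R s_pos[OF a] unfolding J_def g_def by simp
    finally have "\<theta> ^ n * s $ 0 / smax * J / \<theta> ^ (n + k) \<le> Re (corr s p 0 R (sub (n + k) [0])) / \<theta> ^ (n + k)"
      using \<theta>_gt_1 by (intro divide_right_mono) auto
    moreover have "\<theta> ^ n * s $ 0 / smax * J / \<theta> ^ (n + k) = b" using \<theta>_gt_1 by (simp add: b_def power_add)
    moreover have "Re (z / complex_of_real c) = Re z / c" for z c by (rule Re_divide_of_real)
    ultimately show ?thesis by simp
  qed
  ultimately have "b \<le> Re (\<kappa> * s $ 0)" by (intro LIMSEQ_le_const) auto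
  then have "0 < Re \<kappa> * s $ 0" using b by simp
  then show ?thesis using s_pos[OF m_pos] unfolding \<kappa>_def R_def by (simp add: zero_less_mult_iff)
qed

text \<open>At each point only one fixed prefix is involved, on which \<open>acc\<close> converges;
  the common bound B gives domination.\<close>

lemma tendsto_flow_corr:
  assumes P: "\<And>n. admissible B (P n)" and t: "0 \<le> t" and R: "0 \<le> R"
    and lim: "\<And>a u. a < m \<Longrightarrow> 0 \<le> u \<Longrightarrow> u \<le> s $ a \<Longrightarrow> (\<lambda>n. P n a u) \<longlonglongrightarrow> p a u" and p: "admissible B' p"
  shows "(\<lambda>n. LINT x|\<mu>. flow_corr (P n) t R x) \<longlonglongrightarrow> (LINT x|\<mu>. flow_corr p t R x)"
proof (rule integral_dominated_convergence[where w = "\<lambda>_. qbound B R"])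
  show "flow_corr p t R \<in> borel_measurable \<mu>" by (rule measurable_flow_corr[OF p t R])
  show "flow_corr (P n) t R \<in> borel_measurable \<mu>" for n by (rule measurable_flow_corr[OF P t R])
  show "AE x in \<mu>. norm (flow_corr (P n) t R x) \<le> qbound B R" for n
    by (rule AE_I2) (simp add: space_\<mu> flow_corr_bound[OF P t R])
  show "AE x in \<mu>. (\<lambda>n. flow_corr (P n) t R x) \<longlonglongrightarrow> flow_corr p t R x"
  proof (rule AE_I2)
    fix x assume "x \<in> space \<mu>"
    then have "fst x \<in> subst_space m \<zeta>" by (auto simp: space_\<mu> suspension_def)
    then have w: "word (pre (fst x) n)" for n by (rule word_pre)
    show "(\<lambda>n. flow_corr (P n) t R x) \<longlonglongrightarrow> flow_corr p t R x"
      unfolding flow_corr_def corr_density_def by (intro tendsto_intros tendsto_acc lim w) auto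
  qed
qed simp

lemma flow_corr_right_continuous:
  assumes p: "admissible B p" and R: "0 \<le> R"
  shows "((\<lambda>t. LINT x|\<mu>. flow_corr p t R x) \<longlongrightarrow> (LINT x|\<mu>. flow_corr p 0 R x)) (at_right 0)"
proof (rule tendsto_at_right_sequentially[of 0 1])
  fix t :: "nat \<Rightarrow> real"
  assume t: "\<And>n. 0 < t n" "\<And>n. t n < 1" and t0: "t \<longlonglongrightarrow> 0"
  show "(\<lambda>n. LINT x|\<mu>. flow_corr p (t n) R x) \<longlonglongrightarrow> (LINT x|\<mu>. flow_corr p 0 R x)"
  proof (rule integral_dominated_convergence[where w = "\<lambda>_. qbound B R"])
    show "flow_corr p 0 R \<in> borel_measurable \<mu>" by (rule measurable_flow_corr[OF p order_refl R])
    show "flow_corr p (t n) R \<in> borel_measurable \<mu>" for n by (rule measurable_flow_corr[OF p less_imp_le[OF t(1)] R])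
    show "AE x in \<mu>. norm (flow_corr p (t n) R x) \<le> qbound B R" for n
      by (rule AE_I2) (simp add: space_\<mu> flow_corr_bound[OF p less_imp_le[OF t(1)] R])
    show "AE x in \<mu>. (\<lambda>n. flow_corr p (t n) R x) \<longlonglongrightarrow> flow_corr p 0 R x"
    proof (rule AE_I2)
      fix x assume "x \<in> space \<mu>"
      then obtain y u where x: "x = (y, u)" and yu: "(y, u) \<in> suspension m \<zeta> s"
        unfolding space_\<mu> by (cases x) auto
      \<comment> \<open>The prefix read by \<open>flow_corr\<close> depends on t; this one serves
        all t in [0, 1] and leaves continuity of a single \<open>acc\<close>.\<close>
      define w where "w = pre y (window (1 + R))"
      have w: "word w" unfolding w_def by (rule word_pre[OF suspension_sequence[OF yu]])
      have n: "u + 1 + R \<le> wlen s w"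
        using wlen_window[OF suspension_sequence[OF yu], of "1 + R"] suspension_height[OF yu] by (simp add: w_def)
      have Gt: "flow_corr p r R x = corr_density s p r R w u" if "0 \<le> r" "r \<le> 1" for r
        unfolding x w_def using n that by (intro flow_corr_eq[OF p _ R yu]) (auto simp: w_def)
      have c: "continuous_on UNIV (acc s p w)"
        by (rule continuous_acc[of p, OF admissibleD(1)[OF p] admissibleD(2)[OF p] w])
      have "isCont (acc s p w) v" for v using c by (simp add: continuous_on_eq_continuous_at)
      then have a: "(\<lambda>n. acc s p w (g n)) \<longlonglongrightarrow> acc s p w v" if "g \<longlonglongrightarrow> v" for g v
        using that by (rule isCont_tendsto_compose)
      have "(\<lambda>n. corr_density s p (t n) R w u) \<longlonglongrightarrow> corr_density s p 0 R w u"
        unfolding corr_density_def by (intro tendsto_intros a t0)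
      then show "(\<lambda>n. flow_corr p (t n) R x) \<longlonglongrightarrow> flow_corr p 0 R x"
        using Gt[of 0] Gt[OF less_imp_le[OF t(1)] less_imp_le[OF t(2)]] by simp
    qed
  qed simp
qed simp

end

section \<open>Nonzero limit of the tile totals, and the limit measure\<close>

context cylindrical_tiling
begin

text \<open>The totals of \<zeta>^n(j) form a row vector that is multiplied by S from the right at
  each step. Its pairing with the right eigenvector \<open>e\<^sub>2\<close> therefore grows by
  exactly \<open>\<theta>\<^sub>2\<close>, and the normalised pairing keeps its initial value
  \<open>m_Phi m s e\<^sub>2 \<psi>\<close>.\<close>

lemma ends_limit:
  assumes mean: "(LINT x|\<mu>. f x) = 0" and e\<^sub>2: "eigenvector (subst_matrix m \<zeta>) e\<^sub>2 \<theta>\<^sub>2"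
    and ne: "m_Phi m s e\<^sub>2 \<psi> \<noteq> 0"
  obtains l a where "\<And>a. a < m \<Longrightarrow> (\<lambda>n. nlev \<theta>\<^sub>2 P\<^sub>0 n a (s $ a)) \<longlonglongrightarrow> l a" "a < m" "l a \<noteq> 0"
proof -
  define x where "x n j = tot s P\<^sub>0 (sub n [j])" for n j
  have rec: "x (Suc n) j = (\<Sum>i<m. x n i * S\<^sub>C $$ (i, j))" if "j < m" for n j
  proof -
    have "tot s P\<^sub>0 (concat (map (\<lambda>b. sub n [b]) w)) = (\<Sum>b\<leftarrow>w. tot s P\<^sub>0 (sub n [b]))" for w
      by (induction w) simp_all
    then show ?thesis unfolding row_times_subst_matrix[OF that] unfolding x_def sub_Suc_letter by simp
  qed
  have small: "(\<lambda>n. x n j / \<theta> ^ n) \<longlonglongrightarrow> 0" if "j < m" for j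
    unfolding x_def by (rule zero_mean_total[OF mean that])
  have conv: "convergent (\<lambda>n. x n j / \<theta>\<^sub>2 ^ n)" if "j < m" for j
    by (rule subdominant_row_iteration[where m = m and A = "S\<^sub>C" and x = x and \<theta> = \<theta> and zs = zs,
          OF S\<^sub>C_carrier char_poly_S\<^sub>C zs_less _ \<theta>\<^sub>2_less rec small that]) (use \<theta>\<^sub>2_gt_1 in auto)
  then obtain l where l: "\<And>j. j < m \<Longrightarrow> (\<lambda>n. x n j / \<theta>\<^sub>2 ^ n) \<longlonglongrightarrow> l j"
    unfolding convergent_def by metis
  have x_nlev: "nlev \<theta>\<^sub>2 P\<^sub>0 n a (s $ a) = x n a / \<theta>\<^sub>2 ^ n" if "a < m" for n a
  proof -
    have "word [a]" using that by simp
    from tot_lev[of P\<^sub>0, OF admissibleD(1)[OF P\<^sub>0_admissible] this, of n] show ?thesis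
      by (simp add: nlev_def x_def)
  qed
  define e where "e j = complex_of_real (e\<^sub>2 $ j)" for j
  have dim: "e\<^sub>2 \<in> carrier_vec m" and ev: "subst_matrix m \<zeta> *\<^sub>v e\<^sub>2 = \<theta>\<^sub>2 \<cdot>\<^sub>v e\<^sub>2"
    using e\<^sub>2 by (auto simp: eigenvector_def subst_matrix_def)
  have Se: "(\<Sum>j<m. S\<^sub>C $$ (i, j) * e j) = \<theta>\<^sub>2 * e i" if i: "i < m" for i
  proof -
    have "(subst_matrix m \<zeta> *\<^sub>v e\<^sub>2) $ i = (\<Sum>j<m. subst_matrix m \<zeta> $$ (i, j) * e\<^sub>2 $ j)"
      using i dim by (simp add: subst_matrix_def scalar_prod_def lessThan_atLeast0)
    also have "(subst_matrix m \<zeta> *\<^sub>v e\<^sub>2) $ i = \<theta>\<^sub>2 * e\<^sub>2 $ i" unfolding ev using i dim by simp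
    finally have eq: "\<theta>\<^sub>2 * e\<^sub>2 $ i = (\<Sum>j<m. subst_matrix m \<zeta> $$ (i, j) * e\<^sub>2 $ j)" .
    have "complex_of_real (\<Sum>j<m. subst_matrix m \<zeta> $$ (i, j) * e\<^sub>2 $ j) = \<theta>\<^sub>2 * e i"
      unfolding eq[symmetric] e_def by simp
    moreover have "(\<Sum>j<m. S\<^sub>C $$ (i, j) * e j) = (\<Sum>j<m. complex_of_real (subst_matrix m \<zeta> $$ (i, j) * e\<^sub>2 $ j))"
      using i by (intro sum.cong) (auto simp: e_def subst_matrix_def)
    ultimately show ?thesis by simp
  qed
  have xe: "(\<Sum>j<m. x n j * e j) = \<theta>\<^sub>2 ^ n * (\<Sum>j<m. x 0 j * e j)" for n
  proof (induction n)
    case (Suc n)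
    have "(\<Sum>j<m. x (Suc n) j * e j) = (\<Sum>j<m. \<Sum>i<m. x n i * (S\<^sub>C $$ (i, j) * e j))"
      by (intro sum.cong) (auto simp: rec sum_distrib_right mult.assoc)
    also have "\<dots> = (\<Sum>i<m. x n i * (\<Sum>j<m. S\<^sub>C $$ (i, j) * e j))"
      by (subst sum.swap) (simp only: sum_distrib_left)
    also have "\<dots> = (\<Sum>i<m. \<theta>\<^sub>2 * (x n i * e i))" by (intro sum.cong) (auto simp: Se)
    also have "\<dots> = \<theta>\<^sub>2 * (\<Sum>i<m. x n i * e i)" by (simp only: sum_distrib_left)
    finally show ?case by (simp only: Suc.IH) simp
  qed simp
  have "(\<Sum>j<m. x 0 j * e j) = m_Phi m s e\<^sub>2 \<psi>"
    unfolding m_Phi_def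
  proof (rule sum.cong[OF refl])
    fix j assume "j \<in> {..<m}"
    then have "(LINT t:{0..s $ j}|lborel. \<psi> j t) = integral {0..s $ j} (\<psi> j)"
      by (intro set_borel_integral_eq_integral \<psi>_integrable) simp
    then show "x 0 j * e j = complex_of_real (e\<^sub>2 $ j) * (LINT t:{0..s $ j}|lborel. \<psi> j t)"
      by (simp add: x_def e_def P\<^sub>0_def)
  qed
  moreover have "(\<lambda>n. \<Sum>j<m. x n j / \<theta>\<^sub>2 ^ n * e j) \<longlonglongrightarrow> (\<Sum>j<m. l j * e j)"
    by (intro tendsto_intros l) auto
  moreover have "(\<Sum>j<m. x n j / \<theta>\<^sub>2 ^ n * e j) = (\<Sum>j<m. x 0 j * e j)" for n
  proof -
    have "(\<Sum>j<m. x n j / \<theta>\<^sub>2 ^ n * e j) = (\<Sum>j<m. x n j * e j) / \<theta>\<^sub>2 ^ n" by (simp add: sum_divide_distrib)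
    then show ?thesis using \<theta>\<^sub>2_gt_1 by (subst (asm) xe) simp
  qed
  ultimately have "(\<lambda>n::nat. m_Phi m s e\<^sub>2 \<psi>) \<longlonglongrightarrow> (\<Sum>j<m. l j * e j)" by simp
  then have "m_Phi m s e\<^sub>2 \<psi> = (\<Sum>j<m. l j * e j)" by (simp only: LIMSEQ_const_iff)
  with ne obtain a where "a < m" "l a \<noteq> 0" by (metis (no_types, lifting) lessThan_iff mult_zero_left sum.neutral)
  with l show thesis using that[of l a] x_nlev by simp
qed

lemma scaled_spectral_limit:
  assumes mean: "(LINT x|\<mu>. f x) = 0" and e\<^sub>2: "eigenvector (subst_matrix m \<zeta>) e\<^sub>2 \<theta>\<^sub>2"
    and ne: "m_Phi m s e\<^sub>2 \<psi> \<noteq> 0" and prim: "primitive_subst m \<zeta>" and \<sigma>: "spectral_measure \<mu> flow f \<sigma>"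
  shows "\<exists>\<eta> :: real measure. sets \<eta> = sets borel \<and> sigma_finite_measure \<eta> \<and> emeasure \<eta> UNIV \<noteq> 0 \<and>
    (\<forall>c>0. emeasure \<eta> {c} = 0 \<longrightarrow>
      (\<lambda>N. ennreal ((\<theta> / \<theta>\<^sub>2) ^ (2 * N) * measure \<sigma> {- c / \<theta> ^ N..c / \<theta> ^ N})) \<longlonglongrightarrow> emeasure \<eta> {- c..c})"
proof -
  have s\<sigma> [measurable_cong, simp]: "sets \<sigma> = sets borel" using \<sigma> by (simp add: spectral_measure_def)
  have sp\<sigma> [simp]: "space \<sigma> = UNIV" using sets_eq_imp_space_eq[OF s\<sigma>] by simp
  interpret \<sigma>: finite_measure \<sigma> using \<sigma> by (simp add: spectral_measure_def)
  obtain l a where l: "\<And>a. a < m \<Longrightarrow> (\<lambda>n. nlev \<theta>\<^sub>2 P\<^sub>0 n a (s $ a)) \<longlonglongrightarrow> l a" and a: "a < m" "l a \<noteq> 0"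
    using ends_limit[OF mean e\<^sub>2 ne] by metis
  obtain p B where p: "admissible B p" and nl: "\<And>n. admissible B (nlev \<theta>\<^sub>2 P\<^sub>0 n)"
    and lim: "\<And>a u. a < m \<Longrightarrow> 0 \<le> u \<Longrightarrow> u \<le> s $ a \<Longrightarrow> (\<lambda>n. nlev \<theta>\<^sub>2 P\<^sub>0 n a u) \<longlonglongrightarrow> p a u"
    and pl: "\<And>a. a < m \<Longrightarrow> p a (s $ a) = l a"
    using nlev_limit[OF P\<^sub>0_admissible \<theta>\<^sub>2_gt_1 l] by metis
  obtain r :: real where r: "0 < r" "r \<notin> \<rat>" using irrational_exists by blast
  \<comment> \<open>The length demanded by \<open>autocorrelation_pos\<close> for a tile with
    nonzero limit total; it makes \<open>\<phi> 0\<close> positive.\<close>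
  define R where "R = s $ a / 2"
  have R: "0 < R" "0 < r * R" using s_pos[OF a(1)] r by (auto simp: R_def)
  define w where "w \<xi> = weight R \<xi> + weight (r * R) \<xi>" for \<xi>
  define c where "c N = (\<theta> / \<theta>\<^sub>2) ^ (2 * N)" for N :: nat
  have c: "0 < c N" for N using \<theta>_gt_1 \<theta>\<^sub>2_gt_1 by (simp add: c_def)
  define \<nu> where "\<nu> N = density (distr \<sigma> borel (\<lambda>\<omega>. \<theta> ^ N * \<omega>)) (\<lambda>_. ennreal (c N))" for N
  \<comment> \<open>Division by 2 pi converts between e^(itx) of characteristic functions and e^(2
    pi i \<omega> t) of spectral measures.\<close>
  define \<phi> where "\<phi> t = Re (LINT x|\<mu>. flow_corr p (t / (2 * pi)) R x) + Re (LINT x|\<mu>. flow_corr p (t / (2 * pi)) (r * R) x)" for t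
  \<comment> \<open>In the original frequency the weight is \<theta>^(-2N) times the Fejer kernel of
    length \<theta>^N Q. Together with \<open>c N\<close> this leaves
    \<open>(1 / \<theta>\<^sub>2 ^ N)\<^sup>2\<close>, exactly the factor that turns correlations of
    \<open>lev\<close> into those of \<open>nlev\<close>.\<close>
  have wave_weight: "(CLINT \<xi>|\<nu> N. iexp (t * \<xi>) * weight Q \<xi>) = (LINT x|\<mu>. flow_corr (nlev \<theta>\<^sub>2 P\<^sub>0 N) (t / (2 * pi)) Q x)"
    if t: "0 \<le> t" and Q: "0 \<le> Q" for N t Q
  proof -
    have \<theta>N: "0 < \<theta> ^ N" using \<theta>_gt_1 by simp
    have wm [measurable]: "weight Q \<in> borel_measurable borel"
      by (rule borel_measurable_continuous_onI[OF weight_continuous])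
    have "(CLINT \<xi>|\<nu> N. iexp (t * \<xi>) * weight Q \<xi>) =
        (CLINT \<omega>|\<sigma>. c N *\<^sub>R (iexp (t * (\<theta> ^ N * \<omega>)) * weight Q (\<theta> ^ N * \<omega>)))"
      unfolding \<nu>_def by (subst integral_density) (auto simp: c less_imp_le integral_distr)
    also have "\<dots> = (CLINT \<omega>|\<sigma>. complex_of_real (c N / \<theta> ^ (2 * N)) *
        (wave \<omega> (\<theta> ^ N * (t / (2 * pi))) * of_real ((\<theta> ^ N * Q)\<^sup>2 * (sinc (pi * \<omega> * (\<theta> ^ N * Q)))\<^sup>2)))"
    proof (rule Bochner_Integration.integral_cong[OF refl])
      fix \<omega>
      have e: "iexp (t * (\<theta> ^ N * \<omega>)) = wave \<omega> (\<theta> ^ N * (t / (2 * pi)))" by (simp add: mult_ac)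
      have "weight Q (\<theta> ^ N * \<omega>) = (1 / \<theta> ^ (2 * N)) * ((\<theta> ^ N * Q)\<^sup>2 * (sinc (pi * \<omega> * (\<theta> ^ N * Q)))\<^sup>2)"
      proof -
        have "Q\<^sup>2 * z = (1 / \<theta> ^ (2 * N)) * ((\<theta> ^ N * Q)\<^sup>2 * z)" for z
          using \<theta>_gt_1 by (simp add: power_mult_distrib power_even_eq)
        moreover have "pi * (\<theta> ^ N * \<omega>) * Q = pi * \<omega> * (\<theta> ^ N * Q)" by simp
        ultimately show ?thesis unfolding weight_def by presburger
      qed
      then show "c N *\<^sub>R (iexp (t * (\<theta> ^ N * \<omega>)) * weight Q (\<theta> ^ N * \<omega>)) = complex_of_real (c N / \<theta> ^ (2 * N)) *
          (wave \<omega> (\<theta> ^ N * (t / (2 * pi))) * of_real ((\<theta> ^ N * Q)\<^sup>2 * (sinc (pi * \<omega> * (\<theta> ^ N * Q)))\<^sup>2))"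
        unfolding e by (simp only: scaleR_conv_of_real of_real_mult of_real_divide of_real_1) (simp add: mult_ac)
    qed
    also have "\<dots> = complex_of_real (c N / \<theta> ^ (2 * N)) * (LINT x|\<mu>. flow_corr P\<^sub>0 (\<theta> ^ N * (t / (2 * pi))) (\<theta> ^ N * Q) x)"
      unfolding integral_mult_right_zero
      by (subst spectral_flow_corr[OF \<sigma>]) (use t Q \<theta>N in auto)
    also have "c N / \<theta> ^ (2 * N) = (1 / \<theta>\<^sub>2 ^ N)\<^sup>2"
      using \<theta>_gt_1 by (simp add: c_def power_divide power_even_eq)
    also have "(LINT x|\<mu>. flow_corr P\<^sub>0 (\<theta> ^ N * (t / (2 * pi))) (\<theta> ^ N * Q) x) = (LINT x|\<mu>. flow_corr (lev P\<^sub>0 N) (t / (2 * pi)) Q x)"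
    proof (rule flow_corr_renormalize[OF P\<^sub>0_admissible _ Q])
      show "0 \<le> t / (2 * pi)" using t by simp
      have "norm (lev P\<^sub>0 N a u) \<le> \<theta>\<^sub>2 ^ N * B" if "a < m" "u \<in> {0..s $ a}" for a u
        using admissibleD(3)[OF nl that(1), of u N] that(2) \<theta>\<^sub>2_gt_1
        by (simp add: nlev_def norm_divide norm_power field_simps)
      then show "admissible (\<theta>\<^sub>2 ^ N * B) (lev P\<^sub>0 N)"
        unfolding admissible_def
        using lev_zero[of P\<^sub>0, OF admissibleD(1)[OF P\<^sub>0_admissible]]
          lev_continuous[of P\<^sub>0, OF admissibleD(1,2)[OF P\<^sub>0_admissible]] by auto
    qed
    also have "complex_of_real ((1 / \<theta>\<^sub>2 ^ N)\<^sup>2) * (LINT x|\<mu>. flow_corr (lev P\<^sub>0 N) (t / (2 * pi)) Q x) =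
        (LINT x|\<mu>. flow_corr (nlev \<theta>\<^sub>2 P\<^sub>0 N) (t / (2 * pi)) Q x)"
    proof -
      have "nlev \<theta>\<^sub>2 P\<^sub>0 N = (\<lambda>a u. complex_of_real (1 / \<theta>\<^sub>2 ^ N) * lev P\<^sub>0 N a u)"
        by (intro ext) (simp add: nlev_def)
      moreover have "(norm (complex_of_real (1 / \<theta>\<^sub>2 ^ N)))\<^sup>2 = (1 / \<theta>\<^sub>2 ^ N)\<^sup>2" by (simp only: norm_of_real power2_abs)
      ultimately show ?thesis by (simp only: flow_corr_scale integral_mult_right_zero)
    qed
    finally show ?thesis .
  qed
  have f\<nu>: "finite_measure (\<nu> N)" for N
  proof -
    interpret D: finite_measure "distr \<sigma> borel (\<lambda>\<omega>. \<theta> ^ N * \<omega>)" by (rule \<sigma>.finite_measure_distr) measurable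
    show ?thesis unfolding \<nu>_def
      by (rule finite_measureI) (simp add: emeasure_density_const ennreal_mult_eq_top_iff D.emeasure_finite del: emeasure_distr)
  qed
  have s\<nu>: "sets (\<nu> N) = sets borel" for N by (simp add: \<nu>_def)
  have "\<exists>\<eta> :: real measure. sets \<eta> = sets borel \<and> sigma_finite_measure \<eta> \<and> emeasure \<eta> UNIV \<noteq> 0 \<and>
    (\<forall>c>0. emeasure \<eta> {c} = 0 \<longrightarrow> (\<lambda>N. ennreal (measure (\<nu> N) {- c..c})) \<longlonglongrightarrow> emeasure \<eta> {- c..c})"
  proof (rule vague_limit_measure[where w = w and \<phi> = \<phi> and B = "R\<^sup>2 + (r * R)\<^sup>2"])
    show "finite_measure (\<nu> N)" "sets (\<nu> N) = sets borel" for N by (rule f\<nu> s\<nu>)+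
    show "continuous_on UNIV w" unfolding w_def by (intro continuous_intros weight_continuous)
    show "0 < w \<xi>" for \<xi> unfolding w_def by (rule weight_pos[OF R(1) r])
    show "w \<xi> \<le> R\<^sup>2 + (r * R)\<^sup>2" for \<xi> unfolding w_def by (intro add_mono weight_le)
    show "w (- \<xi>) = w \<xi>" for \<xi> unfolding w_def by (simp only: weight_even)
    have r0: "0 \<le> R" "0 \<le> r * R" using R by auto
    show "(\<lambda>N. Re (CLINT \<xi>|\<nu> N. iexp (t * \<xi>) * w \<xi>)) \<longlonglongrightarrow> \<phi> t" if t: "0 \<le> t" for t
    proof -
      have "(CLINT \<xi>|\<nu> N. iexp (t * \<xi>) * w \<xi>) =
          (LINT x|\<mu>. flow_corr (nlev \<theta>\<^sub>2 P\<^sub>0 N) (t / (2 * pi)) R x) + (LINT x|\<mu>. flow_corr (nlev \<theta>\<^sub>2 P\<^sub>0 N) (t / (2 * pi)) (r * R) x)" for N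
      proof -
        interpret \<nu>: finite_measure "\<nu> N" by (rule f\<nu>)
        have "integrable (\<nu> N) (\<lambda>\<xi>. iexp (t * \<xi>) * weight Q \<xi>)" for Q
        proof (rule \<nu>.integrable_const_bound[where B = "Q\<^sup>2"])
          show "AE \<xi> in \<nu> N. norm (iexp (t * \<xi>) * weight Q \<xi>) \<le> Q\<^sup>2"
            by (intro AE_I2) (simp add: norm_mult weight_le weight_nonneg)
          have [measurable]: "weight Q \<in> borel_measurable borel"
            by (rule borel_measurable_continuous_onI[OF weight_continuous])
          show "(\<lambda>\<xi>. iexp (t * \<xi>) * weight Q \<xi>) \<in> borel_measurable (\<nu> N)"
            unfolding measurable_cong_sets[OF s\<nu> refl] by measurable
        qed
        then show ?thesis
          unfolding wave_weight[OF t r0(1), symmetric] wave_weight[OF t r0(2), symmetric] w_def of_real_add distrib_left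
          by (intro Bochner_Integration.integral_add)
      qed
      then show ?thesis unfolding \<phi>_def plus_complex.simps(1)[symmetric]
        using t by (simp only:) (intro tendsto_intros tendsto_flow_corr[OF nl _ _ lim p] r0; simp)
    qed
    show "(\<phi> \<longlongrightarrow> \<phi> 0) (at_right 0)"
    proof -
      have sc: "filterlim (\<lambda>t. t / (2 * pi)) (at_right 0) (at_right 0)"
        unfolding filterlim_at by (auto intro!: tendsto_eq_intros simp: eventually_at_filter)
      have "((\<lambda>t. LINT x|\<mu>. flow_corr p (t / (2 * pi)) Q x) \<longlongrightarrow> (LINT x|\<mu>. flow_corr p (0 / (2 * pi)) Q x)) (at_right 0)" if "0 \<le> Q" for Q
        using filterlim_compose[OF flow_corr_right_continuous[OF p that] sc] by simp
      then show ?thesis unfolding \<phi>_def using r0 by (intro tendsto_intros)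
    qed
    have "0 < Re (LINT x|\<mu>. flow_corr p 0 R x)"
      unfolding R_def by (rule autocorrelation_pos[OF prim p a(1)]) (simp add: pl a)
    \<comment> \<open>The second kernel has to keep w positive, not to add mass; at lag 0 its
      correlation is the mean of a squared norm.\<close>
    moreover have "0 \<le> Re (LINT x|\<mu>. flow_corr p 0 (r * R) x)"
    proof -
      have "0 \<le> (LINT x|\<mu>. Re (flow_corr p 0 (r * R) x))"
      proof (rule Bochner_Integration.integral_nonneg)
        have z: "0 \<le> Re (z * cnj z)" for z by simp
        show "0 \<le> Re (flow_corr p 0 (r * R) x)" for x
          unfolding flow_corr_def corr_density_def add_0_right by (rule z)
      qed
      then show ?thesis using integral_Re[OF integrable_flow_corr[OF p order_refl r0(2)]] by simp
    qed
    ultimately show "0 < \<phi> 0" by (simp add: \<phi>_def)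
  qed
  moreover have "measure (\<nu> N) {- d..d} = (\<theta> / \<theta>\<^sub>2) ^ (2 * N) * measure \<sigma> {- d / \<theta> ^ N..d / \<theta> ^ N}" for N d
  proof -
    have \<theta>N: "0 < \<theta> ^ N" using \<theta>_gt_1 by simp
    have "measure (\<nu> N) {- d..d} = c N * measure (distr \<sigma> borel (\<lambda>\<omega>. \<theta> ^ N * \<omega>)) {- d..d}"
      unfolding \<nu>_def using c[of N] by (subst measure_density_const) (auto simp: less_imp_le)
    also have "measure (distr \<sigma> borel (\<lambda>\<omega>. \<theta> ^ N * \<omega>)) {- d..d} = measure \<sigma> ((\<lambda>\<omega>. \<theta> ^ N * \<omega>) -` {- d..d} \<inter> space \<sigma>)"
      by (rule measure_distr) auto
    also have "(\<lambda>\<omega>. \<theta> ^ N * \<omega>) -` {- d..d} \<inter> space \<sigma> = {- d / \<theta> ^ N..d / \<theta> ^ N}"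
      using \<theta>N by (auto simp: field_simps)
    finally show ?thesis by (simp add: c_def)
  qed
  ultimately show ?thesis by (simp only:)
qed

end

theorem theorem6p2:
  fixes m :: nat and \<zeta> :: "nat \<Rightarrow> nat list"
    and \<theta> \<theta>\<^sub>2 \<alpha> :: real and \<theta>s :: "complex list"
    and s e\<^sub>2 :: "real vec"
    and \<mu> :: "((int \<Rightarrow> nat) \<times> real) measure"
    and f :: "(int \<Rightarrow> nat) \<times> real \<Rightarrow> complex"
    and \<psi> :: "nat \<Rightarrow> real \<Rightarrow> complex"
    and \<sigma> :: "real measure"
  assumes "m \<ge> 2"
    and "substitution m \<zeta>" and "primitive_subst m \<zeta>" and "aperiodic_subst m \<zeta>"
    and "eigenvalue_list (subst_matrix m \<zeta>) (complex_of_real \<theta> # complex_of_real \<theta>\<^sub>2 # \<theta>s)"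
    and "\<theta> > \<theta>\<^sub>2" and "\<forall>z\<in>set \<theta>s. \<theta>\<^sub>2 > cmod z"
    and "sorted_wrt (\<lambda>z w. cmod z \<ge> cmod w) \<theta>s" and "\<theta>\<^sub>2 > 1"
    and "eigenvector (transpose_mat (subst_matrix m \<zeta>)) s \<theta>" and "\<forall>j<m. s $ j > 0"
    and "eigenvector (subst_matrix m \<zeta>) e\<^sub>2 \<theta>\<^sub>2"
    and "invariant_prob m \<zeta> s \<mu>"
    and "square_integrable \<mu> f" and "cylindrical m \<zeta> s \<psi> f"
    and "(LINT x|\<mu>. f x) = 0" and "m_Phi m s e\<^sub>2 \<psi> \<noteq> 0"
    and "spectral_measure \<mu> (suspension_flow s) f \<sigma>"
    and "\<alpha> = log \<theta> \<theta>\<^sub>2"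
  shows "\<exists>\<eta> :: real measure.
           sets \<eta> = sets borel \<and> sigma_finite_measure \<eta> \<and> emeasure \<eta> UNIV \<noteq> 0 \<and>
           (\<forall>c>0. emeasure \<eta> {c} = 0 \<longrightarrow>
              (\<lambda>N. ennreal (measure \<sigma> {- c * \<theta> powr (- real N) .. c * \<theta> powr (- real N)}
                     / \<theta> powr (- real N * (2 - 2 * \<alpha>))))
              \<longlonglongrightarrow> emeasure \<eta> {- c..c})"
proof -
  note m = assms(1) and sub = assms(2) and ev = assms(5) and s = assms(10)
  have "\<theta> > 1" using assms(6,9) by simp
  have S: "subst_matrix m \<zeta> \<in> carrier_mat m m" by (simp add: subst_matrix_def)
  \<comment> \<open>Coordinate j of the transposed matrix applied to s counts the letters of
    \<open>\<zeta> j\<close> weighted by their lengths.\<close>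
  have wl: "wlen s (\<zeta> j) = \<theta> * s $ j" if j: "j < m" for j
  proof -
    have dim: "s \<in> carrier_vec m" and eq: "transpose_mat (subst_matrix m \<zeta>) *\<^sub>v s = \<theta> \<cdot>\<^sub>v s"
      using s S by (auto simp: eigenvector_def)
    have "wlen s (\<zeta> j) = (\<Sum>i<m. of_nat (count_list (\<zeta> j) i) * s $ i)"
      unfolding wlen_def
      by (rule sum_list_map_eq_sum_count_list) (use sub j in \<open>auto simp: substitution_def\<close>)
    also have "\<dots> = (transpose_mat (subst_matrix m \<zeta>) *\<^sub>v s) $ j"
      using j dim by (simp add: subst_matrix_def scalar_prod_def lessThan_atLeast0)
    also have "\<dots> = \<theta> * s $ j" unfolding eq using j dim by simp
    finally show ?thesis .
  qed
  interpret cylindrical_tiling m \<zeta> s \<theta> \<theta>\<^sub>2 \<theta>s \<mu> \<psi> f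
    using assms wl \<open>\<theta> > 1\<close> by unfold_locales auto
  \<comment> \<open>This turns the real exponent into integer powers: the denominator becomes
    \<open>(\<theta>\<^sub>2 / \<theta>) ^ (2 * N)\<close>, the reciprocal of the factor in
    \<open>scaled_spectral_limit\<close>.\<close>
  have th: "\<theta> powr \<alpha> = \<theta>\<^sub>2" using assms(6,9,19) \<open>\<theta> > 1\<close> by (simp add: powr_log_cancel)
  have pN: "\<theta> powr (- real N) = 1 / \<theta> ^ N" for N
    using \<open>\<theta> > 1\<close> by (simp add: powr_minus powr_realpow divide_inverse)
  have rate: "\<theta> powr (- real N * (2 - 2 * \<alpha>)) = (\<theta>\<^sub>2 / \<theta>) ^ (2 * N)" for N
  proof -
    have "\<theta> powr (- real N * (2 - 2 * \<alpha>)) = \<theta> powr (- real (2 * N) + \<alpha> * real (2 * N))"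
      by (simp add: algebra_simps)
    also have "\<dots> = \<theta> powr (- real (2 * N)) * (\<theta> powr \<alpha>) powr real (2 * N)"
      by (simp only: powr_add powr_powr)
    also have "\<dots> = 1 / \<theta> ^ (2 * N) * \<theta>\<^sub>2 ^ (2 * N)"
      unfolding th pN using assms(9) by (simp only: powr_realpow)
    finally show ?thesis by (simp add: power_divide)
  qed
  have scaled: "measure \<sigma> {- c * \<theta> powr (- real N) .. c * \<theta> powr (- real N)} / \<theta> powr (- real N * (2 - 2 * \<alpha>)) =
      (\<theta> / \<theta>\<^sub>2) ^ (2 * N) * measure \<sigma> {- c / \<theta> ^ N..c / \<theta> ^ N}" for c N
    unfolding rate pN by (simp add: power_divide)
  show ?thesis
    unfolding scaled by (rule scaled_spectral_limit) (use assms in auto)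
qed

end
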